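(* Let $C_4 = \{[X:Y:Z]\in\mathbb{P}^2 \mid X^4+Y^4+Z^4=0\}$, a smooth plane quartic over $\mathbb{Q}$. Let $d\in\mathbb{Z}$ be an integer. The scheme $\mathrm{Pic}^{2d+1}_{C_4/\mathbb{Q}}$ has no $\mathbb{Q}$-rational point. In other words, $\mathrm{Pic}^{2d+1}_{C_4/\mathbb{Q}}$ is a non-trivial torsor under $\mathrm{Jac}(C_4)$.
   Context: $\mathrm{Pic}_{C_4/\mathbb{Q}}$ is the Picard scheme of $C_4$ over $\mathbb{Q}$, representing the relative Picard functor; $\mathrm{Pic}^{m}_{C_4/\mathbb{Q}}$ is its degree $m$ part, and $\mathrm{Jac}(C_4)=\mathrm{Pic}^0_{C_4/\mathbb{Q}}$ is the Jacobian variety. Each $\mathrm{Pic}^{m}_{C_4/\mathbb{Q}}$ is a torsor under $\mathrm{Jac}(C_4)$. The $\mathbb{Q}$-rational points of $\mathrm{Pic}^{m}_{C_4/\mathbb{Q}}$ are the $\mathrm{Gal}(\overline{\mathbb{Q}}/\mathbb{Q})$-invariant degree $m$ divisor classes on $C_4\otimes_{\mathbb{Q}}\overline{\mathbb{Q}}$. *)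

theory Defs
  imports
    "HOL-Analysis.Finite_Cartesian_Product"
    "HOL-Algebra.Free_Abelian_Groups"
    "HOL-Algebra.Algebraic_Closure_Type"
    "HOL-Algebra.Ideal"
begin

section \<open>Ternary forms and plane curves\<close>

text \<open>
  Polynomials in \<open>X, Y, Z\<close> are finitely supported families of coefficients indexed by exponent
  vectors; the three variables are indexed by the type \<open>3\<close>, in which \<open>3 = 0\<close>.
\<close>

type_synonym 'a ternary = "(3 \<Rightarrow>\<^sub>0 nat) \<Rightarrow>\<^sub>0 'a"

definition tvar :: "3 \<Rightarrow> 'a::comm_ring_1 ternary" where
  "tvar i = Poly_Mapping.single (Poly_Mapping.single i 1) 1"

definition teval :: "'a::comm_ring_1 ^ 3 \<Rightarrow> 'a ternary \<Rightarrow> 'a" where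
  "teval v F = (\<Sum>m\<in>Poly_Mapping.keys F.
     Poly_Mapping.lookup F m * (\<Prod>i\<in>UNIV. (v $ i) ^ Poly_Mapping.lookup m i))"

definition homogeneous :: "nat \<Rightarrow> 'a::comm_ring_1 ternary \<Rightarrow> bool" where
  "homogeneous e F \<longleftrightarrow> (\<forall>m\<in>Poly_Mapping.keys F. (\<Sum>i\<in>UNIV. Poly_Mapping.lookup m i) = e)"

definition fermat_quartic :: "'a::comm_ring_1 ternary" where
  "fermat_quartic = tvar 1 ^ 4 + tvar 2 ^ 4 + tvar 3 ^ 4"

text \<open>A point of the projective plane is the set of all its vectors of homogeneous coordinates.\<close>

definition proj_plane :: "('a::field ^ 3) set set" where
  "proj_plane = {{c *s v | c. c \<noteq> 0} | v. v \<noteq> 0}"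

definition vanishes_at :: "'a::field ternary \<Rightarrow> ('a ^ 3) set \<Rightarrow> bool" where
  "vanishes_at F P \<longleftrightarrow> (\<forall>v\<in>P. teval v F = 0)"

definition curve_points :: "'a::field ternary \<Rightarrow> ('a ^ 3) set set" where
  "curve_points Q = {P \<in> proj_plane. vanishes_at Q P}"


section \<open>Function field, local rings and divisors\<close>

text \<open>
  In this section \<open>Q\<close> is meant to be a form defining a smooth irreducible curve over an
  algebraically closed field. The elements of its function field are the classes of fractions
  \<open>F / G\<close> of forms of equal degree with \<open>G\<close> not identically zero on the curve, where
  \<open>F / G = F' / G'\<close> iff \<open>F G' - F' G\<close> lies in the ideal \<open>(Q)\<close>.
\<close>

definition fractions :: "'a::field ternary \<Rightarrow> ('a ternary \<times> 'a ternary) set" where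
  "fractions Q = {(F, G). (\<exists>e. homogeneous e F \<and> homogeneous e G) \<and> \<not> Q dvd G}"

definition ratfun :: "'a::field ternary \<Rightarrow> 'a ternary \<Rightarrow> 'a ternary
    \<Rightarrow> ('a ternary \<times> 'a ternary) set" where
  "ratfun Q F G = {(F', G') \<in> fractions Q. Q dvd (F * G' - F' * G)}"

definition function_field :: "'a::field ternary \<Rightarrow> ('a ternary \<times> 'a ternary) set ring" where
  "function_field Q =
    \<lparr> carrier = {ratfun Q F G | F G. (F, G) \<in> fractions Q},
      monoid.mult = (\<lambda>f g. \<Union>(F, G)\<in>f. \<Union>(F', G')\<in>g. ratfun Q (F * F') (G * G')),
      one = ratfun Q 1 1,
      ring.zero = ratfun Q 0 1,
      add = (\<lambda>f g. \<Union>(F, G)\<in>f. \<Union>(F', G')\<in>g. ratfun Q (F * G' + F' * G) (G * G')) \<rparr>"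

definition local_ring :: "'a::field ternary \<Rightarrow> ('a ^ 3) set
    \<Rightarrow> ('a ternary \<times> 'a ternary) set ring" where
  "local_ring Q P = (function_field Q)
    \<lparr> carrier := {f \<in> carrier (function_field Q). \<exists>(F, G)\<in>f. \<not> vanishes_at G P} \<rparr>"

definition local_maximal_ideal :: "'a::field ternary \<Rightarrow> ('a ^ 3) set
    \<Rightarrow> ('a ternary \<times> 'a ternary) set set" where
  "local_maximal_ideal Q P =
    {f \<in> carrier (function_field Q). \<exists>(F, G)\<in>f. \<not> vanishes_at G P \<and> vanishes_at F P}"

text \<open>
  The local ring at a smooth point is a discrete valuation ring; the order of \<open>f \<noteq> 0\<close> is the
  \<open>n\<close> with \<open>f = u t\<^sup>n\<close> for a unit \<open>u\<close> and a generator \<open>t\<close> of the maximal ideal. Nothing is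
  intended for \<open>f = 0\<close>.
\<close>

definition ord_at :: "'a::field ternary \<Rightarrow> ('a ^ 3) set
    \<Rightarrow> ('a ternary \<times> 'a ternary) set \<Rightarrow> int" where
  "ord_at Q P f = (THE n. \<exists>t u.
     t \<in> carrier (local_ring Q P) \<and> PIdl\<^bsub>local_ring Q P\<^esub> t = local_maximal_ideal Q P \<and>
     u \<in> Units (local_ring Q P) \<and>
     f = u \<otimes>\<^bsub>function_field Q\<^esub> (t [^]\<^bsub>function_field Q\<^esub> n))"

abbreviation divisor_group :: "'a::field ternary \<Rightarrow> (('a ^ 3) set \<Rightarrow>\<^sub>0 int) monoid" where
  "divisor_group Q \<equiv> free_Abelian_group (curve_points Q)"

definition divisor_degree :: "('p \<Rightarrow>\<^sub>0 int) \<Rightarrow> int" where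
  "divisor_degree D = (\<Sum>P\<in>Poly_Mapping.keys D. Poly_Mapping.lookup D P)"

definition principal_divisors :: "'a::field ternary \<Rightarrow> (('a ^ 3) set \<Rightarrow>\<^sub>0 int) set" where
  "principal_divisors Q =
    {D \<in> carrier (divisor_group Q).
       \<exists>f \<in> carrier (function_field Q) - {\<zero>\<^bsub>function_field Q\<^esub>}.
         \<forall>P\<in>curve_points Q. Poly_Mapping.lookup D P = ord_at Q P f}"

text \<open>Divisor classes are cosets of the principal divisors; the group law is written \<open>\<otimes>\<close>.\<close>

definition divisor_class_group :: "'a::field ternary \<Rightarrow> (('a ^ 3) set \<Rightarrow>\<^sub>0 int) set monoid" where
  "divisor_class_group Q = divisor_group Q Mod principal_divisors Q"

definition divisor_classes_of_degree ::
    "'a::field ternary \<Rightarrow> int \<Rightarrow> (('a ^ 3) set \<Rightarrow>\<^sub>0 int) set set" where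
  "divisor_classes_of_degree Q m =
    {principal_divisors Q #>\<^bsub>divisor_group Q\<^esub> D | D.
       D \<in> carrier (divisor_group Q) \<and> divisor_degree D = m}"


section \<open>Galois action\<close>

type_synonym qbar = "rat alg_closure"

definition galois_group :: "(qbar \<Rightarrow> qbar) monoid" where
  "galois_group =
    \<lparr> carrier = {\<sigma>. bij \<sigma> \<and> (\<forall>x y. \<sigma> (x + y) = \<sigma> x + \<sigma> y) \<and> (\<forall>x y. \<sigma> (x * y) = \<sigma> x * \<sigma> y) \<and>
                     (\<forall>q. \<sigma> (to_ac q) = to_ac q)},
      monoid.mult = (\<circ>),
      one = id \<rparr>"

definition galois_point :: "(qbar \<Rightarrow> qbar) \<Rightarrow> (qbar ^ 3) set \<Rightarrow> (qbar ^ 3) set" where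
  "galois_point \<sigma> P = (\<lambda>v. \<chi> i. \<sigma> (v $ i)) ` P"

definition galois_divisor ::
    "(qbar \<Rightarrow> qbar) \<Rightarrow> ((qbar ^ 3) set \<Rightarrow>\<^sub>0 int) \<Rightarrow> ((qbar ^ 3) set \<Rightarrow>\<^sub>0 int)" where
  "galois_divisor \<sigma> = frag_extend (\<lambda>P. frag_of (galois_point \<sigma> P))"

definition galois_class ::
    "(qbar \<Rightarrow> qbar) \<Rightarrow> ((qbar ^ 3) set \<Rightarrow>\<^sub>0 int) set \<Rightarrow> ((qbar ^ 3) set \<Rightarrow>\<^sub>0 int) set" where
  "galois_class \<sigma> c = galois_divisor \<sigma> ` c"


section \<open>The Picard scheme of a smooth plane curve over the rationals\<close>

text \<open>
  A form \<open>C\<close> over \<open>\<rat>\<close> is base changed to \<open>qbar\<close>. The scheme \<open>Pic\<^sup>m\<close> is described by its geometric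
  points, that is the divisor classes of degree \<open>m\<close> over \<open>qbar\<close>, with their Galois action; its
  rational points are the Galois-invariant classes of degree \<open>m\<close>, which need not contain a
  Galois-invariant divisor.
\<close>

definition base_change :: "rat ternary \<Rightarrow> qbar ternary" where
  "base_change C = Poly_Mapping.map to_ac C"

definition pic_points :: "rat ternary \<Rightarrow> int \<Rightarrow> ((qbar ^ 3) set \<Rightarrow>\<^sub>0 int) set set" where
  "pic_points C m = divisor_classes_of_degree (base_change C) m"

definition pic_rational_points :: "rat ternary \<Rightarrow> int \<Rightarrow> ((qbar ^ 3) set \<Rightarrow>\<^sub>0 int) set set" where
  "pic_rational_points C m =
    {c \<in> pic_points C m. \<forall>\<sigma>\<in>carrier galois_group. galois_class \<sigma> c = c}"

definition jacobian :: "rat ternary \<Rightarrow> ((qbar ^ 3) set \<Rightarrow>\<^sub>0 int) set monoid" where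
  "jacobian C = (divisor_class_group (base_change C)) \<lparr> carrier := pic_points C 0 \<rparr>"


section \<open>Torsors\<close>

text \<open>
  Torsors under a commutative algebraic group over \<open>\<rat>\<close>, in terms of geometric points: \<open>A\<close> is a
  group with a Galois action \<open>gA\<close>, \<open>T\<close> a set with a Galois action \<open>gT\<close>, and \<open>act\<close> an equivariant
  simply transitive action of \<open>A\<close> on \<open>T\<close>. The trivial torsor is \<open>A\<close> acting on itself.
\<close>

definition galois_module :: "('g, 'r) monoid_scheme \<Rightarrow> ('a, 's) monoid_scheme
    \<Rightarrow> ('g \<Rightarrow> 'a \<Rightarrow> 'a) \<Rightarrow> bool" where
  "galois_module G A gA \<longleftrightarrow>
     comm_group A \<and> (\<forall>\<sigma>\<in>carrier G. gA \<sigma> \<in> hom A A) \<and>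
     (\<forall>a\<in>carrier A. gA \<one>\<^bsub>G\<^esub> a = a) \<and>
     (\<forall>\<sigma>\<in>carrier G. \<forall>\<tau>\<in>carrier G. \<forall>a\<in>carrier A. gA (\<sigma> \<otimes>\<^bsub>G\<^esub> \<tau>) a = gA \<sigma> (gA \<tau> a))"

definition galois_torsor :: "('g, 'r) monoid_scheme \<Rightarrow> ('a, 's) monoid_scheme
    \<Rightarrow> ('g \<Rightarrow> 'a \<Rightarrow> 'a) \<Rightarrow> 't set \<Rightarrow> ('g \<Rightarrow> 't \<Rightarrow> 't) \<Rightarrow> ('a \<Rightarrow> 't \<Rightarrow> 't) \<Rightarrow> bool" where
  "galois_torsor G A gA T gT act \<longleftrightarrow>
     galois_module G A gA \<and> T \<noteq> {} \<and>
     (\<forall>\<sigma>\<in>carrier G. \<forall>x\<in>T. gT \<sigma> x \<in> T) \<and>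
     (\<forall>x\<in>T. gT \<one>\<^bsub>G\<^esub> x = x) \<and>
     (\<forall>\<sigma>\<in>carrier G. \<forall>\<tau>\<in>carrier G. \<forall>x\<in>T. gT (\<sigma> \<otimes>\<^bsub>G\<^esub> \<tau>) x = gT \<sigma> (gT \<tau> x)) \<and>
     (\<forall>a\<in>carrier A. \<forall>x\<in>T. act a x \<in> T) \<and>
     (\<forall>x\<in>T. act \<one>\<^bsub>A\<^esub> x = x) \<and>
     (\<forall>a\<in>carrier A. \<forall>b\<in>carrier A. \<forall>x\<in>T. act (a \<otimes>\<^bsub>A\<^esub> b) x = act a (act b x)) \<and>
     (\<forall>x\<in>T. \<forall>y\<in>T. \<exists>!a\<in>carrier A. act a x = y) \<and>
     (\<forall>\<sigma>\<in>carrier G. \<forall>a\<in>carrier A. \<forall>x\<in>T. gT \<sigma> (act a x) = act (gA \<sigma> a) (gT \<sigma> x))"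

definition trivial_galois_torsor :: "('g, 'r) monoid_scheme \<Rightarrow> ('a, 's) monoid_scheme
    \<Rightarrow> ('g \<Rightarrow> 'a \<Rightarrow> 'a) \<Rightarrow> 't set \<Rightarrow> ('g \<Rightarrow> 't \<Rightarrow> 't) \<Rightarrow> ('a \<Rightarrow> 't \<Rightarrow> 't) \<Rightarrow> bool" where
  "trivial_galois_torsor G A gA T gT act \<longleftrightarrow>
     galois_torsor G A gA T gT act \<and>
     (\<exists>\<phi>. bij_betw \<phi> (carrier A) T \<and>
          (\<forall>a\<in>carrier A. \<forall>b\<in>carrier A. \<phi> (a \<otimes>\<^bsub>A\<^esub> b) = act a (\<phi> b)) \<and>
          (\<forall>\<sigma>\<in>carrier G. \<forall>a\<in>carrier A. \<phi> (gA \<sigma> a) = gT \<sigma> (\<phi> a)))"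

definition pic_is_torsor :: "rat ternary \<Rightarrow> int \<Rightarrow> bool" where
  "pic_is_torsor C m \<longleftrightarrow>
     galois_torsor galois_group (jacobian C) galois_class (pic_points C m) galois_class
       (\<lambda>a c. a \<otimes>\<^bsub>divisor_class_group (base_change C)\<^esub> c)"

definition pic_is_trivial_torsor :: "rat ternary \<Rightarrow> int \<Rightarrow> bool" where
  "pic_is_trivial_torsor C m \<longleftrightarrow>
     trivial_galois_torsor galois_group (jacobian C) galois_class (pic_points C m) galois_class
       (\<lambda>a c. a \<otimes>\<^bsub>divisor_class_group (base_change C)\<^esub> c)"

end

theory Submission
  imports Defs
begin

text \<open>
  Already over the reals a Galois-invariant class on the curve has even degree. Let \<open>D\<close> be a divisor whose
  class is invariant under complex conjugation, say \<open>D' - D = div h\<close> with \<open>D'\<close> the conjugate of \<open>D\<close>.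
  Then \<open>h h'\<close> has no zeros and poles, so it is a real constant, and \<open>h\<close> can be scaled so that
  \<open>h h'\<close> is \<open>1\<close> or \<open>-1\<close>. If it is \<open>1\<close>, Hilbert 90 gives \<open>h = g' / g\<close>, and \<open>D - div g\<close> is an invariant
  divisor; its degree is even because the curve has no real points. If it is \<open>-1\<close>, divide \<open>h\<close> by
  \<open>f = (X\<^sup>2 + i Y\<^sup>2) / Z\<^sup>2\<close>, which also has norm \<open>-1\<close>; since \<open>div f\<close> is twice a divisor \<open>E\<close> of degree
  \<open>0\<close> with \<open>E' = - E\<close>, this replaces \<open>D\<close> by \<open>D + E\<close> and reduces to the first case.

  The orders at a point are read off from power series expansions. The coordinate ring is a free module
  with basis \<open>1, Y, Y\<^sup>2, Y\<^sup>3\<close> over the polynomials in \<open>X, Z\<close>, and these powers stay independent in the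
  power series, so no nonzero element expands to \<open>0\<close>. Principal divisors have degree \<open>0\<close> since the norm
  of a form for \<open>Y \<mapsto> i Y\<close> is congruent to a product of linear forms in \<open>X, Z\<close>.
\<close>

unbundle no Formal_Power_Series.fps_syntax

text \<open>The closure \<open>qbar\<close> is abstract and carries no conjugation. It is embedded
  into the complex numbers by Zorn's lemma; the image is stable under \<open>cnj\<close>, and the
  conjugation obtained by transport enters the parity argument only through the axioms of
  \<open>real_structure\<close>. All geometry is done with forms modulo divisibility by Q.
  Injectivity of the expansions on forms plays the part of irreducibility of Q, and
  \<open>ord_at\<close>, which speaks of generators of the maximal ideal, is reached by explicit
  congruences H^n F = T^n U modulo Q with H and U nonzero at the point. Norm -1 is a genuine
  obstacle: a scalar z changes the norm by z z', which is positive, so no rescaling removes the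
  sign. What saves the argument is that the divisor of f can be halved. On the curve (X^2 + i Y^2)
  (X^2 - i Y^2) = - Z^4, and the two factors have no common zero there, so each has order 0 or four
  times the order of Z.\<close>

abbreviation (input) keys :: "('a \<Rightarrow>\<^sub>0 'b::zero) \<Rightarrow> 'a set" where
  "keys \<equiv> Poly_Mapping.keys"

abbreviation (input) lookup :: "('a \<Rightarrow>\<^sub>0 'b::zero) \<Rightarrow> 'a \<Rightarrow> 'b" where
  "lookup \<equiv> Poly_Mapping.lookup"

abbreviation (input) Q :: "'a::comm_ring_1 ternary" where
  "Q \<equiv> fermat_quartic"

abbreviation (input) curve :: "('a::field ^ 3) set set" where
  "curve \<equiv> curve_points Q"

section \<open>Ternary forms\<close>

lemma sum_keys_superset:
  assumes "finite S" "keys F \<subseteq> S" "\<And>m. f m 0 = 0"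
  shows "(\<Sum>m\<in>keys F. f m (lookup F m)) = (\<Sum>m\<in>S. f m (lookup F m))"
  using assms by (intro sum.mono_neutral_left) (auto simp: in_keys_iff)

text \<open>A predicate on plain functions, so that evaluations, expansions, twists and field
  automorphisms between many different rings share one set of simplification rules.\<close>

definition ring_map :: "('a::comm_ring_1 \<Rightarrow> 'b::comm_ring_1) \<Rightarrow> bool" where
  "ring_map h \<longleftrightarrow> h 0 = 0 \<and> h 1 = 1 \<and> (\<forall>x y. h (x + y) = h x + h y) \<and> (\<forall>x y. h (x * y) = h x * h y)"

lemma ring_mapI:
  assumes "h 1 = 1" "\<And>x y. h (x + y) = h x + h y" "\<And>x y. h (x * y) = h x * h y"
  shows "ring_map h"
proof -
  have "h 0 + h 0 = h 0 + 0"
    using assms(2)[of 0 0] by simp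
  then have "h 0 = 0"
    by simp
  then show ?thesis
    using assms by (simp add: ring_map_def)
qed

lemma
  assumes "ring_map h"
  shows ring_map_0: "h 0 = 0" and ring_map_1: "h 1 = 1"
    and ring_map_add: "h (x + y) = h x + h y" and ring_map_mult: "h (x * y) = h x * h y"
    and ring_map_uminus: "h (- x) = - h x" and ring_map_diff: "h (x - y) = h x - h y"
    and ring_map_power: "h (x ^ n) = h x ^ n"
    and ring_map_sum: "h (sum f A) = (\<Sum>a\<in>A. h (f a))"
    and ring_map_prod: "h (prod f A) = (\<Prod>a\<in>A. h (f a))"
proof -
  show 0: "h 0 = 0" and 1: "h 1 = 1" and a: "\<And>x y. h (x + y) = h x + h y"
    and m: "\<And>x y. h (x * y) = h x * h y"
    using assms by (simp_all add: ring_map_def)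
  have u: "h (- x) = - h x" for x
    using a[of x "- x"] by (simp add: 0 eq_neg_iff_add_eq_0 add.commute)
  show "h (- x) = - h x"
    by (rule u)
  show "h (x - y) = h x - h y"
    using a[of x "- y"] by (simp add: u)
  show "h (x ^ n) = h x ^ n"
    by (induction n) (simp_all add: 1 m)
  show "h (sum f A) = (\<Sum>a\<in>A. h (f a))"
    by (induction A rule: infinite_finite_induct) (simp_all add: 0 a)
  show "h (prod f A) = (\<Prod>a\<in>A. h (f a))"
    by (induction A rule: infinite_finite_induct) (simp_all add: 1 m)
qed

lemmas ring_map_simps = ring_map_0 ring_map_1 ring_map_add ring_map_mult ring_map_uminus
  ring_map_diff ring_map_power

lemma ring_map_dvd: "ring_map h \<Longrightarrow> a dvd b \<Longrightarrow> h a dvd h b"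
  by (auto simp: dvd_def ring_map_mult)

lemma ring_map_id: "ring_map id" "ring_map (\<lambda>x. x)"
  by (auto simp: ring_map_def)

lemma ring_map_comp: "ring_map f \<Longrightarrow> ring_map g \<Longrightarrow> ring_map (\<lambda>x. f (g x))"
  by (auto simp: ring_map_def)


section \<open>Evaluation homomorphisms on ternary polynomials\<close>

abbreviation tconst :: "'a::comm_ring_1 \<Rightarrow> 'a ternary" where
  "tconst \<equiv> Poly_Mapping.single 0"

lemma ring_map_tconst: "ring_map tconst"
  by (rule ring_mapI) (simp_all add: single_add mult_single)

text \<open>The homomorphism that extends \<open>h\<close> and sends X_i to \<open>x i\<close>.
  Point evaluation, twisting and power series expansion are instances, and
  \<open>ring_map_of_hev\<close> computes their compositions.\<close>

definition hev :: "('a::comm_ring_1 \<Rightarrow> 'b::comm_ring_1) \<Rightarrow> (3 \<Rightarrow> 'b) \<Rightarrow> 'a ternary \<Rightarrow> 'b" where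
  "hev h x F = (\<Sum>m\<in>keys F.
     h (lookup F m) * (\<Prod>i\<in>UNIV. x i ^ lookup m i))"

lemma teval_eq_hev: "teval v F = hev (\<lambda>c. c) (($) v) F"
  by (simp add: teval_def hev_def)

lemma hev_superset:
  assumes "ring_map h" "finite S" "keys F \<subseteq> S"
  shows "hev h x F = (\<Sum>m\<in>S. h (lookup F m) * (\<Prod>i\<in>UNIV. x i ^ lookup m i))"
  unfolding hev_def
  by (rule sum_keys_superset[OF assms(2,3)]) (simp add: ring_map_0[OF assms(1)])

lemma hev_add: "ring_map h \<Longrightarrow> hev h x (F + G) = hev h x F + hev h x G"
  using hev_superset[of h "keys F \<union> keys G" _ x] keys_add[of F G]
  by (simp add: lookup_add ring_map_add sum.distrib ring_distribs)

lemma hev_single: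
  "ring_map h \<Longrightarrow> hev h x (Poly_Mapping.single m c) = h c * (\<Prod>i\<in>UNIV. x i ^ lookup m i)"
  by (subst hev_superset[of h "{m}"]) (simp_all add: ring_map_0)

lemma poly_mapping_add_induct [case_names zero single add]:
  assumes "P 0" "\<And>m c. P (Poly_Mapping.single m c)" "\<And>F G. P F \<Longrightarrow> P G \<Longrightarrow> P (F + G)"
  shows "P (F :: 'a \<Rightarrow>\<^sub>0 'b::ab_group_add)"
proof -
  have "P (\<Sum>m\<in>S. Poly_Mapping.single m (lookup F m))" if "finite S" for S
    using that by induction (auto intro: assms)
  moreover have "F = (\<Sum>m\<in>keys F. Poly_Mapping.single m (lookup F m))"
    by (rule poly_mapping_eqI)
       (auto simp: lookup_sum lookup_single when_def in_keys_iff sum.delta)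
  ultimately show ?thesis
    by (metis finite_keys)
qed

lemma hev_mult:
  assumes h: "ring_map h"
  shows "hev h x (F * G) = hev h x F * hev h x G"
proof (induction F rule: poly_mapping_add_induct)
  case zero
  show ?case by (simp add: hev_def)
next
  case (single m c)
  show ?case
  proof (induction G rule: poly_mapping_add_induct)
    case zero
    show ?case by (simp add: hev_def)
  next
    case (single n d)
    show ?case
      by (simp add: mult_single hev_single[OF h] ring_map_mult[OF h] lookup_add power_add prod.distrib)
  next
    case (add G G')
    then show ?case
      by (simp add: ring_distribs hev_add[OF h])
  qed
next
  case (add F F')
  then show ?case
    by (simp add: ring_distribs hev_add[OF h])
qed

lemma hev_tconst [simp]: "ring_map h \<Longrightarrow> hev h x (tconst c) = h c"
  by (simp add: hev_single)

lemma ring_map_hev: "ring_map h \<Longrightarrow> ring_map (hev h x)"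
  using hev_tconst[of h x 1]
  by (intro ring_mapI) (simp_all add: hev_add hev_mult ring_map_1)

lemma hev_tvar [simp]: "ring_map h \<Longrightarrow> hev h x (tvar i) = x i"
proof -
  assume h: "ring_map h"
  have "(\<Prod>j\<in>UNIV. x j ^ lookup (Poly_Mapping.single i 1) j) = (\<Prod>j\<in>UNIV. if j = i then x j else 1)"
    by (intro prod.cong) (auto simp: lookup_single when_def)
  then show ?thesis
    using h by (simp add: tvar_def hev_single ring_map_1 prod.delta)
qed

lemma ring_map_of_hev:
  "ring_map g \<Longrightarrow> g (hev h x F) = hev (\<lambda>c. g (h c)) (\<lambda>i. g (x i)) F"
  by (simp add: hev_def ring_map_sum ring_map_mult ring_map_prod ring_map_power)

definition tmonom :: "(3 \<Rightarrow> nat) \<Rightarrow> 'a::comm_ring_1 ternary" where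
  "tmonom m = (\<Prod>i\<in>UNIV. tvar i ^ m i)"

lemma tvar_power: "tvar i ^ n = Poly_Mapping.single (Poly_Mapping.single i n) 1"
  by (induction n) (simp_all add: tvar_def mult_single flip: single_add)

lemma single_eq_tmonom: "Poly_Mapping.single m c = tconst c * tmonom (lookup m)"
proof -
  have "(\<Prod>i\<in>A. Poly_Mapping.single (f i) 1) = Poly_Mapping.single (sum f A) (1::'a)" for A and f :: "3 \<Rightarrow> 3 \<Rightarrow>\<^sub>0 nat"
    by (induction A rule: infinite_finite_induct) (simp_all add: mult_single)
  moreover have "(\<Sum>i\<in>UNIV. Poly_Mapping.single i (lookup m i)) = m"
    by (rule poly_mapping_eqI) (auto simp: lookup_sum lookup_single when_def sum.delta)
  ultimately show ?thesis
    by (simp add: tmonom_def tvar_power mult_single)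
qed

lemma hev_tconst_tvar: "hev tconst tvar F = F"
proof (induction F rule: poly_mapping_add_induct)
  case (single m c)
  then show ?case
    by (subst (2) single_eq_tmonom) (simp add: hev_single ring_map_tconst tmonom_def)
next
  case (add F G)
  then show ?case
    by (simp add: hev_add ring_map_tconst)
qed (simp add: hev_def)


section \<open>Homogeneous forms\<close>

lemma homogeneous_0 [simp]: "homogeneous e 0"
  by (simp add: homogeneous_def)

lemma homogeneous_add: "homogeneous e F \<Longrightarrow> homogeneous e G \<Longrightarrow> homogeneous e (F + G)"
  using keys_add[of F G] by (auto simp: homogeneous_def)

lemma homogeneous_uminus: "homogeneous e F \<Longrightarrow> homogeneous e (- F)"
  by (auto simp: homogeneous_def in_keys_iff)

lemma homogeneous_diff: "homogeneous e F \<Longrightarrow> homogeneous e G \<Longrightarrow> homogeneous e (F - G)"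
  using homogeneous_add[of e F "- G"] by (simp add: homogeneous_uminus)

lemma homogeneous_mult: "homogeneous e F \<Longrightarrow> homogeneous e' G \<Longrightarrow> homogeneous (e + e') (F * G)"
  using keys_mult[of F G] by (fastforce simp: homogeneous_def lookup_add sum.distrib)

lemma homogeneous_tconst [simp]: "homogeneous 0 (tconst c)"
  by (simp add: homogeneous_def)

lemma homogeneous_one [simp]: "homogeneous 0 1"
  using homogeneous_tconst[of 1] by simp

lemma homogeneous_power: "homogeneous e F \<Longrightarrow> homogeneous (e * n) (F ^ n)"
  by (induction n) (auto dest: homogeneous_mult)

lemma homogeneous_tvar [simp]: "homogeneous 1 (tvar i)"
  by (simp add: homogeneous_def tvar_def lookup_single when_def sum.delta)

lemma homogeneous_tconst_mult: "homogeneous e F \<Longrightarrow> homogeneous e (tconst c * F)"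
  using homogeneous_mult[OF homogeneous_tconst] by fastforce

lemma homogeneous_sum: "(\<And>a. a \<in> A \<Longrightarrow> homogeneous e (f a)) \<Longrightarrow> homogeneous e (sum f A)"
  by (induction A rule: infinite_finite_induct) (auto intro: homogeneous_add)

lemma homogeneous_prod: "(\<And>a. a \<in> A \<Longrightarrow> homogeneous (e a) (f a)) \<Longrightarrow> homogeneous (sum e A) (prod f A)"
  by (induction A rule: infinite_finite_induct) (auto intro: homogeneous_mult)

lemma homogeneous_tmonom: "homogeneous (sum m UNIV) (tmonom m)"
  unfolding tmonom_def
  using homogeneous_prod[of UNIV "\<lambda>i. 1 * m i"] homogeneous_power[OF homogeneous_tvar]
  by (metis (no_types, lifting) mult_1 sum.cong)

lemma homogeneous_induct [consumes 1, case_names zero monom add]: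
  assumes "homogeneous e F" "P 0"
    and "\<And>m c. sum m UNIV = e \<Longrightarrow> P (tconst c * tmonom m)"
    and "\<And>F G. P F \<Longrightarrow> P G \<Longrightarrow> P (F + G)"
  shows "P F"
proof -
  have "P (\<Sum>m\<in>S. Poly_Mapping.single m (lookup F m))"
    if "finite S" "\<forall>m\<in>S. (\<Sum>i\<in>UNIV. lookup m i) = e" for S
    using that
  proof (induction S)
    case (insert m S)
    have "P (Poly_Mapping.single m (lookup F m))"
      using insert.prems by (subst single_eq_tmonom, intro assms(3)) auto
    then show ?case
      using insert by (auto intro: assms(4))
  qed (auto intro: assms(2))
  moreover have "F = (\<Sum>m\<in>keys F. Poly_Mapping.single m (lookup F m))"
    by (rule poly_mapping_eqI)
       (auto simp: lookup_sum lookup_single when_def in_keys_iff sum.delta)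
  ultimately show ?thesis
    using assms(1) unfolding homogeneous_def by (metis finite_keys)
qed

lemma hev_scale:
  assumes "ring_map h" "homogeneous e F"
  shows "hev h (\<lambda>i. c * x i) F = c ^ e * hev h x F"
  using assms(2)
proof (induction rule: homogeneous_induct)
  case zero
  then show ?case by (simp add: hev_def)
next
  case (monom m a)
  have "(\<Prod>i\<in>UNIV. c ^ m i) = c ^ e"
    using monom by (simp flip: power_sum)
  then show ?case using assms(1)
    by (simp add: ring_map_mult[OF ring_map_hev] tmonom_def ring_map_prod[OF ring_map_hev]
        ring_map_power[OF ring_map_hev] power_mult_distrib prod.distrib)
next
  case (add F G)
  then show ?case using assms(1) by (simp add: hev_add ring_distribs)
qed

lemma teval_scale: "homogeneous e F \<Longrightarrow> teval (c *s v) F = c ^ e * teval v F"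
  using hev_scale[OF ring_map_id(2), of e F c "($) v"]
  by (simp add: teval_eq_hev vector_smult_component[abs_def])

lemma ring_map_teval: "ring_map (teval v)"
  using ring_map_hev[OF ring_map_id(2), of "($) v"] by (simp add: teval_eq_hev[abs_def])

lemma teval_tvar [simp]: "teval v (tvar i) = v $ i"
  by (simp add: teval_eq_hev ring_map_id)

lemma teval_tconst [simp]: "teval v (tconst c) = c"
  by (simp add: teval_eq_hev ring_map_id)

lemmas teval_simps = ring_map_simps[OF ring_map_teval]


text \<open>A semilinear substitution. With \<open>d\<close> constantly 1 it is Galois conjugation
  of the coefficients, with \<open>s\<close> the identity it gives rotations such as Y to i Y; both
  fix the quartic as soon as all \<open>d i\<close> are fourth roots of unity.\<close>

definition twist :: "('a::comm_ring_1 \<Rightarrow> 'a) \<Rightarrow> (3 \<Rightarrow> 'a) \<Rightarrow> 'a ternary \<Rightarrow> 'a ternary" where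
  "twist s d = hev (\<lambda>c. tconst (s c)) (\<lambda>i. tconst (d i) * tvar i)"

lemma ring_map_twist: "ring_map s \<Longrightarrow> ring_map (twist s d)"
  unfolding twist_def by (intro ring_map_hev ring_map_comp[OF ring_map_tconst])

lemma twist_tvar: "ring_map s \<Longrightarrow> twist s d (tvar i) = tconst (d i) * tvar i"
  by (simp add: twist_def ring_map_comp[OF ring_map_tconst])

lemma twist_tconst: "ring_map s \<Longrightarrow> twist s d (tconst c) = tconst (s c)"
  by (simp add: twist_def ring_map_comp[OF ring_map_tconst])

lemma homogeneous_twist:
  assumes s: "ring_map s" and "homogeneous e F"
  shows "homogeneous e (twist s d F)"
  using assms(2)
proof (induction rule: homogeneous_induct)
  case zero
  show ?case by (simp add: twist_def hev_def)
next
  case (monom m c)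
  have "twist s d (tconst c * tmonom m) = tconst (s c) * ((\<Prod>i\<in>UNIV. tconst (d i) ^ m i) * tmonom m)"
    using s by (simp add: ring_map_mult[OF ring_map_twist] tmonom_def ring_map_prod[OF ring_map_twist]
        ring_map_power[OF ring_map_twist] twist_tvar twist_tconst power_mult_distrib prod.distrib)
  also have "(\<Prod>i\<in>UNIV. tconst (d i) ^ m i) = tconst (\<Prod>i\<in>UNIV. d i ^ m i)"
    by (simp add: ring_map_prod[OF ring_map_tconst] ring_map_power[OF ring_map_tconst])
  finally show ?case
    using homogeneous_tconst_mult[OF homogeneous_tconst_mult[OF homogeneous_tmonom[of m]]]
    unfolding monom by simp
next
  case (add F G)
  then show ?case
    by (simp add: ring_map_add[OF ring_map_twist[OF s]] homogeneous_add)
qed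

lemma teval_twist:
  fixes d :: "3 \<Rightarrow> 'a::field"
  assumes "ring_map s" "\<And>i. d i \<noteq> 0"
  shows "teval (\<chi> i. s (v $ i) / d i) (twist s d F) = s (teval v F)"
  using assms unfolding twist_def teval_eq_hev
  by (subst (1 2) ring_map_of_hev)
     (simp_all add: ring_map_hev ring_map_id ring_map_mult[OF ring_map_hev])

lemma twist_twist:
  assumes "ring_map s" "ring_map s'"
  shows "twist s d (twist s' d' F) = twist (\<lambda>c. s (s' c)) (\<lambda>i. s (d' i) * d i) F"
proof -
  have "twist s d (twist s' d' F) =
    hev (\<lambda>c. twist s d (tconst (s' c))) (\<lambda>i. twist s d (tconst (d' i) * tvar i)) F"
    unfolding twist_def[of s'] by (rule ring_map_of_hev[OF ring_map_twist[OF assms(1)]])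
  also have "\<dots> = twist (\<lambda>c. s (s' c)) (\<lambda>i. s (d' i) * d i) F"
    using assms(1) by (simp add: twist_tconst ring_map_mult[OF ring_map_twist] twist_tvar
        mult.assoc[symmetric] mult_single twist_def[of "\<lambda>c. s (s' c)"])
  finally show ?thesis .
qed

lemma twist_id: "twist (\<lambda>c. c) (\<lambda>_. 1) F = F"
  using hev_tconst_tvar[of F] by (simp add: twist_def)

lemma UNIV_3: "distinct [i, j, k] \<Longrightarrow> UNIV = {i, j, k :: 3}"
  by (rule sym, rule card_subset_eq) auto

lemma fermat_quartic_eq: "distinct [i, j, k] \<Longrightarrow> Q = tvar i ^ 4 + tvar j ^ 4 + tvar k ^ 4"
proof -
  have *: "Q = (\<Sum>i\<in>UNIV. tvar i ^ 4)"
    by (subst UNIV_3[of 1 2 3]) (simp_all add: fermat_quartic_def add.assoc)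
  assume "distinct [i, j, k]"
  then show ?thesis
    unfolding * by (subst UNIV_3[of i j k]) (simp_all add: add.assoc)
qed

lemma homogeneous_fermat: "homogeneous 4 Q"
  using homogeneous_power[OF homogeneous_tvar, of 4]
  by (auto simp: fermat_quartic_def intro!: homogeneous_add)

lemma twist_fermat:
  assumes "ring_map s" "\<And>i. d i ^ 4 = 1"
  shows "twist s d Q = Q"
  using assms by (simp add: fermat_quartic_def ring_map_add[OF ring_map_twist]
      ring_map_power[OF ring_map_twist] twist_tvar power_mult_distrib ring_map_power[OF ring_map_tconst, symmetric])


section \<open>Normal forms and charts\<close>

text \<open>A descent step in the spirit of Eisenstein's criterion. As r is a simple root of p,
  evaluating the two equations at r in turn forces a root at r in a0, a1, a2, a3, in this
  order.\<close>

lemma linear_divides_quadruple: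
  fixes q :: "'a::field_char_0 poly"
  assumes p: "p = [:- r, 1:] * q" and q: "poly q r \<noteq> 0"
    and eq1: "a0\<^sup>2 + p * a2\<^sup>2 = 2 * p * a1 * a3" and eq2: "2 * a0 * a2 = a1\<^sup>2 + p * a3\<^sup>2"
  shows "\<exists>b0 b1 b2 b3. a0 = [:- r, 1:] * b0 \<and> a1 = [:- r, 1:] * b1 \<and> a2 = [:- r, 1:] * b2 \<and> a3 = [:- r, 1:] * b3"
proof -
  define l where "l = [:- r, 1:]"
  have l: "poly l r = 0" "l \<noteq> 0"
    by (simp_all add: l_def)
  have pr: "poly p r = 0"
    by (simp add: p)
  have split: "\<exists>b. a = l * b" if "poly a r = 0" for a
    using that by (auto simp: poly_eq_0_iff_dvd dvd_def l_def)
  have "(poly a0 r)\<^sup>2 = 0"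
    using arg_cong[OF eq1, of "\<lambda>f. poly f r"] by (simp add: pr)
  then obtain b0 where b0: "a0 = l * b0"
    using split by auto
  have "(poly a1 r)\<^sup>2 = 0"
    using arg_cong[OF eq2, of "\<lambda>f. poly f r"] by (simp add: pr b0 l)
  then obtain b1 where b1: "a1 = l * b1"
    using split by auto
  \<comment> \<open>With a0 and a1 divisible by l, the first equation can be divided by l once; at r
    only the term with a2 then survives.\<close>
  have "l * (l * b0\<^sup>2 + q * a2\<^sup>2) = l * (2 * l * q * b1 * a3)"
    using eq1 unfolding p b0 b1 l_def[symmetric] by (simp add: power2_eq_square algebra_simps)
  then have "l * b0\<^sup>2 + q * a2\<^sup>2 = 2 * l * q * b1 * a3"
    using l by (metis mult_left_cancel)
  from arg_cong[OF this, of "\<lambda>f. poly f r"] have "poly q r * (poly a2 r)\<^sup>2 = 0"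
    by (simp add: l(1))
  then obtain b2 where b2: "a2 = l * b2"
    using split q by auto
  have "l * (2 * l * b0 * b2) = l * (l * b1\<^sup>2 + q * a3\<^sup>2)"
    using eq2 unfolding p b0 b1 b2 l_def[symmetric] by (simp add: power2_eq_square algebra_simps)
  then have "2 * l * b0 * b2 = l * b1\<^sup>2 + q * a3\<^sup>2"
    using l by (metis mult_left_cancel)
  from arg_cong[OF this, of "\<lambda>f. poly f r"] have "poly q r * (poly a3 r)\<^sup>2 = 0"
    by (simp add: l(1))
  then obtain b3 where b3: "a3 = l * b3"
    using split q by auto
  show ?thesis
    using b0 b1 b2 b3 unfolding l_def by blast
qed

text \<open>Both equations are homogeneous quadratic in the a's, so the quotients by a power of X -
  r satisfy them again and the descent can be repeated.\<close>

lemma linear_power_divides_quadruple: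
  fixes q :: "'a::field_char_0 poly"
  assumes p: "p = [:- r, 1:] * q" and q: "poly q r \<noteq> 0"
    and eq1: "a0\<^sup>2 + p * a2\<^sup>2 = 2 * p * a1 * a3" and eq2: "2 * a0 * a2 = a1\<^sup>2 + p * a3\<^sup>2"
  shows "\<exists>b0 b1 b2 b3. a0 = [:- r, 1:] ^ n * b0 \<and> a1 = [:- r, 1:] ^ n * b1 \<and>
    a2 = [:- r, 1:] ^ n * b2 \<and> a3 = [:- r, 1:] ^ n * b3"
proof (induction n)
  case (Suc n)
  define l where "l = [:- r, 1:] ^ n"
  from Suc obtain b0 b1 b2 b3 where b:
    "a0 = l * b0" "a1 = l * b1" "a2 = l * b2" "a3 = l * b3"
    unfolding l_def by blast
  have l: "l\<^sup>2 \<noteq> 0"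
    by (simp add: l_def)
  have "l\<^sup>2 * (b0\<^sup>2 + p * b2\<^sup>2) = l\<^sup>2 * (2 * p * b1 * b3)" "l\<^sup>2 * (2 * b0 * b2) = l\<^sup>2 * (b1\<^sup>2 + p * b3\<^sup>2)"
    using eq1 eq2 unfolding b by (simp_all add: power2_eq_square algebra_simps)
  then have "b0\<^sup>2 + p * b2\<^sup>2 = 2 * p * b1 * b3" "2 * b0 * b2 = b1\<^sup>2 + p * b3\<^sup>2"
    using l by (metis mult_left_cancel)+
  from linear_divides_quadruple[OF p q this] obtain c0 c1 c2 c3 where
    "b0 = [:- r, 1:] * c0" "b1 = [:- r, 1:] * c1" "b2 = [:- r, 1:] * c2" "b3 = [:- r, 1:] * c3"
    by blast
  then have "a0 = [:- r, 1:] ^ Suc n * c0 \<and> a1 = [:- r, 1:] ^ Suc n * c1 \<and>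
      a2 = [:- r, 1:] ^ Suc n * c2 \<and> a3 = [:- r, 1:] ^ Suc n * c3"
    by (simp only: b l_def power_Suc mult_ac)
  then show ?case
    by blast
qed auto

text \<open>The norm \<open>B\<^sub>0\<^sup>2 - p B\<^sub>1\<^sup>2\<close> of the sum vanishes, and \<open>p\<close> is not a square, so \<open>B\<^sub>0 = B\<^sub>1 = 0\<close>;
  the rest is a descent.\<close>

lemma fourth_root_independent:
  fixes q :: "'a::field_char_0 poly" and w :: "'a fps"
  assumes p: "p = [:- r, 1:] * q" and q: "poly q r \<noteq> 0" and w: "w ^ 4 = fps_of_poly p"
    and sum: "(\<Sum>m<4. fps_of_poly (a m) * w ^ m) = 0" and "m < 4"
  shows "a m = 0"
proof -
  let ?f = fps_of_poly
  define B0 where "B0 = (a 0)\<^sup>2 + p * (a 2)\<^sup>2 - 2 * p * a 1 * a 3"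
  define B1 where "B1 = 2 * a 0 * a 2 - (a 1)\<^sup>2 - p * (a 3)\<^sup>2"
  note hom = fps_of_poly_mult fps_of_poly_add fps_of_poly_diff fps_of_poly_power
  have sum4: "?f (a 0) + ?f (a 1) * w + ?f (a 2) * w\<^sup>2 + ?f (a 3) * w ^ 3 = 0"
    using sum by (simp add: eval_nat_numeral)
  \<comment> \<open>Multiplication by the conjugate under w to -w leaves only even powers of w, and
    w^4 = p reduces these to 1 and w^2.\<close>
  have "?f B0 + ?f B1 * w\<^sup>2 = (?f (a 0) + ?f (a 1) * w + ?f (a 2) * w\<^sup>2 + ?f (a 3) * w ^ 3) *
      (?f (a 0) - ?f (a 1) * w + ?f (a 2) * w\<^sup>2 - ?f (a 3) * w ^ 3)"
    unfolding B0_def B1_def hom fps_of_poly_numeral w[symmetric]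
    by (simp add: power2_eq_square power3_eq_cube power4_eq_xxxx algebra_simps)
  also have "\<dots> = 0"
    by (simp only: sum4 mult_zero_left)
  finally have "?f B0 = - (?f B1 * w\<^sup>2)"
    by (simp only: eq_neg_iff_add_eq_0)
  then have "(?f B0)\<^sup>2 = (?f B1)\<^sup>2 * w ^ 4"
    by (simp add: power_mult_distrib flip: power_mult)
  then have "?f (B0\<^sup>2) = ?f (p * B1\<^sup>2)"
    by (simp add: w hom mult.commute)
  then have B: "B0\<^sup>2 = p * B1\<^sup>2"
    by (simp add: fps_of_poly_eq_iff)
  have "B1 = 0"
  proof (rule ccontr)
    assume B1: "B1 \<noteq> 0"
    have "q \<noteq> 0"
      using q by auto
    then have nz: "p \<noteq> 0"
      unfolding p by (simp only: mult_eq_0_iff) simp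
    have "order r p = order r [:- r, 1:] + order r q"
      using nz unfolding p by (rule order_mult)
    then have "order r p = 1"
      using order_power_n_n[of r 1] order_0I[OF q] by (simp only: power_one_right)
    \<comment> \<open>Parity of orders at r: even for B0^2, odd for p B1^2 because r is a simple
      root of p.\<close>
    moreover have "order r (B0\<^sup>2) = order r p + order r (B1\<^sup>2)"
      unfolding B using nz B1 by (intro order_mult) auto
    moreover have "B0 \<noteq> 0"
      using B nz B1 by auto
    ultimately have "order r B0 + order r B0 = 1 + (order r B1 + order r B1)"
      using B1 by (simp add: power2_eq_square order_mult)
    then show False
      by presburger
  qed
  with B have "B0 = 0"
    by simp
  have eq1: "(a 0)\<^sup>2 + p * (a 2)\<^sup>2 = 2 * p * a 1 * a 3" and eq2: "2 * a 0 * a 2 = (a 1)\<^sup>2 + p * (a 3)\<^sup>2"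
    using \<open>B0 = 0\<close> \<open>B1 = 0\<close> by (simp_all add: B0_def B1_def algebra_simps)
  have "m = 0 \<or> m = 1 \<or> m = 2 \<or> m = 3"
    using \<open>m < 4\<close> by auto
  then have "[:- r, 1:] ^ n dvd a m" for n
    using linear_power_divides_quadruple[OF p q eq1 eq2, of n] by (auto simp: dvd_def)
  then have "a m = 0 \<or> Suc (order r (a m)) \<le> order r (a m)"
    by (simp only: order_divides)
  then show ?thesis
    by simp
qed


text \<open>The homogenisation X_i^e p(X_k / X_i), provided that p has degree at most e.\<close>

definition bform :: "3 \<Rightarrow> 3 \<Rightarrow> nat \<Rightarrow> 'a::comm_ring_1 poly \<Rightarrow> 'a ternary" where
  "bform i k e p = (\<Sum>a\<le>e. tconst (coeff p a) * tvar k ^ a * tvar i ^ (e - a))"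

lemma bform_0 [simp]: "bform i k e 0 = 0"
  by (simp add: bform_def)

lemma bform_add: "bform i k e (p + q) = bform i k e p + bform i k e q"
  by (simp add: bform_def single_add ring_distribs sum.distrib)

lemma bform_monom: "n \<le> e \<Longrightarrow> bform i k e (monom c n) = tconst c * tvar k ^ n * tvar i ^ (e - n)"
proof -
  assume n: "n \<le> e"
  have "bform i k e (monom c n) = (\<Sum>a\<le>e. if a = n then tconst c * tvar k ^ a * tvar i ^ (e - a) else 0)"
    unfolding bform_def by (intro sum.cong) auto
  then show ?thesis
    using n by simp
qed

lemma homogeneous_bform: "homogeneous e (bform i k e p)"
  unfolding bform_def
proof (rule homogeneous_sum)
  fix a assume "a \<in> {..e}"
  then have "0 + 1 * a + 1 * (e - a) = e"
    by simp
  then show "homogeneous e (tconst (coeff p a) * tvar k ^ a * tvar i ^ (e - a))"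
    using homogeneous_mult[OF homogeneous_mult[OF homogeneous_tconst homogeneous_power[OF homogeneous_tvar]]
        homogeneous_power[OF homogeneous_tvar]] by metis
qed

text \<open>The remainder of a form of degree e on division by Q, which is monic of degree 4 in X_j;
  \<open>a m\<close> is the dehomogenised coefficient of X_j^m.\<close>

definition nform :: "3 \<Rightarrow> 3 \<Rightarrow> 3 \<Rightarrow> nat \<Rightarrow> (nat \<Rightarrow> 'a::comm_ring_1 poly) \<Rightarrow> 'a ternary" where
  "nform i j k e a = (\<Sum>m<4. bform i k (e - m) (a m) * tvar j ^ m)"

definition has_nform :: "3 \<Rightarrow> 3 \<Rightarrow> 3 \<Rightarrow> nat \<Rightarrow> 'a::comm_ring_1 ternary \<Rightarrow> bool" where
  "has_nform i j k e F \<longleftrightarrow> (\<exists>a. (\<forall>m. a m = 0 \<or> m + degree (a m) \<le> e) \<and>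
     Q dvd F - nform i j k e a)"

lemma has_nform_cong:
  assumes "Q dvd F - G" "has_nform i j k e G"
  shows "has_nform i j k e F"
proof -
  have "F - H = (F - G) + (G - H)" for H
    by simp
  then show ?thesis
    using assms unfolding has_nform_def by (metis dvd_add)
qed

lemma has_nform_add:
  assumes "has_nform i j k e F" "has_nform i j k e G"
  shows "has_nform i j k e (F + G)"
proof -
  from assms obtain a b where
    a: "\<forall>m. a m = 0 \<or> m + degree (a m) \<le> e" "Q dvd F - nform i j k e a"
    and b: "\<forall>m. b m = 0 \<or> m + degree (b m) \<le> e" "Q dvd G - nform i j k e b"
    unfolding has_nform_def by blast
  let ?c = "\<lambda>m. a m + b m"
  have "?c m = 0 \<or> m + degree (?c m) \<le> e" for m
  proof (cases "a m = 0 \<or> b m = 0")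
    case True
    then show ?thesis using a(1) b(1) by auto
  next
    case False
    then have "degree (a m) \<le> e - m" "degree (b m) \<le> e - m" "m \<le> e"
      using a(1)[rule_format, of m] b(1)[rule_format, of m] by auto
    then show ?thesis
      using degree_add_le[of "a m" "e - m" "b m"] by auto
  qed
  moreover have "F + G - nform i j k e ?c = (F - nform i j k e a) + (G - nform i j k e b)"
    by (simp add: nform_def bform_add ring_distribs sum.distrib)
  then have "Q dvd F + G - nform i j k e ?c"
    using a(2) b(2) by (simp only: dvd_add)
  ultimately show ?thesis
    unfolding has_nform_def by (intro exI[of _ ?c]) blast
qed

text \<open>Modulo Q the factor X_j^4 may be replaced by -(X_i^4 + X_k^4), which lowers the exponent
  of X_j by 4.\<close>

lemma has_nform_monom:
  fixes c :: "'a::comm_ring_1"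
  assumes d: "distinct [i, j, k]"
  shows "has_nform i j k (\<alpha> + \<beta> + \<gamma>) (tconst c * tvar i ^ \<alpha> * tvar j ^ \<beta> * tvar k ^ \<gamma>)"
proof (induction \<beta> arbitrary: \<alpha> \<gamma> c rule: less_induct)
  case (less \<beta>)
  show ?case
  proof (cases "\<beta> < 4")
    case True
    let ?a = "\<lambda>m. if m = \<beta> then monom c \<gamma> else 0"
    have "nform i j k (\<alpha> + \<beta> + \<gamma>) ?a =
        (\<Sum>m<4. if m = \<beta> then bform i k (\<alpha> + \<beta> + \<gamma> - m) (monom c \<gamma>) * tvar j ^ m else 0)"
      unfolding nform_def by (intro sum.cong) auto
    also have "\<dots> = tconst c * tvar i ^ \<alpha> * tvar j ^ \<beta> * tvar k ^ \<gamma>"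
      using True by (simp add: bform_monom mult_ac)
    finally show ?thesis
      unfolding has_nform_def
      by (intro exI[of _ ?a]) (auto simp: degree_monom_eq intro: order.trans[OF degree_monom_le])
  next
    case False
    define \<delta> where "\<delta> = \<beta> - 4"
    have \<beta>: "\<beta> = \<delta> + 4"
      using False by (simp add: \<delta>_def)
    let ?F = "tconst c * tvar i ^ \<alpha> * tvar j ^ \<beta> * tvar k ^ \<gamma>"
    let ?G = "tconst (- c) * tvar i ^ (\<alpha> + 4) * tvar j ^ \<delta> * tvar k ^ \<gamma>
      + tconst (- c) * tvar i ^ \<alpha> * tvar j ^ \<delta> * tvar k ^ (\<gamma> + 4)"
    have "?F - ?G = Q * (tconst c * tvar i ^ \<alpha> * tvar j ^ \<delta> * tvar k ^ \<gamma>)"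
      unfolding fermat_quartic_eq[OF d] by (simp add: \<beta> power_add ring_map_uminus[OF ring_map_tconst] algebra_simps)
    then have "Q dvd ?F - ?G"
      by simp
    moreover have "has_nform i j k (\<alpha> + \<beta> + \<gamma>) ?G"
      using less(1)[of \<delta> "\<alpha> + 4" "\<gamma>" "- c"] less(1)[of \<delta> "\<alpha>" "\<gamma> + 4" "- c"]
      by (intro has_nform_add) (simp_all add: \<beta> ac_simps)
    ultimately show ?thesis
      by (rule has_nform_cong)
  qed
qed

lemma prod_UNIV_3: "distinct [i, j, k :: 3] \<Longrightarrow> prod f UNIV = f i * f j * f k"
  by (subst UNIV_3[of i j k]) (simp_all add: mult.assoc)

lemma sum_UNIV_3: "distinct [i, j, k :: 3] \<Longrightarrow> sum f UNIV = f i + f j + f k"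
  by (subst UNIV_3[of i j k]) (simp_all add: add.assoc)

lemma tmonom_3: "distinct [i, j, k] \<Longrightarrow> tmonom m = tvar i ^ m i * tvar j ^ m j * tvar k ^ m k"
  unfolding tmonom_def by (rule prod_UNIV_3)

lemma homogeneous_has_nform:
  assumes d: "distinct [i, j, k]" and F: "homogeneous e F"
  shows "has_nform i j k e F"
  using F
proof (induction rule: homogeneous_induct)
  case zero
  show ?case
    unfolding has_nform_def by (intro exI[of _ "\<lambda>_. 0"]) (simp add: nform_def)
next
  case (monom m c)
  then show ?case
    using has_nform_monom[OF d, of "m i" "m j" "m k" c]
    by (simp add: tmonom_3[OF d] sum_UNIV_3[OF d] mult.assoc)
qed (rule has_nform_add)


section \<open>Power series expansion at a point of the curve\<close>

lemma ring_map_fps_const: "ring_map fps_const"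
  by (rule ring_mapI) (simp_all flip: fps_const_add fps_const_mult)

lemma ring_map_fps_nth_0: "ring_map (\<lambda>f. fps_nth f 0)"
  by (rule ring_mapI) simp_all

text \<open>The chart at the point with \<open>X\<^sub>i = 1\<close>, \<open>X\<^sub>j = b\<close>, \<open>X\<^sub>k = c\<close>. As \<open>b \<noteq> 0\<close>, \<open>X\<^sub>k - c X\<^sub>i\<close> is a local
  parameter, and \<open>X\<^sub>j\<close> expands to a fourth root.\<close>

locale chart =
  fixes i j k :: 3 and b c :: "'a::field_char_0"
  assumes dist: "distinct [i, j, k]" and b: "b \<noteq> 0" and bc: "1 + b ^ 4 + c ^ 4 = 0"
begin

definition pt :: "'a ^ 3" where
  "pt = (\<chi> n. if n = i then 1 else if n = j then b else c)"

text \<open>The fourth root with constant term b: the first argument of \<open>fps_radical\<close>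
  chooses the root of the constant coefficient, here always b.\<close>

definition w :: "'a fps" where
  "w = fps_radical (\<lambda>_ _. b) 4 (- (1 + (fps_const c + fps_X) ^ 4))"

definition loc :: "'a ternary \<Rightarrow> 'a fps" where
  "loc = hev fps_const (\<lambda>n. if n = i then 1 else if n = j then w else fps_const c + fps_X)"

lemma pt_simps [simp]: "pt $ i = 1" "pt $ j = b" "pt $ k = c"
  using dist by (auto simp: pt_def)

lemma w_nth_0 [simp]: "fps_nth w 0 = b"
  by (simp add: w_def)

lemma w_power: "w ^ 4 = - (1 + (fps_const c + fps_X) ^ 4)"
proof -
  let ?a = "- (1 + (fps_const c + fps_X) ^ 4)"
  have "fps_nth ?a 0 = - (1 + c ^ 4)"
    using ring_map_power[OF ring_map_fps_nth_0, of "fps_const c + fps_X" 4] by simp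
  also have "\<dots> = b ^ 4"
    using bc by (metis add.commute add.left_commute eq_neg_iff_add_eq_0)
  finally have *: "fps_nth ?a 0 = b ^ 4" .
  show ?thesis
    using power_radical[of ?a "\<lambda>_ _. b" 3] b unfolding * w_def by simp
qed

lemma ring_map_loc: "ring_map loc"
  unfolding loc_def by (intro ring_map_hev ring_map_fps_const)

lemmas loc_simps = ring_map_simps[OF ring_map_loc]

lemma loc_tvar [simp]: "loc (tvar i) = 1" "loc (tvar j) = w" "loc (tvar k) = fps_const c + fps_X"
  using dist by (auto simp: loc_def ring_map_fps_const)

lemma loc_tconst [simp]: "loc (tconst a) = fps_const a"
  by (simp add: loc_def ring_map_fps_const)

lemma loc_nth_0: "fps_nth (loc F) 0 = teval pt F"
  unfolding loc_def teval_eq_hev using dist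
  by (subst ring_map_of_hev[OF ring_map_fps_nth_0])
     (auto intro!: arg_cong[where f = "\<lambda>x. hev _ x _"] simp: pt_def fun_eq_iff)

lemma loc_fermat: "loc Q = 0"
  by (simp add: fermat_quartic_eq[OF dist] loc_simps w_power)

lemma loc_dvd: "Q dvd F - G \<Longrightarrow> loc F = loc G"
  using ring_map_dvd[OF ring_map_loc, of Q "F - G"] by (simp add: loc_fermat loc_simps)

lemma loc_bform:
  assumes "degree p \<le> e"
  shows "loc (bform i k e p) = fps_of_poly (pcompose p [:c, 1:])"
proof -
  have mon: "pcompose (monom a n) [:c, 1:] = smult a ([:c, 1:] ^ n)" for a n
    by (induction n) (simp_all add: monom_0 monom_Suc pcompose_pCons pcompose_const mult_ac)
  have lin: "fps_of_poly [:c, 1:] = fps_const c + fps_X"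
    by (simp add: fps_of_poly_linear add.commute)
  have "loc (bform i k e p) = (\<Sum>a\<le>e. fps_of_poly (pcompose (monom (coeff p a) a) [:c, 1:]))"
    unfolding bform_def ring_map_sum[OF ring_map_loc] mon
    by (simp add: loc_simps fps_of_poly_smult fps_of_poly_power lin)
  also have "\<dots> = fps_of_poly (pcompose (\<Sum>a\<le>e. monom (coeff p a) a) [:c, 1:])"
    by (simp add: fps_of_poly_sum pcompose_sum)
  finally show ?thesis
    by (simp add: poly_as_sum_of_monoms'[OF assms])
qed

lemma loc_nform:
  assumes "\<And>m. a m = 0 \<or> m + degree (a m) \<le> e"
  shows "loc (nform i j k e a) = (\<Sum>m<4. fps_of_poly (pcompose (a m) [:c, 1:]) * w ^ m)"
  unfolding nform_def ring_map_sum[OF ring_map_loc]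
proof (intro sum.cong refl)
  fix m
  have "degree (a m) \<le> e - m"
    using assms[of m] by auto
  from loc_bform[OF this]
  show "loc (bform i k (e - m) (a m) * tvar j ^ m) = fps_of_poly (pcompose (a m) [:c, 1:]) * w ^ m"
    by (simp add: loc_simps)
qed

text \<open>The shift by c is injective on polynomials, so \<open>fourth_root_independent\<close>
  can be applied to -(1 + (c + t)^4). Its root r - c, where r^4 = -1, is simple because the
  derivative there is -4 r^3.\<close>

lemma nform_unique:
  assumes a: "\<And>m. a m = 0 \<or> m + degree (a m) \<le> e"
    and "loc (nform i j k e a) = 0" and "\<exists>r::'a. r ^ 4 = -1" and "m < 4"
  shows "a m = 0"
proof -
  obtain r :: 'a where r: "r ^ 4 = -1"
    using assms(3) by blast
  define q where "q = - (1 + [:c, 1:] ^ 4)"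
  let ?r = "r - c"
  have "poly q ?r = 0"
    by (simp add: q_def r)
  then obtain q' where q': "q = [:- ?r, 1:] * q'"
    by (auto simp: poly_eq_0_iff_dvd dvd_def)
  have "pderiv q = - (4 * [:c, 1:] ^ 3)"
    by (simp add: q_def pderiv_minus pderiv_diff pderiv_power pderiv_pCons numeral_poly)
  then have "poly (pderiv q) ?r = - (4 * r ^ 3)"
    by simp
  moreover have "poly (pderiv q) ?r = poly q' ?r"
    unfolding q' pderiv_mult by (simp add: pderiv_pCons algebra_simps)
  moreover have "r \<noteq> 0"
    using r by auto
  ultimately have q'r: "poly q' ?r \<noteq> 0"
    by auto
  have wq: "w ^ 4 = fps_of_poly q"
    by (simp add: w_power q_def fps_of_poly_uminus fps_of_poly_add fps_of_poly_diff fps_of_poly_power fps_of_poly_linear add.commute one_pCons)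
  have "pcompose (a m) [:c, 1:] = 0"
    using assms(2) unfolding loc_nform[OF a]
    by (rule fourth_root_independent[OF q' q'r wq _ \<open>m < 4\<close>])
  then show ?thesis
    by (simp add: pcompose_eq_0_iff)
qed

text \<open>A form with zero expansion has a normal form with zero expansion, and that normal form
  is 0 by uniqueness. Homogeneity matters: \<open>loc\<close> also kills
  \<open>tvar i - 1\<close>.\<close>

lemma loc_eq_0_iff:
  assumes F: "homogeneous e F" and r: "\<exists>r::'a. r ^ 4 = -1"
  shows "loc F = 0 \<longleftrightarrow> Q dvd F"
proof
  assume *: "loc F = 0"
  from homogeneous_has_nform[OF dist F] obtain a where
    a: "\<And>m. a m = 0 \<or> m + degree (a m) \<le> e" "Q dvd F - nform i j k e a"
    unfolding has_nform_def by blast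
  have "loc (nform i j k e a) = 0"
    using loc_dvd[OF a(2)] * by simp
  then have "a m = 0" if "m < 4" for m
    by (rule nform_unique[OF a(1) _ r that])
  then have "nform i j k e a = 0"
    by (simp add: nform_def)
  then show "Q dvd F"
    using a(2) by simp
next
  assume "Q dvd F"
  then show "loc F = 0"
    using loc_dvd[of F 0] by (simp add: loc_simps)
qed

end

lemma fourth_root_exists: "\<exists>r :: 'a::alg_closed_field. r ^ 4 = x"
  using nth_root_exists[of 4 x] by auto

text \<open>A single branch suffices: the expansion at (1 : r : 0) is multiplicative, its kernel on
  forms consists of the multiples of Q, and power series have no zero divisors.\<close>

lemma fermat_prime:
  fixes F G :: "'a::{field_char_0, alg_closed_field} ternary"
  assumes F: "homogeneous e F" and G: "homogeneous e' G" and dvd: "Q dvd F * G"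
  shows "Q dvd F \<or> Q dvd G"
proof -
  obtain r :: 'a where r: "r ^ 4 = -1"
    using fourth_root_exists by blast
  interpret chart 1 2 3 r 0
    by unfold_locales (use r in auto)
  have "loc F * loc G = 0"
    using loc_dvd[of "F * G" 0] dvd by (simp add: loc_simps)
  then show ?thesis
    using loc_eq_0_iff[OF F] loc_eq_0_iff[OF G] r by auto
qed


section \<open>Orders of vanishing\<close>

lemma homogeneous_induct_tvar [consumes 1, case_names zero const tvar add]:
  assumes "homogeneous e F" and P0: "\<And>e. P e 0" and Pc: "\<And>c. P 0 (tconst c)"
    and Pt: "\<And>e n F. P e F \<Longrightarrow> P (Suc e) (tvar n * F)"
    and Pa: "\<And>e F G. P e F \<Longrightarrow> P e G \<Longrightarrow> P e (F + G)"
  shows "P e F"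
  using assms(1)
proof (induction rule: homogeneous_induct)
  case (monom m c)
  have pow: "P (e + a) (tvar n ^ a * F)" if "P e F" for e n a F
    using that by (induction a) (auto dest: Pt simp: mult.assoc)
  have "P (sum m A) (tconst c * (\<Prod>i\<in>A. tvar i ^ m i))" if "finite A" for A
    using that
  proof induction
    case (insert i A)
    then show ?case
      using pow[OF insert.IH, of "m i" i] by (simp add: add.commute mult.left_commute)
  qed (simp add: Pc)
  from this[of UNIV] monom show ?case
    by (simp add: tmonom_def)
qed (use P0 Pa in auto)


lemma homogeneous_tvar_power: "homogeneous n (tvar i ^ n)"
  using homogeneous_power[OF homogeneous_tvar, of n i] by simp

context chart
begin

text \<open>\<open>T\<close> and \<open>S\<close> are linear forms that cut out the point.
  \<open>H\<close> and \<open>C\<close> are the cofactors in X_j^4 - b^4 X_i^4 = S H and X_k^4 - c^4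
  X_i^4 = T C. Since \<open>H\<close> has the value 4 b^3 at the point, the relation Q = S H + T C
  makes \<open>S\<close> a multiple of \<open>T\<close> near it.\<close>

definition T :: "'a ternary" where "T = tvar k - tconst c * tvar i"

definition S :: "'a ternary" where "S = tvar j - tconst b * tvar i"

definition H :: "'a ternary" where
  "H = tvar j ^ 3 + tconst b * tvar j ^ 2 * tvar i + tconst (b ^ 2) * tvar j * tvar i ^ 2 + tconst (b ^ 3) * tvar i ^ 3"

definition C :: "'a ternary" where
  "C = tvar k ^ 3 + tconst c * tvar k ^ 2 * tvar i + tconst (c ^ 2) * tvar k * tvar i ^ 2 + tconst (c ^ 3) * tvar i ^ 3"

lemma homogeneous_T: "homogeneous 1 T"
  unfolding T_def by (intro homogeneous_diff homogeneous_tconst_mult homogeneous_tvar)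

lemma homogeneous_cubic:
  "homogeneous 3 (tvar m ^ 3 + tconst a * tvar m ^ 2 * tvar n + tconst a' * tvar m * tvar n ^ 2 + tconst a'' * tvar n ^ 3)"
proof -
  have "homogeneous 3 (tvar m ^ p * tvar n ^ q)" if "p + q = 3" for p q
    using homogeneous_mult[OF homogeneous_tvar_power homogeneous_tvar_power, of p q m n] that
    by metis
  from this[of 3 0] this[of 2 1] this[of 1 2] this[of 0 3] show ?thesis
    by (auto intro!: homogeneous_add homogeneous_tconst_mult simp: mult.assoc)
qed

lemma homogeneous_H: "homogeneous 3 H"
  unfolding H_def by (rule homogeneous_cubic)

lemma homogeneous_C: "homogeneous 3 C"
  unfolding C_def by (rule homogeneous_cubic)

lemma teval_pt_H: "teval pt H \<noteq> 0"
proof -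
  have "teval pt H = 4 * b ^ 3"
    by (simp add: H_def teval_simps power2_eq_square power3_eq_cube)
  then show ?thesis
    using b by simp
qed

lemma loc_T: "loc T = fps_X"
  by (simp add: T_def loc_simps)

lemma fermat_eq_SH_TC: "Q = S * H + T * C"
proof -
  have "tconst (b ^ 4 + c ^ 4) = tconst (- 1)"
    using bc by (metis add.assoc add_eq_0_iff)
  then have *: "tconst b ^ 4 + tconst c ^ 4 = - 1"
    by (simp add: ring_map_simps[OF ring_map_tconst])
  have "S * H = tvar j ^ 4 - tconst b ^ 4 * tvar i ^ 4" "T * C = tvar k ^ 4 - tconst c ^ 4 * tvar i ^ 4"
    unfolding S_def T_def H_def C_def ring_map_power[OF ring_map_tconst]
    by (simp_all add: algebra_simps power2_eq_square power3_eq_cube power4_eq_xxxx)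
  then have "S * H + T * C = (tvar j ^ 4 - tconst b ^ 4 * tvar i ^ 4) + (tvar k ^ 4 - tconst c ^ 4 * tvar i ^ 4)"
    by simp
  also have "\<dots> = tvar j ^ 4 + tvar k ^ 4 - (tconst b ^ 4 + tconst c ^ 4) * tvar i ^ 4"
    by (simp add: algebra_simps)
  finally have "S * H + T * C = tvar j ^ 4 + tvar k ^ 4 - (tconst b ^ 4 + tconst c ^ 4) * tvar i ^ 4" .
  then show ?thesis
    unfolding fermat_quartic_eq[OF dist] * by simp
qed

text \<open>First order expansion at the point with control of degrees. At e = 0 the exponent
  \<open>e - 1\<close> is truncated; the first clause then makes A and B zero, hence homogeneous of
  every degree.\<close>

lemma form_eq_at_point:
  assumes "homogeneous e F"
  shows "\<exists>A B. (e = 0 \<longrightarrow> A = 0 \<and> B = 0) \<and> homogeneous (e - 1) A \<and> homogeneous (e - 1) B \<and>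
    F = tconst (teval pt F) * tvar i ^ e + T * A + S * B"
  using assms
proof (induction rule: homogeneous_induct_tvar)
  case (zero e)
  show ?case
    by (intro exI[of _ 0]) (simp add: teval_simps)
next
  case (const c)
  show ?case
    by (intro exI[of _ 0]) simp
next
  case (tvar e n F)
  then obtain A B where AB: "e = 0 \<longrightarrow> A = 0 \<and> B = 0" "homogeneous (e - 1) A" "homogeneous (e - 1) B"
    "F = tconst (teval pt F) * tvar i ^ e + T * A + S * B"
    by blast
  have hom: "homogeneous e (tvar n * A)" "homogeneous e (tvar n * B)"
    "homogeneous e (tconst (teval pt F) * tvar i ^ e)"
    using AB(1) homogeneous_mult[OF homogeneous_tvar AB(2), of n] homogeneous_mult[OF homogeneous_tvar AB(3), of n]
      homogeneous_tconst_mult[OF homogeneous_tvar_power, of e "teval pt F" i]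
    by (cases e; simp)+
  have m: "teval pt (tvar n * F) = pt $ n * teval pt F"
    by (simp add: teval_simps)
  have exp: "tvar n * F = tvar n * (tconst (teval pt F) * tvar i ^ e + T * A + S * B)"
    using AB(4) by simp
  consider "n = i" | "n = j" | "n = k"
    using UNIV_3[OF dist] by blast
  then show ?case
  proof cases
    case 1
    then show ?thesis
      using hom unfolding m
      by (intro exI[of _ "tvar n * A"] exI[of _ "tvar n * B"] conjI; (subst exp)?) (simp_all add: algebra_simps)
  next
    case 2
    \<comment> \<open>Here X_j = b X_i + S, so the value of F at the point also contributes to the
      coefficient of \<open>S\<close>.\<close>
    have "homogeneous e (tvar n * B + tconst (teval pt F) * tvar i ^ e)"
      using hom by (intro homogeneous_add)
    then show ?thesis
      using hom 2 unfolding m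
      by (intro exI[of _ "tvar n * A"] exI[of _ "tvar n * B + tconst (teval pt F) * tvar i ^ e"] conjI; (subst exp)?)
         (simp_all add: S_def algebra_simps ring_map_mult[OF ring_map_tconst])
  next
    case 3
    have "homogeneous e (tvar n * A + tconst (teval pt F) * tvar i ^ e)"
      using hom by (intro homogeneous_add)
    then show ?thesis
      using hom 3 unfolding m
      by (intro exI[of _ "tvar n * A + tconst (teval pt F) * tvar i ^ e"] exI[of _ "tvar n * B"] conjI; (subst exp)?)
         (simp_all add: T_def algebra_simps ring_map_mult[OF ring_map_tconst])
  qed
next
  case (add e F G)
  then obtain A B A' B' where
    AB: "e = 0 \<longrightarrow> A = 0 \<and> B = 0" "homogeneous (e - 1) A" "homogeneous (e - 1) B"
    "F = tconst (teval pt F) * tvar i ^ e + T * A + S * B"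
    and AB': "e = 0 \<longrightarrow> A' = 0 \<and> B' = 0" "homogeneous (e - 1) A'" "homogeneous (e - 1) B'"
    "G = tconst (teval pt G) * tvar i ^ e + T * A' + S * B'"
    by blast
  have "F + G = (tconst (teval pt F) * tvar i ^ e + T * A + S * B) + (tconst (teval pt G) * tvar i ^ e + T * A' + S * B')"
    using AB(4) AB'(4) by simp
  also have "\<dots> = tconst (teval pt (F + G)) * tvar i ^ e + T * (A + A') + S * (B + B')"
    by (simp add: teval_simps ring_map_add[OF ring_map_tconst] algebra_simps)
  finally show ?case
    using AB(1-3) AB'(1-3) by (intro exI[of _ "A + A'"] exI[of _ "B + B'"] conjI homogeneous_add) auto
qed

text \<open>Write F = T A + S B and multiply by \<open>H\<close>; modulo Q the product S H is - T C,
  which leaves T (H A - C B).\<close>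

lemma T_divides:
  assumes F: "homogeneous e F" and 0: "teval pt F = 0"
  shows "\<exists>F'. homogeneous (e + 2) F' \<and> Q dvd H * F - T * F'"
proof -
  obtain A B where AB: "e = 0 \<longrightarrow> A = 0 \<and> B = 0" "homogeneous (e - 1) A" "homogeneous (e - 1) B"
    "F = T * A + S * B"
    using form_eq_at_point[OF F] by (auto simp: 0)
  have "homogeneous (e + 2) (H * A - C * B)"
    using AB(1) homogeneous_mult[OF homogeneous_H AB(2)] homogeneous_mult[OF homogeneous_C AB(3)]
    by (cases e) (auto intro!: homogeneous_diff simp: eval_nat_numeral)
  moreover have "H * F - T * (H * A - C * B) = Q * B"
    unfolding fermat_eq_SH_TC AB(4) by (simp add: algebra_simps)
  ultimately show ?thesis
    by (metis dvd_triv_left)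
qed

text \<open>The factorisation of F as T^n times a local unit, with denominators H^n cleared.
  \<open>T_divides\<close> strips off one \<open>T\<close> as long as the form vanishes at the
  point, and each time the order of the expansion drops by exactly 1, since \<open>T\<close> expands
  to \<open>fps_X\<close> and \<open>H\<close> to a unit.\<close>

lemma uniformizer_expansion:
  assumes r: "\<exists>r::'a. r ^ 4 = -1"
    and "homogeneous e F" "\<not> Q dvd F" "subdegree (loc F) = n"
  shows "\<exists>U. homogeneous (2 * n + e) U \<and> teval pt U \<noteq> 0 \<and> Q dvd H ^ n * F - T ^ n * U"
  using assms(2-)
proof (induction n arbitrary: e F)
  case 0
  then have "teval pt F \<noteq> 0"
    using loc_eq_0_iff[OF 0(1) r] loc_nth_0 by (metis subdegree_eq_0_iff)
  then show ?case
    using 0 by (intro exI[of _ F]) simp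
next
  case (Suc n)
  have "teval pt F = 0"
    using Suc.prems(3) by (metis loc_nth_0 nth_less_subdegree_zero zero_less_Suc)
  then obtain F' where F': "homogeneous (e + 2) F'" "Q dvd H * F - T * F'"
    using T_divides Suc.prems(1) by blast
  have nz: "loc F \<noteq> 0" "loc H \<noteq> 0" and H0: "subdegree (loc H) = 0"
    using loc_eq_0_iff[OF Suc.prems(1) r] Suc.prems(2) teval_pt_H loc_nth_0[of H] by auto
  have eq: "loc H * loc F = fps_X * loc F'"
    using loc_dvd[OF F'(2)] by (simp add: loc_simps loc_T)
  then have F'nz: "loc F' \<noteq> 0"
    using nz by auto
  then have "subdegree (loc F') = n"
    using arg_cong[OF eq, of subdegree] nz H0 Suc.prems(3) by simp
  moreover have "\<not> Q dvd F'"
    using F'nz loc_eq_0_iff[OF F'(1) r] by simp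
  ultimately obtain U where U: "homogeneous (2 * n + (e + 2)) U" "teval pt U \<noteq> 0"
    "Q dvd H ^ n * F' - T ^ n * U"
    using Suc.IH F'(1) by blast
  have "H ^ Suc n * F - T ^ Suc n * U = H ^ n * (H * F - T * F') + T * (H ^ n * F' - T ^ n * U)"
    by (simp add: algebra_simps)
  then have "Q dvd H ^ Suc n * F - T ^ Suc n * U"
    using F'(2) U(3) by (metis dvd_add dvd_mult)
  with U(1,2) show ?case
    by (intro exI[of _ U]) (simp add: algebra_simps)
qed

end


section \<open>Points of the curve and the charts around them\<close>

definition proj_pt :: "'a::field ^ 3 \<Rightarrow> ('a ^ 3) set" where
  "proj_pt v = {c *s v | c. c \<noteq> 0}"

lemma vanishes_at_proj_pt: "homogeneous e F \<Longrightarrow> vanishes_at F (proj_pt v) \<longleftrightarrow> teval v F = 0"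
proof -
  assume F: "homogeneous e F"
  have "v = 1 *s v"
    by simp
  then have "v \<in> proj_pt v"
    unfolding proj_pt_def by (metis (mono_tags, lifting) mem_Collect_eq zero_neq_one)
  then show ?thesis
    using teval_scale[OF F] by (auto simp: vanishes_at_def proj_pt_def)
qed

lemma proj_pt_scale: "a \<noteq> 0 \<Longrightarrow> proj_pt (a *s v) = proj_pt v"
proof -
  assume a: "a \<noteq> 0"
  have "c *s v = (c / a) *s (a *s v)" "c *s (a *s v) = (c * a) *s v" for c
    using a by (simp_all add: vector_smult_assoc)
  then show ?thesis
    using a unfolding proj_pt_def by (metis (mono_tags, opaque_lifting) divide_eq_0_iff mult_eq_0_iff)
qed

lemma curve_points_eq: "curve = {proj_pt v | v. v \<noteq> 0 \<and> teval v Q = 0}"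
  unfolding curve_points_def proj_plane_def
  using vanishes_at_proj_pt[OF homogeneous_fermat] unfolding proj_pt_def by blast

text \<open>Once v_i is nonzero, the equation forbids that both other coordinates vanish; the
  nonvanishing one takes the role of X_j.\<close>

lemma curve_point_chart:
  fixes P :: "('a::field_char_0 ^ 3) set"
  assumes "P \<in> curve"
  obtains i j k b c where "chart i j k b c" "P = proj_pt (chart.pt i j b c)"
proof -
  obtain v where v: "P = proj_pt v" "v \<noteq> 0" "teval v Q = 0"
    using assms by (auto simp: curve_points_eq)
  obtain i where i: "v $ i \<noteq> 0"
    using v(2) by (auto simp: vec_eq_iff)
  have eval: "v $ i ^ 4 + v $ j ^ 4 + v $ k ^ 4 = 0" if "distinct [i, j, k]" for j k
    using v(3) by (simp add: fermat_quartic_eq[OF that] teval_simps)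
  have "\<exists>j k. distinct [i, j, k]"
  proof (cases "i = 1 \<or> i = 2")
    case True
    then show ?thesis
      by (intro exI[of _ "if i = 1 then 2 else 1"] exI[of _ 3]) auto
  next
    case False
    then show ?thesis
      by (intro exI[of _ 1] exI[of _ 2]) auto
  qed
  then obtain j k where jk: "distinct [i, j, k]"
    by blast
  have "\<exists>j k. distinct [i, j, k] \<and> v $ j \<noteq> 0"
  proof (cases "v $ j = 0")
    case True
    then have "v $ k \<noteq> 0"
      using eval[OF jk] i by auto
    then show ?thesis
      using jk by (intro exI[of _ k] exI[of _ j]) auto
  qed (use jk in auto)
  then obtain j k where jk: "distinct [i, j, k]" "v $ j \<noteq> 0"
    by blast
  let ?b = "v $ j / v $ i" and ?c = "v $ k / v $ i"
  have "1 + ?b ^ 4 + ?c ^ 4 = (v $ i ^ 4 + v $ j ^ 4 + v $ k ^ 4) / v $ i ^ 4"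
    using i by (simp add: power_divide add_divide_distrib)
  then have ch: "chart i j k ?b ?c"
    using jk i eval[OF jk(1)] by unfold_locales auto
  interpret chart i j k ?b ?c
    by (rule ch)
  have "n = i \<or> n = j \<or> n = k" for n
    using UNIV_3[OF jk(1)] by blast
  then have "pt = (1 / v $ i) *s v"
    using i jk by (auto simp: vec_eq_iff pt_def)
  then have "P = proj_pt pt"
    using i v(1) by (simp add: proj_pt_scale)
  with ch show ?thesis
    by (rule that)
qed


text \<open>What an expansion at P must satisfy, without mention of a chart, so that it can be
  transported along automorphisms. The last clause excludes ramified reparametrisations such as t to
  t^2, which would multiply all orders.\<close>

definition branch :: "('a ternary \<Rightarrow> 'a fps) \<Rightarrow> ('a::field ^ 3) set \<Rightarrow> bool" where
  "branch \<psi> P \<longleftrightarrow> ring_map \<psi> \<and>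
    (\<forall>e F. homogeneous e F \<longrightarrow> (fps_nth (\<psi> F) 0 = 0 \<longleftrightarrow> vanishes_at F P)) \<and>
    (\<forall>e F. homogeneous e F \<longrightarrow> (\<psi> F = 0 \<longleftrightarrow> Q dvd F)) \<and>
    (\<exists>e T. homogeneous e T \<and> subdegree (\<psi> T) = 1)"

text \<open>The choice of the branch is harmless by \<open>subdegree_branch_chart\<close>. For P on
  the curve the value at a form divisible by Q is the default 0, not infinity.\<close>

definition val :: "('a::field ^ 3) set \<Rightarrow> 'a ternary \<Rightarrow> nat" where
  "val P F = subdegree ((SOME \<psi>. branch \<psi> P) F)"

lemma branch_loc:
  fixes b c :: "'a::{field_char_0, alg_closed_field}"
  assumes "chart i j k b c"
  shows "branch (chart.loc i j b c) (proj_pt (chart.pt i j b c))"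
proof -
  interpret chart i j k b c
    by (rule assms)
  have "\<exists>e T. homogeneous e T \<and> subdegree (loc T) = 1"
    by (intro exI[of _ 1] exI[of _ T]) (simp add: homogeneous_T[simplified] loc_T)
  then show ?thesis
    unfolding branch_def
    using loc_eq_0_iff[OF _ fourth_root_exists] by (auto simp: ring_map_loc vanishes_at_proj_pt loc_nth_0)
qed

text \<open>The expansion at the uniformizer \<open>T\<close> of a chart shows that every order along a branch is a
  multiple of the order of \<open>T\<close>; since the order \<open>1\<close> occurs, \<open>T\<close> has order \<open>1\<close>.\<close>

lemma subdegree_branch_chart:
  fixes b c :: "'a::{field_char_0, alg_closed_field}"
  assumes ch: "chart i j k b c" and \<psi>: "branch \<psi> (proj_pt (chart.pt i j b c))"
    and F: "homogeneous e F"
  shows "subdegree (\<psi> F) = subdegree (chart.loc i j b c F)"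
proof -
  interpret chart i j k b c
    by (rule ch)
  have rm: "ring_map \<psi>" and dvd0: "\<And>e F. homogeneous e F \<Longrightarrow> \<psi> F = 0 \<longleftrightarrow> Q dvd F"
    and van: "\<And>e F. homogeneous e F \<Longrightarrow> fps_nth (\<psi> F) 0 = 0 \<longleftrightarrow> teval pt F = 0"
    using \<psi> by (auto simp: branch_def vanishes_at_proj_pt)
  have r: "\<exists>r::'a. r ^ 4 = -1"
    by (rule fourth_root_exists)
  have nvan: "subdegree (\<psi> G) = 0" if "homogeneous e G" "teval pt G \<noteq> 0" for e G
    using van[OF that(1)] that(2) by (simp add: subdegree_eq_0_iff)
  have T: "\<psi> T \<noteq> 0"
    using dvd0[OF homogeneous_T] loc_eq_0_iff[OF homogeneous_T r] loc_T by simp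
  have *: "subdegree (\<psi> F) = subdegree (loc F) * subdegree (\<psi> T)"
    if F: "homogeneous e F" "\<not> Q dvd F" for e F
  proof -
    let ?n = "subdegree (loc F)"
    obtain U where U: "homogeneous (2 * ?n + e) U" "teval pt U \<noteq> 0" "Q dvd H ^ ?n * F - T ^ ?n * U"
      using uniformizer_expansion[OF r F refl] by blast
    have "homogeneous (3 * ?n + e) (H ^ ?n * F)" "homogeneous (3 * ?n + e) (T ^ ?n * U)"
      using homogeneous_mult[OF homogeneous_power[OF homogeneous_H, of ?n] F(1)]
        homogeneous_mult[OF homogeneous_power[OF homogeneous_T, of ?n] U(1)] by (simp_all add: algebra_simps)
    then have "\<psi> (H ^ ?n * F - T ^ ?n * U) = 0"
      using dvd0 U(3) homogeneous_diff by blast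
    then have eq: "\<psi> H ^ ?n * \<psi> F = \<psi> T ^ ?n * \<psi> U"
      by (simp add: ring_map_simps[OF rm])
    have "\<psi> U \<noteq> 0" "\<psi> H \<noteq> 0" "\<psi> F \<noteq> 0"
      using van[OF U(1)] U(2) van[OF homogeneous_H] teval_pt_H dvd0[OF F(1)] F(2) by auto
    then show ?thesis
      using arg_cong[OF eq, of subdegree] T nvan[OF U(1,2)] nvan[OF homogeneous_H teval_pt_H]
      by simp
  qed
  obtain e' T' where T': "homogeneous e' T'" "subdegree (\<psi> T') = 1"
    using \<psi> by (auto simp: branch_def)
  then have "\<not> Q dvd T'"
    using dvd0[OF T'(1)] by auto
  from *[OF T'(1) this] have "subdegree (\<psi> T) = 1"
    using T'(2) by auto
  then show ?thesis
    using *[OF F] dvd0[OF F] loc_eq_0_iff[OF F r] by (cases "Q dvd F") auto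
qed

section \<open>Orders of forms at a point of the curve\<close>

context
  fixes P :: "('a::{field_char_0, alg_closed_field} ^ 3) set"
  assumes P: "P \<in> curve"
begin

lemma branch_ex: "branch (SOME \<psi>. branch \<psi> P) P"
  using curve_point_chart[OF P] branch_loc by (metis someI)

lemma val_eq:
  assumes "branch \<psi> P" "homogeneous e F"
  shows "val P F = subdegree (\<psi> F)"
proof -
  obtain i j k and b c :: 'a where ch: "chart i j k b c" "P = proj_pt (chart.pt i j b c)"
    using curve_point_chart[OF P] by blast
  show ?thesis
    unfolding val_def
    using subdegree_branch_chart[OF ch(1)] branch_ex assms unfolding ch(2) by metis
qed

lemma val_mult:
  assumes "homogeneous e F" "homogeneous e' G" "\<not> Q dvd F" "\<not> Q dvd G"
  shows "val P (F * G) = val P F + val P G"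
  using branch_ex assms unfolding val_def branch_def by (simp add: ring_map_mult)

lemma val_power:
  assumes "homogeneous e F" "\<not> Q dvd F"
  shows "val P (F ^ n) = n * val P F"
  using branch_ex assms unfolding val_def branch_def by (simp add: ring_map_power)

lemma val_cong:
  assumes "homogeneous e F" "homogeneous e G" "Q dvd F - G"
  shows "val P F = val P G"
proof -
  let ?\<psi> = "SOME \<psi>. branch \<psi> P"
  have "?\<psi> (F - G) = 0"
    using branch_ex assms(3) homogeneous_diff[OF assms(1,2)] unfolding branch_def by blast
  then have "?\<psi> F = ?\<psi> G"
    using branch_ex by (simp add: branch_def ring_map_diff)
  then show ?thesis
    by (simp add: val_def)
qed

lemma val_eq_0_iff:
  assumes "homogeneous e F" "\<not> Q dvd F"
  shows "val P F = 0 \<longleftrightarrow> \<not> vanishes_at F P"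
  using branch_ex assms unfolding val_def branch_def subdegree_eq_0_iff by blast

lemma nonvanishing_not_dvd:
  assumes "homogeneous e F" "\<not> vanishes_at F P"
  shows "\<not> Q dvd F"
proof
  let ?\<psi> = "SOME \<psi>. branch \<psi> P"
  assume "Q dvd F"
  then have "?\<psi> F = 0"
    using branch_ex assms(1) unfolding branch_def by blast
  then have "fps_nth (?\<psi> F) 0 = 0"
    by simp
  then show False
    using branch_ex assms unfolding branch_def by blast
qed

lemma vanishes_at_mult:
  assumes "homogeneous e F" "homogeneous e' G"
  shows "vanishes_at (F * G) P \<longleftrightarrow> vanishes_at F P \<or> vanishes_at G P"
proof -
  let ?\<psi> = "SOME \<psi>. branch \<psi> P"
  have *: "vanishes_at F P \<longleftrightarrow> fps_nth (?\<psi> F) 0 = 0" if "homogeneous e F" for e F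
    using branch_ex that unfolding branch_def by blast
  have "ring_map ?\<psi>"
    using branch_ex unfolding branch_def by blast
  then show ?thesis
    unfolding *[OF assms(1)] *[OF assms(2)] *[OF homogeneous_mult[OF assms]] by (simp add: ring_map_mult)
qed

text \<open>The chart-free summary of the local theory: T / L will serve as uniformizer, the linear
  form L making the quotient a fraction of degree 0, and H is the local unit that clears
  denominators.\<close>

lemma val_expansion:
  obtains T L H where "homogeneous 1 T" "homogeneous 1 L" "homogeneous 3 H"
    "\<not> vanishes_at L P" "\<not> vanishes_at H P" "\<not> Q dvd T" "val P T = 1"
    "\<And>e F. homogeneous e F \<Longrightarrow> \<not> Q dvd F \<Longrightarrow>
      \<exists>U. homogeneous (2 * val P F + e) U \<and> \<not> vanishes_at U P \<and>
        Q dvd H ^ val P F * F - T ^ val P F * U"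
proof -
  obtain i j k and b c :: 'a where ch: "chart i j k b c" "P = proj_pt (chart.pt i j b c)"
    using curve_point_chart[OF P] by blast
  interpret chart i j k b c
    by (rule ch)
  have v: "val P F = subdegree (loc F)" if "homogeneous e F" for e F
    using val_eq[OF _ that] branch_loc[OF ch(1)] ch(2) by metis
  have "\<not> Q dvd T"
    using loc_eq_0_iff[OF homogeneous_T fourth_root_exists] by (simp add: loc_T)
  moreover have "val P T = 1"
    using v[OF homogeneous_T] by (simp add: loc_T)
  ultimately show ?thesis
  proof (intro that[of T "tvar i" H])
    show "\<exists>U. homogeneous (2 * val P F + e) U \<and> \<not> vanishes_at U P \<and>
        Q dvd H ^ val P F * F - T ^ val P F * U"
      if "homogeneous e F" "\<not> Q dvd F" for e F
      using uniformizer_expansion[OF fourth_root_exists that refl]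
      unfolding v[OF that(1), symmetric] ch(2) by (metis vanishes_at_proj_pt)
  qed (simp_all add: homogeneous_T homogeneous_H ch(2) vanishes_at_proj_pt[OF homogeneous_tvar]
      vanishes_at_proj_pt[OF homogeneous_H] teval_pt_H del: One_nat_def)
qed

end


section \<open>Semilinear automorphisms of the curve\<close>

definition twist_point :: "('a::field \<Rightarrow> 'a) \<Rightarrow> (3 \<Rightarrow> 'a) \<Rightarrow> ('a ^ 3) set \<Rightarrow> ('a ^ 3) set" where
  "twist_point s d P = (\<lambda>v. \<chi> i. s (v $ i) / d i) ` P"

lemma twist_point_proj_pt:
  assumes "ring_map s" "bij s"
  shows "twist_point s d (proj_pt v) = proj_pt (\<chi> i. s (v $ i) / d i)"
proof -
  have 0: "s c = 0 \<longleftrightarrow> c = 0" for c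
    using assms by (metis bij_pointE ring_map_0)
  define f where "f u = (\<chi> i. s (u $ i) / d i)" for u
  have *: "f (c *s v) = s c *s f v" for c
    using assms by (simp add: f_def vec_eq_iff ring_map_mult)
  have s_image: "s ` {c. c \<noteq> 0} = {c. c \<noteq> 0}"
  proof safe
    fix c :: 'a assume c: "c \<noteq> 0"
    obtain c' where "c = s c'"
      using assms(2) by (metis bij_pointE)
    then show "c \<in> s ` {c. c \<noteq> 0}"
      using c 0 by auto
  qed (use 0 in auto)
  have "twist_point s d (proj_pt v) = (\<lambda>c. f (c *s v)) ` {c. c \<noteq> 0}"
    unfolding twist_point_def proj_pt_def f_def by blast
  also have "\<dots> = (\<lambda>c. c *s f v) ` s ` {c. c \<noteq> 0}"
    by (simp only: * image_image)
  also have "\<dots> = proj_pt (f v)"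
    unfolding s_image proj_pt_def by blast
  finally show ?thesis
    by (simp add: f_def)
qed

locale symmetry =
  fixes s :: "'a::{field_char_0, alg_closed_field} \<Rightarrow> 'a" and d :: "3 \<Rightarrow> 'a"
  assumes ring_map_s: "ring_map s" and bij_s: "bij s" and d: "\<And>i. d i ^ 4 = 1"
begin

lemma s_eq_0_iff: "s c = 0 \<longleftrightarrow> c = 0"
  using bij_s ring_map_0[OF ring_map_s] by (metis bij_pointE)

lemma d_nonzero: "d i \<noteq> 0"
  using d[of i] by auto

text \<open>\<open>twist_point\<close> divides by \<open>d i\<close> where \<open>twist\<close>
  multiplies by it, so the factors cancel and the value is only changed by \<open>s\<close>.\<close>

lemma vanishes_at_twist: "vanishes_at (twist s d F) (twist_point s d P) \<longleftrightarrow> vanishes_at F P"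
  by (simp add: vanishes_at_def twist_point_def teval_twist[OF ring_map_s d_nonzero] s_eq_0_iff)

lemma twist_point_curve:
  assumes "P \<in> curve"
  shows "twist_point s d P \<in> curve"
proof -
  obtain v where v: "P = proj_pt v" "v \<noteq> 0" "teval v Q = 0"
    using assms by (auto simp: curve_points_eq)
  let ?v = "\<chi> i. s (v $ i) / d i"
  have "teval ?v Q = s (teval v Q)"
    using teval_twist[of s d v Q, OF ring_map_s d_nonzero]
    by (simp only: twist_fermat[OF ring_map_s d])
  moreover have "?v \<noteq> 0"
    using v(2) by (auto simp: vec_eq_iff s_eq_0_iff d_nonzero)
  ultimately show ?thesis
    using v(3) unfolding v(1) twist_point_proj_pt[OF ring_map_s bij_s] curve_points_eq
    by (auto simp: s_eq_0_iff)
qed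

abbreviation s' :: "'a \<Rightarrow> 'a" where
  "s' \<equiv> inv_into UNIV s"

text \<open>Determined by \<open>s (d' i) * d i = 1\<close>, the condition that
  \<open>twist_twist\<close> imposes on an inverse.\<close>

abbreviation d' :: "3 \<Rightarrow> 'a" where
  "d' \<equiv> \<lambda>i. s' (1 / d i)"

lemma symmetry_inverse: "symmetry (s') d'"
proof -
  let ?h = s'
  have inv: "s (?h x) = x" "?h (s x) = x" for x
    using bij_s by (simp_all add: bij_is_surj surj_f_inv_f bij_is_inj)
  have rm: "ring_map ?h"
  proof (rule ring_mapI)
    show "?h 1 = 1"
      using inv(2)[of 1] by (simp only: ring_map_1[OF ring_map_s])
    show "?h (x + y) = ?h x + ?h y" for x y
      using inv(2)[of "?h x + ?h y"] by (simp only: ring_map_add[OF ring_map_s] inv(1))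
    show "?h (x * y) = ?h x * ?h y" for x y
      using inv(2)[of "?h x * ?h y"] by (simp only: ring_map_mult[OF ring_map_s] inv(1))
  qed
  show ?thesis
    using bij_s by unfold_locales
      (simp_all add: rm bij_imp_bij_inv power_divide d ring_map_1[OF rm] flip: ring_map_power[OF rm])
qed

lemma twist_inverse:
  "twist s d (twist (s') d' F) = F"
  "twist (s') d' (twist s d F) = F"
proof -
  interpret I: symmetry s' d'
    by (rule symmetry_inverse)
  have [simp]: "s (s' x) = x" "s' (s x) = x" for x
    using bij_s by (simp_all add: bij_is_surj surj_f_inv_f bij_is_inj)
  show "twist s d (twist (s') d' F) = F"
    by (subst twist_twist) (simp_all add: ring_map_s I.ring_map_s d_nonzero twist_id)
  have "s' (d i) * s' (1 / d i) = 1" for i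
    by (simp add: ring_map_mult[OF I.ring_map_s, symmetric] d_nonzero ring_map_1[OF I.ring_map_s])
  then show "twist (s') d' (twist s d F) = F"
    by (subst twist_twist) (simp_all add: ring_map_s I.ring_map_s twist_id)
qed

lemma dvd_twist_iff: "Q dvd twist s d F \<longleftrightarrow> Q dvd F"
proof
  interpret I: symmetry s' d'
    by (rule symmetry_inverse)
  assume "Q dvd twist s d F"
  from ring_map_dvd[OF ring_map_twist[OF I.ring_map_s, of d'] this]
  show "Q dvd F"
    by (simp only: twist_inverse(2) twist_fermat[OF I.ring_map_s I.d])
next
  assume "Q dvd F"
  from ring_map_dvd[OF ring_map_twist[OF ring_map_s, of d] this]
  show "Q dvd twist s d F"
    by (simp only: twist_fermat[OF ring_map_s d])
qed

text \<open>A branch at the image point, composed with \<open>twist\<close>, is a branch at P. As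
  orders can be computed on any branch, no comparison of charts is required.\<close>

lemma val_twist:
  assumes P: "P \<in> curve" and F: "homogeneous e F"
  shows "val (twist_point s d P) (twist s d F) = val P F"
proof -
  interpret I: symmetry s' d'
    by (rule symmetry_inverse)
  let ?P = "twist_point s d P"
  define \<psi> where "\<psi> = (SOME \<psi>. branch \<psi> ?P)"
  have \<psi>: "branch \<psi> ?P"
    unfolding \<psi>_def by (rule branch_ex[OF twist_point_curve[OF P]])
  then obtain e' T where T: "homogeneous e' T" "subdegree (\<psi> T) = 1"
    unfolding branch_def by blast
  have "branch (\<lambda>F. \<psi> (twist s d F)) P"
    unfolding branch_def
  proof (intro conjI allI impI)
    show "ring_map (\<lambda>F. \<psi> (twist s d F))"
      using \<psi> unfolding branch_def by (intro ring_map_comp[OF _ ring_map_twist[OF ring_map_s]]) blast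
    show "\<exists>e T. homogeneous e T \<and> subdegree (\<psi> (twist s d T)) = 1"
      using T(2) homogeneous_twist[OF I.ring_map_s T(1)]
      by (intro exI[of _ e'] exI[of _ "twist (s') d' T"])
        (simp add: twist_inverse(1))
    fix e and F :: "'a ternary"
    assume "homogeneous e F"
    from homogeneous_twist[OF ring_map_s this]
    show "fps_nth (\<psi> (twist s d F)) 0 = 0 \<longleftrightarrow> vanishes_at F P"
      "\<psi> (twist s d F) = 0 \<longleftrightarrow> Q dvd F"
      using \<psi> unfolding branch_def vanishes_at_twist[symmetric, of F P] dvd_twist_iff[symmetric, of F]
      by blast+
  qed
  from val_eq[OF P this F] show ?thesis
    by (simp add: val_def \<psi>_def)
qed

end


section \<open>The degree of the divisor of a form\<close>

definition zeros :: "'a::field ternary \<Rightarrow> ('a ^ 3) set set" where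
  "zeros F = {P \<in> curve. vanishes_at F P}"

text \<open>Over an infinite set the sum would be 0 by default, so finiteness of the zeros is always
  proved alongside; for forms not divisible by Q it is part of \<open>bezout\<close>.\<close>

definition vdeg :: "'a::field ternary \<Rightarrow> nat" where
  "vdeg F = (\<Sum>P\<in>zeros F. val P F)"

lemma vdeg_superset:
  fixes F :: "'a::{field_char_0, alg_closed_field} ternary"
  assumes "homogeneous e F" "\<not> Q dvd F"
    and "finite A" "zeros F \<subseteq> A" "A \<subseteq> curve"
  shows "vdeg F = (\<Sum>P\<in>A. val P F)"
  unfolding vdeg_def
proof (rule sum.mono_neutral_left)
  show "\<forall>P\<in>A - zeros F. val P F = 0"
  proof
    fix P assume "P \<in> A - zeros F"
    then have "P \<in> curve" "\<not> vanishes_at F P"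
      using assms(5) by (auto simp: zeros_def)
    then show "val P F = 0"
      by (simp add: val_eq_0_iff[OF _ assms(1,2)])
  qed
qed (use assms in auto)

lemma zeros_mult:
  fixes F :: "'a::{field_char_0, alg_closed_field} ternary"
  assumes "homogeneous e F" "homogeneous e' G"
  shows "zeros (F * G) = zeros F \<union> zeros G"
  using vanishes_at_mult[OF _ assms] by (auto simp: zeros_def)

lemma vdeg_mult:
  fixes F :: "'a::{field_char_0, alg_closed_field} ternary"
  assumes F: "homogeneous e F" "\<not> Q dvd F" and G: "homogeneous e' G" "\<not> Q dvd G"
    and fin: "finite (zeros F)" "finite (zeros G)"
  shows "vdeg (F * G) = vdeg F + vdeg G"
proof -
  let ?A = "zeros F \<union> zeros G"
  have A: "finite ?A" "?A \<subseteq> curve"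
    using fin by (auto simp: zeros_def)
  have nd: "\<not> Q dvd F * G"
    using fermat_prime[OF F(1) G(1)] F G by blast
  have "vdeg (F * G) = (\<Sum>P\<in>?A. val P (F * G))"
    using zeros_mult[OF F(1) G(1)] A
    by (intro vdeg_superset[OF homogeneous_mult[OF F(1) G(1)] nd]) auto
  also have "\<dots> = (\<Sum>P\<in>?A. val P F + val P G)"
    using A(2) by (intro sum.cong refl val_mult[OF _ F(1) G(1) F(2) G(2)]) auto
  also have "\<dots> = vdeg F + vdeg G"
    using vdeg_superset[OF F A(1) _ A(2)] vdeg_superset[OF G A(1) _ A(2)] by (simp add: sum.distrib)
  finally show ?thesis .
qed

lemma vdeg_cong:
  fixes F :: "'a::{field_char_0, alg_closed_field} ternary"
  assumes "homogeneous e F" "homogeneous e G" "Q dvd F - G"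
  shows "zeros F = zeros G" "vdeg F = vdeg G"
proof -
  have vc: "val P F = val P G" if "P \<in> curve" for P
    by (rule val_cong[OF that assms])
  have "vanishes_at F P \<longleftrightarrow> vanishes_at G P" if P: "P \<in> curve" for P
  proof -
    have "vanishes_at (F - G) P"
      using nonvanishing_not_dvd[OF P homogeneous_diff[OF assms(1,2)]] assms(3) by blast
    then show ?thesis
      by (auto simp: vanishes_at_def teval_simps)
  qed
  then show z: "zeros F = zeros G"
    by (auto simp: zeros_def)
  show "vdeg F = vdeg G"
    unfolding vdeg_def z using vc by (intro sum.cong refl) (auto simp: zeros_def)
qed

lemma (in symmetry) zeros_twist: "zeros (twist s d F) = twist_point s d ` zeros F"
  and inj_twist_point: "inj_on (twist_point s d) (curve)"
proof -
  interpret I: symmetry s' d'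
    by (rule symmetry_inverse)
  have [simp]: "s (s' x) = x" "s' (s x) = x" for x
    using bij_s by (simp_all add: bij_is_surj surj_f_inv_f bij_is_inj)
  have [simp]: "s' (x / y) = s' x / s' y" for x y
  proof -
    have "s' (x / y) * s' y = s' x" if "y \<noteq> 0"
      using that by (simp flip: ring_map_mult[OF I.ring_map_s])
    then show ?thesis
      by (cases "y = 0") (auto simp: field_simps I.s_eq_0_iff ring_map_0[OF I.ring_map_s])
  qed
  have comp: "twist_point s d (twist_point (s') d' P) = P"
    "twist_point (s') d' (twist_point s d P) = P" for P
    by (simp_all add: twist_point_def image_image d_nonzero ring_map_1[OF I.ring_map_s]
        ring_map_mult[OF ring_map_s] I.s_eq_0_iff)
  then show "inj_on (twist_point s d) (curve)"
    by (metis inj_on_inverseI)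
  show "zeros (twist s d F) = twist_point s d ` zeros F"
  proof safe
    fix P assume P: "P \<in> zeros (twist s d F)"
    let ?P = "twist_point (s') d' P"
    have "vanishes_at (twist s d F) (twist_point s d ?P)"
      unfolding comp(1) using P by (simp add: zeros_def)
    then have "vanishes_at F ?P"
      by (simp only: vanishes_at_twist)
    moreover have "?P \<in> curve"
      using P by (intro I.twist_point_curve) (simp add: zeros_def)
    ultimately have "?P \<in> zeros F"
      by (simp add: zeros_def)
    then show "P \<in> twist_point s d ` zeros F"
      by (rule image_eqI[rotated]) (simp only: comp(1))
  qed (auto simp: zeros_def twist_point_curve vanishes_at_twist)
qed

lemma (in symmetry) vdeg_twist:
  assumes "homogeneous e F"
  shows "vdeg (twist s d F) = vdeg F"
proof -
  have "inj_on (twist_point s d) (zeros F)"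
    using inj_twist_point by (rule inj_on_subset) (auto simp: zeros_def)
  then have "vdeg (twist s d F) = (\<Sum>P\<in>zeros F. val (twist_point s d P) (twist s d F))"
    unfolding vdeg_def zeros_twist by (rule sum.reindex_cong) auto
  also have "\<dots> = vdeg F"
    unfolding vdeg_def by (intro sum.cong refl val_twist[OF _ assms]) (auto simp: zeros_def)
  finally show ?thesis .
qed


section \<open>Divisors of linear forms and of products of them\<close>

lemma card_fourth_roots:
  fixes x :: "'a::{field_char_0, alg_closed_field}"
  assumes "x \<noteq> 0"
  shows "card {y. y ^ 4 = x} = 4"
proof -
  obtain r :: 'a where r: "r ^ 4 = -1"
    using fourth_root_exists by blast
  define u where "u = r\<^sup>2"
  have u: "u\<^sup>2 = -1"
    using r by (simp add: u_def flip: power_mult)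
  obtain z where z: "z ^ 4 = x"
    using fourth_root_exists by blast
  have nz: "z \<noteq> 0" "u \<noteq> 0" "u \<noteq> 1" "u \<noteq> -1"
    using z assms u by auto
  then have "z * (1 + u) \<noteq> 0"
    by (simp add: add_eq_0_iff)
  have "y ^ 4 = x \<longleftrightarrow> y \<in> {z, - z, u * z, - (u * z)}" for y
  proof -
    have "y ^ 4 - x = (y\<^sup>2 - z\<^sup>2) * (y\<^sup>2 + z\<^sup>2)"
      unfolding z[symmetric] by (simp add: power2_eq_square power4_eq_xxxx algebra_simps)
    also have "y\<^sup>2 + z\<^sup>2 = y\<^sup>2 - (u * z)\<^sup>2"
      by (simp add: power_mult_distrib u)
    finally have "y ^ 4 = x \<longleftrightarrow> y\<^sup>2 = z\<^sup>2 \<or> y\<^sup>2 = (u * z)\<^sup>2"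
      by (metis eq_iff_diff_eq_0 mult_eq_0_iff)
    then show ?thesis
      by (auto simp: power2_eq_iff)
  qed
  then have "{y. y ^ 4 = x} = {z, - z, u * z, - (u * z)}"
    by blast
  moreover have "distinct [z, - z, u * z, - (u * z)]"
    using nz \<open>z * (1 + u) \<noteq> 0\<close> by (auto simp: eq_neg_iff_add_eq_0 neg_eq_iff_add_eq_0 algebra_simps)
  ultimately show ?thesis
    using distinct_card by fastforce
qed

lemma zeros_linear:
  fixes r :: "'a::{field_char_0, alg_closed_field}"
  assumes d: "distinct [i, j, k]"
  shows "zeros (tvar k - tconst r * tvar i) =
    (\<lambda>y. proj_pt (\<chi> n. if n = i then 1 else if n = j then y else r)) ` {y. y ^ 4 = - (1 + r ^ 4)}"
    (is "zeros ?L = ?p ` ?Y")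
proof -
  have L: "homogeneous 1 ?L"
    by (intro homogeneous_diff homogeneous_tconst_mult homogeneous_tvar)
  have ev: "teval v Q = v $ i ^ 4 + v $ j ^ 4 + v $ k ^ 4" for v :: "'a ^ 3"
    by (simp add: fermat_quartic_eq[OF d] teval_simps)
  have all: "n = i \<or> n = j \<or> n = k" for n
    using UNIV_3[OF d] by blast
  show ?thesis
  proof (intro equalityI subsetI)
    fix P assume "P \<in> zeros ?L"
    then obtain v where v: "P = proj_pt v" "v \<noteq> 0" "teval v Q = 0" "v $ k = r * v $ i"
      by (auto simp: zeros_def curve_points_eq vanishes_at_proj_pt[OF L] teval_simps)
    have i: "v $ i \<noteq> 0"
    proof
      assume "v $ i = 0"
      then have "v $ j = 0" "v $ k = 0"
        using v(3,4) by (auto simp: ev)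
      then have "v $ n = 0" for n
        using all[of n] \<open>v $ i = 0\<close> by auto
      then have "v = 0"
        by (simp add: vec_eq_iff)
      with v(2) show False ..
    qed
    let ?y = "v $ j / v $ i"
    have "v $ j ^ 4 = - (1 + r ^ 4) * v $ i ^ 4"
      using v(3,4) by (simp add: ev power_mult_distrib algebra_simps eq_neg_iff_add_eq_0)
    then have "?y ^ 4 = - (1 + r ^ 4)"
      using i by (simp add: power_divide)
    moreover have "(\<chi> n. if n = i then 1 else if n = j then ?y else r) $ n = ((1 / v $ i) *s v) $ n" for n
      using i v(4) d all[of n] by auto
    then have "(\<chi> n. if n = i then 1 else if n = j then ?y else r) = (1 / v $ i) *s v"
      unfolding vec_eq_iff by blast
    then have "P = ?p ?y"
      using i v(1) by (simp add: proj_pt_scale)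
    ultimately show "P \<in> ?p ` ?Y"
      by blast
  next
    fix P assume "P \<in> ?p ` ?Y"
    then obtain y where y: "P = ?p y" "y ^ 4 = - (1 + r ^ 4)"
      by blast
    let ?v = "\<chi> n. if n = i then 1 else if n = j then y else r"
    have v: "?v $ i = 1" "?v $ j = y" "?v $ k = r"
      using d by auto
    have "?v \<noteq> 0"
    proof
      assume "?v = 0"
      then have "?v $ i = 0"
        by (simp only: zero_index)
      with v(1) show False
        by simp
    qed
    moreover have "teval ?v Q = 0" "teval ?v ?L = 0"
      unfolding ev by (simp_all only: v teval_simps teval_tvar teval_tconst y(2)) simp_all
    ultimately show "P \<in> zeros ?L"
      unfolding y(1) zeros_def curve_points_eq by (auto simp: vanishes_at_proj_pt[OF L])
  qed
qed

lemma proj_pt_eq_normalized: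
  assumes "proj_pt u = proj_pt v" "u $ i = 1" "v $ i = 1"
  shows "u = v"
proof -
  have "u \<in> proj_pt u"
    unfolding proj_pt_def by (intro CollectI exI[of _ 1]) simp
  then obtain c where c: "u = c *s v"
    unfolding assms(1) by (auto simp: proj_pt_def)
  have "u $ i = c * v $ i"
    by (simp only: c vector_smult_component)
  then show ?thesis
    using c assms(2,3) by simp
qed

lemma val_proj_pt_chart:
  fixes b c :: "'a::{field_char_0, alg_closed_field}"
  assumes "chart i j k b c" "homogeneous e F"
  shows "proj_pt (chart.pt i j b c) \<in> curve"
    and "val (proj_pt (chart.pt i j b c)) F = subdegree (chart.loc i j b c F)"
proof -
  interpret chart i j k b c
    by fact
  have "pt \<noteq> 0"
    using pt_simps(1) by (metis zero_index zero_neq_one)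
  moreover have "teval pt Q = 0"
    using bc by (simp add: fermat_quartic_eq[OF dist] teval_simps)
  ultimately show P: "proj_pt pt \<in> curve"
    by (auto simp: curve_points_eq)
  show "val (proj_pt pt) F = subdegree (loc F)"
    by (rule val_eq[OF P branch_loc[OF assms(1)] assms(2)])
qed

lemma diff_power4_factor:
  fixes x y :: "'a::comm_ring_1"
  shows "(x - y) * (x ^ 3 + y * x\<^sup>2 + y\<^sup>2 * x + y ^ 3) = x ^ 4 - y ^ 4"
  by (simp add: power2_eq_square power3_eq_cube power4_eq_xxxx algebra_simps)

text \<open>If 1 + r^4 is nonzero, the line meets the curve in four points, and L is the local
  parameter \<open>T\<close> of the chart at each of them. Otherwise it is the tangent at the
  hyperflex (1 : 0 : r). There the chart with j and k exchanged is used: L expands to w - r with w^4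
  - r^4 = - t^4, so the order is 4.\<close>

lemma vdeg_linear:
  fixes r :: "'a::{field_char_0, alg_closed_field}"
  assumes d: "distinct [i, j, k]"
  defines "L \<equiv> tvar k - tconst r * tvar i"
  shows "finite (zeros L)" "vdeg L = 4" "\<not> Q dvd L"
proof -
  have L: "homogeneous 1 L"
    unfolding L_def by (intro homogeneous_diff homogeneous_tconst_mult homogeneous_tvar)
  let ?pt = "\<lambda>y. (\<chi> n. if n = i then 1 else if n = j then y else r) :: 'a ^ 3"
  let ?Y = "{y. y ^ 4 = - (1 + r ^ 4)}"
  have z: "zeros L = (\<lambda>y. proj_pt (?pt y)) ` ?Y"
    unfolding L_def by (rule zeros_linear[OF d])
  have inj: "inj_on (\<lambda>y. proj_pt (?pt y)) ?Y"
  proof (rule inj_onI)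
    fix y y' assume "proj_pt (?pt y) = proj_pt (?pt y')"
    then have "?pt y = ?pt y'"
      by (rule proj_pt_eq_normalized[where i = i]) simp_all
    then have "?pt y $ j = ?pt y' $ j"
      by simp
    then show "y = y'"
      using d by (auto split: if_splits)
  qed
  have "(finite (zeros L) \<and> vdeg L = 4) \<and> \<not> Q dvd L"
  proof (cases "1 + r ^ 4 = 0")
    case False
    then have "- (1 + r ^ 4) \<noteq> 0"
      using neg_equal_0_iff_equal by blast
    then have card: "card ?Y = 4"
      by (rule card_fourth_roots)
    have v: "val (proj_pt (?pt y)) L = 1 \<and> \<not> Q dvd L" if "y \<in> ?Y" for y
    proof -
      have ch: "chart i j k y r"
        using d that False by unfold_locales (auto simp: algebra_simps)
      interpret chart i j k y r
        by (rule ch)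
      have "loc L = fps_X"
        using loc_T by (simp add: T_def L_def)
      then show ?thesis
        using val_proj_pt_chart(2)[OF ch L] loc_eq_0_iff[OF L fourth_root_exists] by (simp add: pt_def)
    qed
    have "card ?Y > 0"
      using card by linarith
    then have "finite ?Y"
      by (rule card_ge_0_finite)
    moreover have "?Y \<noteq> {}"
      using card by (metis card.empty zero_neq_numeral)
    ultimately have "finite (zeros L) \<and> \<not> Q dvd L"
      using z v by auto
    moreover have "vdeg L = (\<Sum>y\<in>?Y. val (proj_pt (?pt y)) L)"
      unfolding vdeg_def z sum.reindex[OF inj] by (simp only: o_def)
    ultimately show ?thesis
      using v card by simp
  next
    case True
    then have Y: "?Y = {0}" and r4: "r ^ 4 = -1"
      by (auto simp: eq_neg_iff_add_eq_0 add.commute)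
    have ch: "chart i k j r 0"
      using d True by unfold_locales auto
    interpret chart i k j r 0
      by (rule ch)
    have loc_L: "loc L = w - fps_const r"
      by (simp add: L_def loc_simps)
    define g where "g = w ^ 3 + fps_const r * w\<^sup>2 + fps_const (r\<^sup>2) * w + fps_const (r ^ 3)"
    have "loc L * g = w ^ 4 - fps_const (r ^ 4)"
      unfolding loc_L g_def ring_map_power[OF ring_map_fps_const] by (rule diff_power4_factor)
    also have "\<dots> = - (fps_X ^ 4)"
      by (simp add: w_power r4)
    finally have eq: "loc L * g = - (fps_X ^ 4)" .
    have "fps_nth g 0 = 4 * r ^ 3"
      using ring_map_power[OF ring_map_fps_nth_0, of w] by (simp add: g_def power3_eq_cube power2_eq_square)
    then have g: "subdegree g = 0" "g \<noteq> 0"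
      using b by auto
    have "loc L \<noteq> 0"
      using eq by auto
    then have "subdegree (loc L) = 4"
      using arg_cong[OF eq, of subdegree] g by (simp add: fps_X_power_subdegree)
    moreover have "?pt 0 = pt"
      using d UNIV_3[OF d] by (auto simp: pt_def vec_eq_iff)
    ultimately show ?thesis
      using val_proj_pt_chart(2)[OF ch L] \<open>loc L \<noteq> 0\<close> loc_eq_0_iff[OF L fourth_root_exists]
      unfolding vdeg_def z Y by simp
  qed
  then show "finite (zeros L)" "vdeg L = 4" "\<not> Q dvd L"
    by auto
qed

lemma bform_mult_tvar:
  assumes "degree p < Suc e"
  shows "bform i k (Suc e) p = tvar i * bform i k e p"
proof -
  have "bform i k (Suc e) p = (\<Sum>a\<le>e. tconst (coeff p a) * tvar k ^ a * tvar i ^ (Suc e - a))"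
    using assms by (simp add: bform_def coeff_eq_0)
  also have "\<dots> = tvar i * bform i k e p"
    unfolding bform_def sum_distrib_left
    by (intro sum.cong refl) (simp add: Suc_diff_le mult_ac)
  finally show ?thesis .
qed

lemma bform_pCons_0: "bform i k (Suc e) (pCons 0 p) = tvar k * bform i k e p"
  unfolding bform_def sum_distrib_left sum.atMost_Suc_shift by (simp add: mult_ac)

lemma bform_smult: "bform i k e (Polynomial.smult c p) = tconst c * bform i k e p"
  unfolding bform_def sum_distrib_left
  by (simp add: ring_map_mult[OF ring_map_tconst] mult_ac)

lemma bform_mult_linear:
  assumes "degree p < Suc e"
  shows "bform i k (Suc e) ([:- r, 1:] * p) = (tvar k - tconst r * tvar i) * bform i k e p"
proof -
  have "[:- r, 1:] * p = pCons 0 p + Polynomial.smult (- r) p"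
    by simp
  then show ?thesis
    by (simp only: bform_add bform_pCons_0 bform_smult bform_mult_tvar[OF assms])
       (simp add: algebra_simps ring_map_uminus[OF ring_map_tconst])
qed

text \<open>The form splits into e linear factors, X_k - r X_i for a root r of p and X_i for each
  drop of the degree of p below e; every factor contributes 4.\<close>

lemma vdeg_bform:
  fixes p :: "'a::{field_char_0, alg_closed_field} poly"
  assumes d: "distinct [i, j, k]"
    and p: "p \<noteq> 0" "degree p \<le> e"
  shows "finite (zeros (bform i k e p)) \<and> vdeg (bform i k e p) = 4 * e \<and> \<not> Q dvd bform i k e p"
  using p
proof (induction e arbitrary: p)
  case 0
  then obtain c where c: "p = [:c:]" "c \<noteq> 0"
    by (metis degree_0_id le_zero_eq pCons_0_0)
  have b: "bform i k 0 p = tconst c"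
    by (simp add: bform_def c)
  have z: "zeros (tconst c) = {}"
    using c by (auto simp: zeros_def curve_points_eq vanishes_at_proj_pt[OF homogeneous_tconst])
  have "\<not> Q dvd tconst c"
  proof
    assume "Q dvd tconst c"
    then have "teval v (tconst c) = 0" if "teval v Q = 0" for v
      using ring_map_dvd[OF ring_map_teval, of Q "tconst c" v] that
      by (simp add: teval_simps)
    from this[of 0] show False
      using c by (simp add: fermat_quartic_def teval_simps)
  qed
  then show ?case
    by (simp add: b z vdeg_def)
next
  case (Suc e)
  have step: "?case" if L: "homogeneous 1 L" "finite (zeros L)" "vdeg L = 4" "\<not> Q dvd L"
    and eq: "bform i k (Suc e) p = L * bform i k e q" and q: "q \<noteq> 0" "degree q \<le> e" for L q
    using Suc.IH[OF q] zeros_mult[OF L(1) homogeneous_bform] vdeg_mult[OF L(1,4) homogeneous_bform _ L(2)]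
      fermat_prime[OF L(1) homogeneous_bform, of i k e q] L
    unfolding eq by auto
  show ?case
  proof (cases "degree p < Suc e")
    case True
    \<comment> \<open>X_i is a linear form as in \<open>vdeg_linear\<close>, with the outer indices
      exchanged and r = 0.\<close>
    have d': "distinct [k, j, i]"
      using d by auto
    show ?thesis
      using vdeg_linear[OF d', of 0] True Suc.prems
      by (intro step[of "tvar i" p] bform_mult_tvar homogeneous_tvar) simp_all
  next
    case False
    then have deg: "degree p = Suc e"
      using Suc.prems by simp
    then obtain r where "poly p r = 0"
      using alg_closed_imp_poly_has_root[of p] by auto
    then obtain q where q: "p = [:- r, 1:] * q"
      by (auto simp: poly_eq_0_iff_dvd dvd_def)
    then have "q \<noteq> 0"
      using Suc.prems by auto
    then have "degree q \<le> e"
      using deg unfolding q by (subst (asm) degree_mult_eq) auto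
    then show ?thesis
      using vdeg_linear[OF d, of r] \<open>q \<noteq> 0\<close> unfolding q
      by (intro step[unfolded q, of "tvar k - tconst r * tvar i" q] bform_mult_linear homogeneous_diff
          homogeneous_tconst_mult homogeneous_tvar) simp_all
  qed
qed

lemma twist_nform:
  assumes d: "distinct [i, j, k]"
  shows "twist (\<lambda>c. c) (\<lambda>n. if n = j then u else 1) (nform i j k e a) =
    nform i j k e (\<lambda>m. Polynomial.smult (u ^ m) (a m))"
proof -
  let ?t = "twist (\<lambda>c. c) (\<lambda>n. if n = j then u else 1)"
  have t: "ring_map ?t"
    by (intro ring_map_twist ring_map_id)
  have "?t (tvar i) = tvar i" "?t (tvar k) = tvar k" "?t (tvar j) = tconst u * tvar j"
    using d by (auto simp: twist_tvar ring_map_id)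
  then show ?thesis
    unfolding nform_def bform_smult
    by (simp add: ring_map_sum[OF t] ring_map_simps[OF t] bform_def twist_tconst ring_map_id
        power_mult_distrib ring_map_power[OF ring_map_tconst] mult_ac)
qed

text \<open>By uniqueness of the normal form, only the power \<open>X\<^sub>j\<^sup>0\<close> occurs in it.\<close>

lemma twist_fixed_imp_bform:
  fixes u :: "'a::{field_char_0, alg_closed_field}"
  assumes d: "distinct [i, j, k]" and u: "u\<^sup>2 = -1" and F: "homogeneous e F"
    and fixed: "twist (\<lambda>c. c) (\<lambda>n. if n = j then u else 1) F = F"
  shows "\<exists>p. degree p \<le> e \<and> Q dvd F - bform i k e p"
proof -
  obtain r :: 'a where r: "r ^ 4 = -1"
    using fourth_root_exists by blast
  interpret chart i j k r 0
    by unfold_locales (use r d in auto)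
  let ?t = "twist (\<lambda>c. c) (\<lambda>n. if n = j then u else 1)"
  have u4: "u ^ 4 = 1"
    using arg_cong[OF u, of "\<lambda>x. x\<^sup>2"] by (simp flip: power_mult)
  have t: "ring_map ?t"
    by (intro ring_map_twist ring_map_id)
  have tf: "?t Q = Q"
    by (rule twist_fermat) (simp_all add: ring_map_id u4)
  from homogeneous_has_nform[OF d F] obtain a where
    a: "\<And>m. a m = 0 \<or> m + degree (a m) \<le> e" "Q dvd F - nform i j k e a"
    unfolding has_nform_def by blast
  let ?b = "\<lambda>m. Polynomial.smult (u ^ m) (a m)"
  \<comment> \<open>The coefficients of the difference between the normal forms of F and of its
    twist. The factor 1 - u^m is nonzero for m = 1, 2, 3.\<close>
  let ?c = "\<lambda>m. Polynomial.smult (1 - u ^ m) (a m)"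
  have "Q dvd F - nform i j k e ?b"
    using ring_map_dvd[OF t a(2)] by (simp only: tf ring_map_diff[OF t] fixed twist_nform[OF d])
  then have "Q dvd (F - nform i j k e ?b) - (F - nform i j k e a)"
    using a(2) by (rule dvd_diff)
  also have "(F - nform i j k e ?b) - (F - nform i j k e a) = nform i j k e a - nform i j k e ?b"
    by simp
  also have "\<dots> = nform i j k e ?c"
    unfolding nform_def sum_subtractf[symmetric]
    by (intro sum.cong refl)
       (simp add: bform_smult ring_map_diff[OF ring_map_tconst] ring_map_1[OF ring_map_tconst] left_diff_distrib)
  finally have "loc (nform i j k e ?c) = 0"
    using loc_dvd[of "nform i j k e ?c" 0] by (simp add: loc_simps)
  moreover have "?c m = 0 \<or> m + degree (?c m) \<le> e" for m
    using a(1)[of m] degree_smult_le[of "1 - u ^ m" "a m"] by auto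
  ultimately have c0: "?c m = 0" if "m < 4" for m
    using nform_unique[of ?c e m] r that by blast
  have "u ^ 3 = - u"
    using u by (simp add: power3_eq_cube power2_eq_square)
  moreover have "u \<noteq> 1" "- u \<noteq> 1"
    using u by (auto simp: minus_equation_iff[of u])
  moreover from this have "1 + u \<noteq> 0"
    by (auto simp: add_eq_0_iff)
  ultimately have "a 1 = 0" "a 2 = 0" "a 3 = 0"
    using c0[of 1] c0[of 2] c0[of 3] u by auto
  then have "nform i j k e a = bform i k e (a 0)"
    by (simp add: nform_def eval_nat_numeral)
  then show ?thesis
    using a(2) a(1)[of 0] by (intro exI[of _ "a 0"]) auto
qed

text \<open>The rotation t permutes the points of the curve, so the norm of F has four times the
  \<open>vdeg\<close> of F. Being fixed by t, the norm is congruent to a form of degree 4 e in X and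
  Z, for which \<open>vdeg_bform\<close> gives 16 e.\<close>

theorem bezout:
  fixes F :: "'a::{field_char_0, alg_closed_field} ternary"
  assumes F: "homogeneous e F" "\<not> Q dvd F"
  shows "finite (zeros F)" "vdeg F = 4 * e"
proof -
  obtain r :: 'a where r: "r ^ 4 = -1"
    using fourth_root_exists by blast
  define u where "u = r\<^sup>2"
  have u: "u\<^sup>2 = -1"
    using r by (simp add: u_def flip: power_mult)
  have u4: "u ^ 4 = 1"
    using arg_cong[OF u, of "\<lambda>x. x\<^sup>2"] by (simp flip: power_mult)
  have dist: "distinct [1, 2, 3 :: 3]"
    by simp
  define D where "D = (\<lambda>n :: 3. if n = 2 then u else 1)"
  define t where "t = twist (\<lambda>c. c) D"
  interpret symmetry "\<lambda>c. c" D
    by unfold_locales (simp_all add: ring_map_id D_def u4 bij_def)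
  have t: "ring_map t"
    unfolding t_def by (intro ring_map_twist ring_map_id)
  have t4: "t (t (t (t F))) = F"
  proof -
    have "D n * (D n * (D n * D n)) = 1" for n
      using d[of n] by (simp add: power4_eq_xxxx mult.assoc)
    then show ?thesis
      by (simp add: t_def twist_twist ring_map_id twist_id mult.assoc)
  qed
  have step: "homogeneous e (t G) \<and> \<not> Q dvd t G \<and> vdeg (t G) = vdeg G \<and> zeros (t G) = twist_point (\<lambda>c. c) D ` zeros G"
    if "homogeneous e G" "\<not> Q dvd G" for G
    using homogeneous_twist[OF ring_map_s that(1)] that dvd_twist_iff vdeg_twist[OF that(1)] zeros_twist
    by (auto simp: t_def)
  note s1 = step[OF F]
  note s2 = step[of "t F"]
  note s3 = step[of "t (t F)"]
  let ?G = "t F * (t (t F) * t (t (t F)))"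
  have hG: "homogeneous (e + (e + e)) ?G"
    using s1 s2 s3 by (intro homogeneous_mult) auto
  have e4: "4 * e = e + (e + (e + e))"
    by simp
  have hN: "homogeneous (4 * e) (F * ?G)"
    unfolding e4 by (rule homogeneous_mult[OF F(1) hG])
  have "t (F * ?G) = F * ?G"
    by (simp add: ring_map_mult[OF t] t4 mult_ac)
  then obtain p where p: "degree p \<le> 4 * e" "Q dvd F * ?G - bform 1 3 (4 * e) p"
    using twist_fixed_imp_bform[OF dist u hN] unfolding t_def D_def by blast
  have nG': "\<not> Q dvd t (t F) * t (t (t F))"
    using fermat_prime[of e "t (t F)" e "t (t (t F))"] s1 s2 s3 by blast
  have "homogeneous (e + e) (t (t F) * t (t (t F)))"
    using s1 s2 s3 by (intro homogeneous_mult) auto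
  then have nG: "\<not> Q dvd ?G"
    using fermat_prime[of e "t F" "e + e" "t (t F) * t (t (t F))"] s1 nG' by blast
  then have nN: "\<not> Q dvd F * ?G"
    using fermat_prime[OF F(1) hG] F(2) by blast
  then have "p \<noteq> 0"
    using p(2) by auto
  from vdeg_bform[OF dist this p(1)] have b: "finite (zeros (F * ?G))" "vdeg (F * ?G) = 4 * (4 * e)"
    using vdeg_cong[OF hN homogeneous_bform p(2)] by auto
  then show fin: "finite (zeros F)"
    using zeros_mult[OF F(1) hG] by simp
  have "vdeg (F * ?G) = vdeg F + (vdeg (t F) + (vdeg (t (t F)) + vdeg (t (t (t F)))))"
  proof -
    have f: "finite (zeros (t F))" "finite (zeros (t (t F)))" "finite (zeros (t (t (t F))))"
      using fin s1 s2 s3 by auto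
    have h: "homogeneous e (t F)" "homogeneous e (t (t F))" "homogeneous e (t (t (t F)))"
      and n: "\<not> Q dvd t F" "\<not> Q dvd t (t F)" "\<not> Q dvd t (t (t F))"
      using s1 s2 s3 by blast+
    have h2: "homogeneous (e + e) (t (t F) * t (t (t F)))"
      by (rule homogeneous_mult[OF h(2,3)])
    have f2: "finite (zeros (t (t F) * t (t (t F))))"
      unfolding zeros_mult[OF h(2,3)] using f by blast
    have f3: "finite (zeros ?G)"
      unfolding zeros_mult[OF h(1) h2] using f(1) f2 by blast
    show ?thesis
      by (simp only: vdeg_mult[OF F hG nG fin f3] vdeg_mult[OF h(1) n(1) h2 nG' f(1) f2]
          vdeg_mult[OF h(2) n(2) h(3) n(3) f(2,3)])
  qed
  then show "vdeg F = 4 * e"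
    using b s1 s2 s3 by auto
qed


section \<open>The function field\<close>

lemma fractionsI:
  "homogeneous e F \<Longrightarrow> homogeneous e G \<Longrightarrow> \<not> C dvd G \<Longrightarrow> (F, G) \<in> fractions C"
  by (auto simp: fractions_def)

lemma fractionsE:
  assumes "(F, G) \<in> fractions C"
  obtains e where "homogeneous e F" "homogeneous e G" "\<not> C dvd G"
  using assms by (auto simp: fractions_def)

context
  fixes Q :: "'a::{field_char_0, alg_closed_field} ternary"
  defines "Q \<equiv> fermat_quartic"
begin

lemma fermat_not_dvd_1: "\<not> Q dvd 1"
  using vdeg_linear(3)[of 1 2 3 "0 :: 'a"] by (auto simp: Q_def intro: dvd_trans)

lemma fractions_one: "(1, 1) \<in> fractions Q"
  by (rule fractionsI[of 0]) (simp_all add: fermat_not_dvd_1)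

lemma fractions_mult:
  assumes "(F, G) \<in> fractions Q" "(F', G') \<in> fractions Q"
  shows "(F * F', G * G') \<in> fractions Q"
proof -
  obtain e e' where e: "homogeneous e F" "homogeneous e G" "\<not> Q dvd G"
    and e': "homogeneous e' F'" "homogeneous e' G'" "\<not> Q dvd G'"
    using assms by (metis fractionsE)
  show ?thesis
    using fermat_prime[OF e(2) e'(2)] e(3) e'(3) unfolding Q_def
    by (intro fractionsI[of "e + e'"] homogeneous_mult e e') blast
qed

text \<open>Equality of fractions is transitive because the common denominator G can be cancelled,
  which is primality of Q on forms.\<close>

lemma fractions_trans:
  assumes "(F, G) \<in> fractions Q" "(F', G') \<in> fractions Q" "(A, B) \<in> fractions Q"
    and 1: "Q dvd F * G' - F' * G" and 2: "Q dvd F * B - A * G"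
  shows "Q dvd F' * B - A * G'"
proof -
  obtain e e' e'' where e: "homogeneous e F" "homogeneous e G" "\<not> Q dvd G"
    and e': "homogeneous e' F'" "homogeneous e' G'" and e'': "homogeneous e'' A" "homogeneous e'' B"
    using assms(1-3) by (metis fractionsE)
  have "homogeneous (e' + e'') (F' * B)" "homogeneous (e' + e'') (A * G')"
    using homogeneous_mult[OF e'(1) e''(2)] homogeneous_mult[OF e''(1) e'(2)] by (simp_all add: add.commute)
  then have h: "homogeneous (e' + e'') (F' * B - A * G')"
    by (rule homogeneous_diff)
  have "Q dvd G' * (F * B - A * G) - B * (F * G' - F' * G)"
    by (rule dvd_diff[OF dvd_mult[OF 2] dvd_mult[OF 1]])
  also have "G' * (F * B - A * G) - B * (F * G' - F' * G) = G * (F' * B - A * G')"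
    by (simp add: algebra_simps)
  finally show ?thesis
    using fermat_prime[OF e(2) h] e(3) unfolding Q_def by blast
qed

lemma dvd_cross_sym: "Q dvd F * G' - F' * G \<Longrightarrow> Q dvd F' * G - F * G'"
  by (metis dvd_minus_iff minus_diff_eq)

lemma ratfun_eq_iff:
  assumes "(F, G) \<in> fractions Q" "(F', G') \<in> fractions Q"
  shows "ratfun Q F G = ratfun Q F' G' \<longleftrightarrow> Q dvd F * G' - F' * G"
proof
  assume "ratfun Q F G = ratfun Q F' G'"
  moreover have "(F', G') \<in> ratfun Q F' G'"
    using assms(2) by (simp add: ratfun_def)
  ultimately show "Q dvd F * G' - F' * G"
    by (auto simp: ratfun_def)
next
  assume "Q dvd F * G' - F' * G"
  then show "ratfun Q F G = ratfun Q F' G'"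
    using fractions_trans[OF assms] fractions_trans[OF assms(2,1)] dvd_cross_sym
    unfolding ratfun_def by blast
qed

lemma mem_ratfun_iff:
  assumes "(F, G) \<in> fractions Q"
  shows "(A, B) \<in> ratfun Q F G \<longleftrightarrow> (A, B) \<in> fractions Q \<and> ratfun Q A B = ratfun Q F G"
  using ratfun_eq_iff[OF assms, of A B] by (auto simp: ratfun_def)

lemma ratfun_self: "(F, G) \<in> fractions Q \<Longrightarrow> (F, G) \<in> ratfun Q F G"
  by (simp add: mem_ratfun_iff)

lemma ratfun_mult_cong:
  assumes "(F, G) \<in> fractions Q" "(F', G') \<in> fractions Q" "(A, B) \<in> fractions Q" "(A', B') \<in> fractions Q"
    and "ratfun Q A B = ratfun Q F G" "ratfun Q A' B' = ratfun Q F' G'"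
  shows "ratfun Q (A * A') (B * B') = ratfun Q (F * F') (G * G')"
proof -
  have 1: "Q dvd A * G - F * B" and 2: "Q dvd A' * G' - F' * B'"
    using assms by (simp_all add: ratfun_eq_iff)
  have "Q dvd A' * G' * (A * G - F * B) + F * B * (A' * G' - F' * B')"
    using 1 2 by (intro dvd_add dvd_mult)
  also have "A' * G' * (A * G - F * B) + F * B * (A' * G' - F' * B') = A * A' * (G * G') - F * F' * (B * B')"
    by (simp add: algebra_simps)
  finally show ?thesis
    using assms by (simp add: ratfun_eq_iff fractions_mult)
qed

lemma function_field_carrier: "carrier (function_field Q) = {ratfun Q F G | F G. (F, G) \<in> fractions Q}"
  by (simp add: function_field_def)

lemma ratfun_in_carrier: "(F, G) \<in> fractions Q \<Longrightarrow> ratfun Q F G \<in> carrier (function_field Q)"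
  by (auto simp: function_field_carrier)

lemma function_field_one: "\<one>\<^bsub>function_field Q\<^esub> = ratfun Q 1 1"
  by (simp add: function_field_def)

text \<open>The unions in the definition of the product run over all representatives of the two
  factors; each pair yields the same class, so the union is that class.\<close>

lemma function_field_mult:
  assumes "(F, G) \<in> fractions Q" "(F', G') \<in> fractions Q"
  shows "ratfun Q F G \<otimes>\<^bsub>function_field Q\<^esub> ratfun Q F' G' = ratfun Q (F * F') (G * G')"
proof -
  let ?R = "ratfun Q (F * F') (G * G')"
  have *: "ratfun Q (A * A') (B * B') = ?R" if "(A, B) \<in> ratfun Q F G" "(A', B') \<in> ratfun Q F' G'" for A B A' B'
    using that unfolding mem_ratfun_iff[OF assms(1)] mem_ratfun_iff[OF assms(2)]
    by (intro ratfun_mult_cong assms) auto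
  have "(\<Union>(A, B)\<in>ratfun Q F G. \<Union>(A', B')\<in>ratfun Q F' G'. ratfun Q (A * A') (B * B')) = ?R"
  proof (intro equalityI subsetI)
    fix x assume "x \<in> (\<Union>(A, B)\<in>ratfun Q F G. \<Union>(A', B')\<in>ratfun Q F' G'. ratfun Q (A * A') (B * B'))"
    then show "x \<in> ?R"
      using * by blast
  next
    fix x assume "x \<in> ?R"
    then show "x \<in> (\<Union>(A, B)\<in>ratfun Q F G. \<Union>(A', B')\<in>ratfun Q F' G'. ratfun Q (A * A') (B * B'))"
      using ratfun_self[OF assms(1)] ratfun_self[OF assms(2)] by blast
  qed
  then show ?thesis
    by (simp add: function_field_def)
qed

text \<open>Gives uniqueness of inverses, on which the negative powers in \<open>ord_at\<close>
  rest.\<close>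

lemma comm_monoid_function_field: "comm_monoid (function_field Q)"
proof (rule comm_monoidI)
  fix f g h
  assume "f \<in> carrier (function_field Q)" "g \<in> carrier (function_field Q)" "h \<in> carrier (function_field Q)"
  then obtain F G F' G' F'' G'' where
    "f = ratfun Q F G" "(F, G) \<in> fractions Q" "g = ratfun Q F' G'" "(F', G') \<in> fractions Q"
    "h = ratfun Q F'' G''" "(F'', G'') \<in> fractions Q"
    by (auto simp: function_field_carrier)
  then show "f \<otimes>\<^bsub>function_field Q\<^esub> g \<otimes>\<^bsub>function_field Q\<^esub> h = f \<otimes>\<^bsub>function_field Q\<^esub> (g \<otimes>\<^bsub>function_field Q\<^esub> h)"
    by (simp add: function_field_mult fractions_mult mult.assoc)
next
  fix f g assume "f \<in> carrier (function_field Q)" "g \<in> carrier (function_field Q)"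
  then obtain F G F' G' where
    fg: "f = ratfun Q F G" "(F, G) \<in> fractions Q" "g = ratfun Q F' G'" "(F', G') \<in> fractions Q"
    by (auto simp: function_field_carrier)
  then show "f \<otimes>\<^bsub>function_field Q\<^esub> g \<in> carrier (function_field Q)"
    by (simp add: function_field_mult fractions_mult ratfun_in_carrier)
  show "f \<otimes>\<^bsub>function_field Q\<^esub> g = g \<otimes>\<^bsub>function_field Q\<^esub> f"
    using fg by (simp add: function_field_mult mult.commute)
next
  show "\<one>\<^bsub>function_field Q\<^esub> \<in> carrier (function_field Q)"
    by (simp add: function_field_one fractions_one ratfun_in_carrier)
  fix f assume "f \<in> carrier (function_field Q)"
  then obtain F G where "f = ratfun Q F G" "(F, G) \<in> fractions Q"
    by (auto simp: function_field_carrier)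
  then show "\<one>\<^bsub>function_field Q\<^esub> \<otimes>\<^bsub>function_field Q\<^esub> f = f"
    by (simp add: function_field_one function_field_mult fractions_one)
qed

lemma fractions_swap: "(F, G) \<in> fractions Q \<Longrightarrow> \<not> Q dvd F \<Longrightarrow> (G, F) \<in> fractions Q"
  by (auto simp: fractions_def)

lemma ratfun_eq_one: "(F, F) \<in> fractions Q \<Longrightarrow> ratfun Q F F = ratfun Q 1 1"
  by (simp add: ratfun_eq_iff fractions_one)

lemma function_field_inv:
  assumes "(F, G) \<in> fractions Q" "\<not> Q dvd F"
  shows "inv\<^bsub>function_field Q\<^esub> (ratfun Q F G) = ratfun Q G F"
proof -
  interpret comm_monoid "function_field Q"
    by (rule comm_monoid_function_field)
  have GF: "(G, F) \<in> fractions Q"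
    using assms by (rule fractions_swap)
  have "ratfun Q (F * G) (G * F) = ratfun Q 1 1"
    using fractions_mult[OF assms(1) GF] by (simp add: mult.commute[of G] ratfun_eq_one)
  then show ?thesis
    using assms GF by (intro comm_inv_char) (simp_all add: ratfun_in_carrier function_field_mult function_field_one)
qed

lemma fractions_power: "(F, G) \<in> fractions Q \<Longrightarrow> (F ^ n, G ^ n) \<in> fractions Q"
  by (induction n) (simp_all add: fractions_one fractions_mult)

lemma function_field_nat_pow:
  assumes "(F, G) \<in> fractions Q"
  shows "ratfun Q F G [^]\<^bsub>function_field Q\<^esub> (n :: nat) = ratfun Q (F ^ n) (G ^ n)"
proof (induction n)
  case 0
  show ?case
    by (simp add: function_field_one)
next
  case (Suc n)
  then show ?case
    by (simp add: function_field_mult assms fractions_power mult.commute)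
qed

lemma fermat_not_dvd_power:
  assumes "homogeneous e F" "\<not> Q dvd F"
  shows "\<not> Q dvd F ^ n"
proof -
  have "(F, F) \<in> fractions Q"
    using assms by (intro fractionsI)
  from fractions_power[OF this, of n] show ?thesis
    by (auto elim: fractionsE)
qed

lemma function_field_int_pow:
  assumes "(F, G) \<in> fractions Q" "\<not> Q dvd F"
  shows "ratfun Q F G [^]\<^bsub>function_field Q\<^esub> (int n) = ratfun Q (F ^ n) (G ^ n)"
    and "ratfun Q F G [^]\<^bsub>function_field Q\<^esub> (- int n) = ratfun Q (G ^ n) (F ^ n)"
proof -
  show 1: "ratfun Q F G [^]\<^bsub>function_field Q\<^esub> (int n) = ratfun Q (F ^ n) (G ^ n)"
    using function_field_nat_pow[OF assms(1)] by (simp add: int_pow_int)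
  have "\<not> Q dvd F ^ n"
    using assms fermat_not_dvd_power by (metis fractionsE)
  then have "inv\<^bsub>function_field Q\<^esub> (ratfun Q (F ^ n) (G ^ n)) = ratfun Q (G ^ n) (F ^ n)"
    by (intro function_field_inv fractions_power assms)
  then show "ratfun Q F G [^]\<^bsub>function_field Q\<^esub> (- int n) = ratfun Q (G ^ n) (F ^ n)"
    using function_field_nat_pow[OF assms(1), of n] by (cases "n = 0") (simp_all add: int_pow_def2)
qed

section \<open>Orders of fractions and their agreement with \<open>ord_at\<close>\<close>

definition fval :: "('a ^ 3) set \<Rightarrow> 'a ternary \<Rightarrow> 'a ternary \<Rightarrow> int" where
  "fval P F G = int (val P F) - int (val P G)"

lemma fval_mult:
  assumes "P \<in> curve_points Q" "(F, G) \<in> fractions Q" "(F', G') \<in> fractions Q" "\<not> Q dvd F" "\<not> Q dvd F'"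
  shows "fval P (F * F') (G * G') = fval P F G + fval P F' G'"
proof -
  obtain e e' where e: "homogeneous e F" "homogeneous e G" "\<not> Q dvd G"
    and e': "homogeneous e' F'" "homogeneous e' G'" "\<not> Q dvd G'"
    using assms(2,3) by (metis fractionsE)
  show ?thesis
    using assms e e' unfolding Q_def by (simp add: fval_def val_mult)
qed

lemma fval_power:
  assumes "P \<in> curve_points Q" "(F, G) \<in> fractions Q" "\<not> Q dvd F"
  shows "fval P (F ^ n) (G ^ n) = int n * fval P F G"
proof -
  obtain e where e: "homogeneous e F" "homogeneous e G" "\<not> Q dvd G"
    using assms(2) by (metis fractionsE)
  show ?thesis
    using assms e unfolding Q_def by (simp add: fval_def val_power right_diff_distrib)
qed

lemma ratfun_eq_dvd:
  assumes "(F, G) \<in> fractions Q" "(F', G') \<in> fractions Q" "ratfun Q F G = ratfun Q F' G'" "Q dvd F"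
  shows "Q dvd F'"
proof -
  obtain e e' where e: "homogeneous e F" "homogeneous e G" "\<not> Q dvd G"
    and e': "homogeneous e' F'" "homogeneous e' G'" "\<not> Q dvd G'"
    using assms(1,2) by (metis fractionsE)
  have "Q dvd F * G' - F' * G"
    using assms by (simp add: ratfun_eq_iff)
  then have "Q dvd F * G' - (F * G' - F' * G)"
    by (rule dvd_diff[OF dvd_mult2[OF assms(4)]])
  then have "Q dvd F' * G"
    by simp
  then show ?thesis
    using fermat_prime[OF e'(1) e(2)] e(3) unfolding Q_def by blast
qed

lemma fval_cong:
  assumes P: "P \<in> curve_points Q" and FG: "(F, G) \<in> fractions Q" "(F', G') \<in> fractions Q"
    and eq: "ratfun Q F G = ratfun Q F' G'" and F: "\<not> Q dvd F"
  shows "\<not> Q dvd F'" "fval P F G = fval P F' G'"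
proof -
  show F': "\<not> Q dvd F'"
    using ratfun_eq_dvd[OF FG(2,1) eq[symmetric]] F by blast
  obtain e e' where e: "homogeneous e F" "homogeneous e G" "\<not> Q dvd G"
    and e': "homogeneous e' F'" "homogeneous e' G'" "\<not> Q dvd G'"
    using FG by (metis fractionsE)
  have h: "homogeneous (e + e') (F * G')" "homogeneous (e + e') (F' * G)"
    using homogeneous_mult[OF e(1) e'(2)] homogeneous_mult[OF e'(1) e(2)] by (simp_all add: add.commute)
  have "Q dvd F * G' - F' * G"
    using assms by (simp add: ratfun_eq_iff)
  then have "val P (F * G') = val P (F' * G)"
    using val_cong[OF _ h] P unfolding Q_def by blast
  then have "val P F + val P G' = val P F' + val P G"
    using val_mult[OF _ e(1) e'(2)] val_mult[OF _ e'(1) e(2)] P F F' e(3) e'(3) unfolding Q_def by simp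
  then show "fval P F G = fval P F' G'"
    by (simp add: fval_def)
qed

lemma local_ring_simps:
  "\<one>\<^bsub>local_ring Q P\<^esub> = ratfun Q 1 1"
  "f \<otimes>\<^bsub>local_ring Q P\<^esub> g = f \<otimes>\<^bsub>function_field Q\<^esub> g"
  by (simp_all add: local_ring_def function_field_def)

lemma local_ring_carrier_iff:
  "f \<in> carrier (local_ring Q P) \<longleftrightarrow> (\<exists>F G. (F, G) \<in> fractions Q \<and> f = ratfun Q F G \<and> \<not> vanishes_at G P)"
proof
  assume "f \<in> carrier (local_ring Q P)"
  then obtain F G A B where "f = ratfun Q F G" "(F, G) \<in> fractions Q" "(A, B) \<in> f" "\<not> vanishes_at B P"
    by (auto simp: local_ring_def function_field_carrier)
  then show "\<exists>F G. (F, G) \<in> fractions Q \<and> f = ratfun Q F G \<and> \<not> vanishes_at G P"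
    by (intro exI[of _ A] exI[of _ B]) (simp add: mem_ratfun_iff)
next
  assume "\<exists>F G. (F, G) \<in> fractions Q \<and> f = ratfun Q F G \<and> \<not> vanishes_at G P"
  then show "f \<in> carrier (local_ring Q P)"
    using ratfun_self by (auto simp: local_ring_def function_field_carrier)
qed

lemma local_maximal_ideal_iff:
  "f \<in> local_maximal_ideal Q P \<longleftrightarrow>
    (\<exists>F G. (F, G) \<in> fractions Q \<and> f = ratfun Q F G \<and> \<not> vanishes_at G P \<and> vanishes_at F P)"
proof
  assume "f \<in> local_maximal_ideal Q P"
  then obtain F G A B where "f = ratfun Q F G" "(F, G) \<in> fractions Q" "(A, B) \<in> f"
    "\<not> vanishes_at B P" "vanishes_at A P"
    by (auto simp: local_maximal_ideal_def function_field_carrier)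
  then show "\<exists>F G. (F, G) \<in> fractions Q \<and> f = ratfun Q F G \<and> \<not> vanishes_at G P \<and> vanishes_at F P"
    by (intro exI[of _ A] exI[of _ B]) (simp add: mem_ratfun_iff)
next
  assume "\<exists>F G. (F, G) \<in> fractions Q \<and> f = ratfun Q F G \<and> \<not> vanishes_at G P \<and> vanishes_at F P"
  then show "f \<in> local_maximal_ideal Q P"
    using ratfun_self by (auto simp: local_maximal_ideal_def function_field_carrier)
qed

definition is_uniformizer :: "('a ^ 3) set \<Rightarrow> ('a ternary \<times> 'a ternary) set \<Rightarrow> bool" where
  "is_uniformizer P t \<longleftrightarrow> t \<in> carrier (local_ring Q P) \<and> PIdl\<^bsub>local_ring Q P\<^esub> t = local_maximal_ideal Q P"

lemma mem_PIdl_iff: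
  "f \<in> PIdl\<^bsub>local_ring Q P\<^esub> t \<longleftrightarrow> (\<exists>x\<in>carrier (local_ring Q P). f = x \<otimes>\<^bsub>function_field Q\<^esub> t)"
  by (auto simp: cgenideal_def local_ring_simps)

context
  fixes P :: "('a ^ 3) set"
  assumes P: "P \<in> curve_points Q"
begin

lemma val_eq_0_iff': "homogeneous e F \<Longrightarrow> \<not> Q dvd F \<Longrightarrow> val P F = 0 \<longleftrightarrow> \<not> vanishes_at F P"
  using val_eq_0_iff[of P e F] P by (simp add: Q_def)

lemma nonvanishing_not_dvd': "homogeneous e F \<Longrightarrow> \<not> vanishes_at F P \<Longrightarrow> \<not> Q dvd F"
  using nonvanishing_not_dvd[of P e F] P by (simp add: Q_def)

lemma vanishes_at_mult': "homogeneous e F \<Longrightarrow> homogeneous e' G \<Longrightarrow>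
    vanishes_at (F * G) P \<longleftrightarrow> vanishes_at F P \<or> vanishes_at G P"
  using vanishes_at_mult[of P e F e' G] P by (simp add: Q_def)

lemma vanishes_at_power: "homogeneous e F \<Longrightarrow> \<not> vanishes_at F P \<Longrightarrow> \<not> vanishes_at (F ^ n) P"
proof (induction n)
  case 0
  have "vanishes_at 1 P \<longleftrightarrow> False"
    using P by (auto simp: curve_points_eq Q_def vanishes_at_proj_pt[OF homogeneous_one] teval_simps)
  then show ?case
    by simp
next
  case (Suc n)
  then show ?case
    using vanishes_at_mult'[OF Suc.prems(1) homogeneous_power[OF Suc.prems(1), of n]] by simp
qed

text \<open>Every generator t of the maximal ideal has order 1. It is at most 1 since T / L, of
  order 1, is a multiple of t by an element of the local ring, and at least 1 since t itself lies in
  the maximal ideal.\<close>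

lemma fval_uniformizer:
  assumes t: "is_uniformizer P t" and AB: "(A, B) \<in> fractions Q" "t = ratfun Q A B"
  shows "\<not> Q dvd A \<and> fval P A B = 1"
proof -
  obtain T L H where TL: "homogeneous 1 T" "homogeneous 1 L" "\<not> vanishes_at L P" "\<not> Q dvd T" "val P T = 1"
    using val_expansion P unfolding Q_def by metis
  have L: "\<not> Q dvd L" "val P L = 0"
    using nonvanishing_not_dvd'[OF TL(2,3)] val_eq_0_iff'[OF TL(2)] TL(3) by auto
  have TLf: "(T, L) \<in> fractions Q"
    using TL L by (intro fractionsI)
  have "vanishes_at T P"
    using val_eq_0_iff'[OF TL(1,4)] TL(5) by simp
  then have "ratfun Q T L \<in> PIdl\<^bsub>local_ring Q P\<^esub> t"
    using t TLf TL(3) unfolding is_uniformizer_def by (auto simp: local_maximal_ideal_iff)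
  then obtain C D where CD: "(C, D) \<in> fractions Q" "\<not> vanishes_at D P"
    and eq: "ratfun Q T L = ratfun Q (C * A) (D * B)"
    using AB by (auto simp: mem_PIdl_iff local_ring_carrier_iff function_field_mult)
  obtain e where e: "homogeneous e C" "homogeneous e D" "\<not> Q dvd D"
    using CD(1) by (metis fractionsE)
  have D: "val P D = 0"
    using val_eq_0_iff'[OF e(2,3)] CD(2) by simp
  have CA: "\<not> Q dvd C * A" "fval P T L = fval P (C * A) (D * B)"
    using fval_cong[OF P TLf fractions_mult[OF CD(1) AB(1)] eq TL(4)] by auto
  then have nz: "\<not> Q dvd C" "\<not> Q dvd A"
    by auto
  have sum: "1 = int (val P C) + fval P A B"
    using CA(2) fval_mult[OF P CD(1) AB(1) nz] D L(2) TL(5) by (simp add: fval_def)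
  have "t \<in> PIdl\<^bsub>local_ring Q P\<^esub> t"
  proof -
    have "\<not> vanishes_at 1 P"
      using vanishes_at_power[of 1 L 0] TL by simp
    then have "ratfun Q 1 1 \<in> carrier (local_ring Q P)"
      unfolding local_ring_carrier_iff using fractions_one by blast
    moreover have "t = ratfun Q 1 1 \<otimes>\<^bsub>function_field Q\<^esub> t"
      using AB fractions_one by (simp add: function_field_mult)
    ultimately show ?thesis
      unfolding mem_PIdl_iff by blast
  qed
  then have "t \<in> local_maximal_ideal Q P"
    using t unfolding is_uniformizer_def by simp
  then obtain A' B' where AB': "(A', B') \<in> fractions Q" "t = ratfun Q A' B'" "\<not> vanishes_at B' P" "vanishes_at A' P"
    by (auto simp: local_maximal_ideal_iff)
  obtain e' where e': "homogeneous e' A'" "homogeneous e' B'" "\<not> Q dvd B'"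
    using AB'(1) by (metis fractionsE)
  have A': "\<not> Q dvd A'" "fval P A B = fval P A' B'"
    using fval_cong[OF P AB(1) AB'(1) _ nz(2)] AB(2) AB'(2) by auto
  have "fval P A' B' \<ge> 1"
    using val_eq_0_iff'[OF e'(1) A'(1)] val_eq_0_iff'[OF e'(2,3)] AB'(3,4) by (simp add: fval_def)
  then show ?thesis
    using sum A' nz by auto
qed

text \<open>Elements of the local ring have nonnegative order, and the orders of a unit and of its
  inverse add up to 0.\<close>

lemma fval_unit:
  assumes u: "u \<in> Units (local_ring Q P)" and CD: "(C, D) \<in> fractions Q" "u = ratfun Q C D"
  shows "\<not> Q dvd C \<and> fval P C D = 0"
proof -
  have nonneg: "fval P A B \<ge> 0"
    if AB: "ratfun Q A B \<in> carrier (local_ring Q P)" "(A, B) \<in> fractions Q" "\<not> Q dvd A" for A B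
  proof -
    obtain A' B' where AB': "(A', B') \<in> fractions Q" "ratfun Q A B = ratfun Q A' B'" "\<not> vanishes_at B' P"
      using AB(1) unfolding local_ring_carrier_iff by blast
    obtain e' where e': "homogeneous e' A'" "homogeneous e' B'" "\<not> Q dvd B'"
      using AB'(1) by (metis fractionsE)
    show ?thesis
      using fval_cong[OF P AB(2) AB'(1,2) AB(3)] val_eq_0_iff'[OF e'(2,3)] AB'(3) by (simp add: fval_def)
  qed
  from u obtain v where v: "u \<in> carrier (local_ring Q P)" "v \<in> carrier (local_ring Q P)"
    "v \<otimes>\<^bsub>local_ring Q P\<^esub> u = \<one>\<^bsub>local_ring Q P\<^esub>"
    by (auto simp: Units_def)
  then obtain A B where AB: "(A, B) \<in> fractions Q" "v = ratfun Q A B"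
    by (auto simp: local_ring_carrier_iff)
  have eq: "ratfun Q 1 1 = ratfun Q (A * C) (B * D)"
    using v(3) AB CD by (simp add: local_ring_simps function_field_mult)
  have AC: "\<not> Q dvd A * C" "fval P 1 1 = fval P (A * C) (B * D)"
    using fval_cong[OF P fractions_one fractions_mult[OF AB(1) CD(1)] eq fermat_not_dvd_1] by auto
  then have nz: "\<not> Q dvd A" "\<not> Q dvd C"
    by auto
  have "0 = fval P A B + fval P C D"
    using AC(2) fval_mult[OF P AB(1) CD(1) nz] by (simp add: fval_def)
  then show ?thesis
    using nonneg[of A B] nonneg[of C D] v AB CD nz by auto
qed

text \<open>Orders are additive, so comparing the orders of both sides gives n, whichever
  uniformizer and unit are used. Negative powers are powers of the inverted fraction.\<close>

lemma ord_at_unique: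
  assumes FG: "(F, G) \<in> fractions Q" "\<not> Q dvd F"
    and t: "is_uniformizer P t" and u: "u \<in> Units (local_ring Q P)"
    and eq: "ratfun Q F G = u \<otimes>\<^bsub>function_field Q\<^esub> (t [^]\<^bsub>function_field Q\<^esub> (n :: int))"
  shows "n = fval P F G"
proof -
  obtain A B where AB: "(A, B) \<in> fractions Q" "t = ratfun Q A B"
    using t by (auto simp: is_uniformizer_def local_ring_carrier_iff)
  obtain C D where CD: "(C, D) \<in> fractions Q" "u = ratfun Q C D"
    using u by (auto simp: Units_def local_ring_carrier_iff)
  note t1 = fval_uniformizer[OF t AB]
  note u0 = fval_unit[OF u CD]
  have BA: "(B, A) \<in> fractions Q"
    using AB(1) t1 fractions_swap by blast
  obtain e where e: "homogeneous e A" "homogeneous e B" "\<not> Q dvd B"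
    using AB(1) by (metis fractionsE)
  have main: "n = fval P F G"
    if pow: "t [^]\<^bsub>function_field Q\<^esub> n = ratfun Q X1 X2" "(X1, X2) \<in> fractions Q" "\<not> Q dvd X1" "fval P X1 X2 = n" for X1 X2
  proof -
    have "ratfun Q F G = ratfun Q (C * X1) (D * X2)"
      using eq CD pow(1,2) by (simp add: function_field_mult)
    from fval_cong(2)[OF P FG(1) fractions_mult[OF CD(1) pow(2)] this FG(2)]
    show ?thesis
      using fval_mult[OF P CD(1) pow(2)] u0 pow(3,4) by simp
  qed
  show ?thesis
  proof (cases "n \<ge> 0")
    case True
    then obtain m where m: "n = int m"
      using nonneg_int_cases by blast
    show ?thesis
    proof (rule main)
      show "t [^]\<^bsub>function_field Q\<^esub> n = ratfun Q (A ^ m) (B ^ m)"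
        unfolding m AB(2) using t1 by (intro function_field_int_pow AB) simp
      show "fval P (A ^ m) (B ^ m) = n"
        using fval_power[OF P AB(1)] t1 by (simp add: m)
    qed (use AB(1) e(1) t1 in \<open>auto simp: fractions_power fermat_not_dvd_power\<close>)
  next
    case False
    then obtain m where m: "n = - int m"
      by (metis int_cases2 of_nat_0_le_iff)
    show ?thesis
    proof (rule main)
      show "t [^]\<^bsub>function_field Q\<^esub> n = ratfun Q (B ^ m) (A ^ m)"
        unfolding m AB(2) using t1 by (intro function_field_int_pow AB) simp
      have "fval P B A = -1"
        using t1 by (simp add: fval_def)
      then show "fval P (B ^ m) (A ^ m) = n"
        using fval_power[OF P BA e(3)] by (simp add: m)
    qed (use BA e in \<open>auto simp: fractions_power fermat_not_dvd_power\<close>)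
  qed
qed

lemma unitI:
  assumes "homogeneous e C" "homogeneous e D" "\<not> vanishes_at C P" "\<not> vanishes_at D P"
  shows "ratfun Q C D \<in> Units (local_ring Q P)"
proof -
  have nd: "\<not> Q dvd C" "\<not> Q dvd D"
    using assms nonvanishing_not_dvd' by blast+
  have CD: "(C, D) \<in> fractions Q" "(D, C) \<in> fractions Q"
    using assms nd by (auto intro: fractionsI)
  moreover from fractions_mult[OF this] have "(C * D, C * D) \<in> fractions Q"
    by (simp add: mult.commute)
  ultimately have CD: "(C, D) \<in> fractions Q" "(D, C) \<in> fractions Q" "(C * D, C * D) \<in> fractions Q"
    by auto
  have "ratfun Q (C * D) (C * D) = ratfun Q 1 1"
    using CD(3) by (rule ratfun_eq_one)
  then have "ratfun Q C D \<otimes>\<^bsub>function_field Q\<^esub> ratfun Q D C = ratfun Q 1 1"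
    "ratfun Q D C \<otimes>\<^bsub>function_field Q\<^esub> ratfun Q C D = ratfun Q 1 1"
    using function_field_mult[OF CD(1,2)] function_field_mult[OF CD(2,1)] by (simp_all only: mult.commute[of D C])
  moreover have "ratfun Q C D \<in> carrier (local_ring Q P)" "ratfun Q D C \<in> carrier (local_ring Q P)"
    unfolding local_ring_carrier_iff using CD assms by blast+
  ultimately show ?thesis
    unfolding Units_def local_ring_simps by blast
qed

text \<open>With t = T / L, F = T^a U / H^a and G = T^b V / H^b, the quotient F / G is t^(a - b)
  times U H^b L^a / (V H^a L^b), whose numerator and denominator do not vanish at P.\<close>

lemma ord_at_exists:
  assumes FG: "(F, G) \<in> fractions Q" "\<not> Q dvd F"
  shows "\<exists>t u. is_uniformizer P t \<and> u \<in> Units (local_ring Q P) \<and>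
    ratfun Q F G = u \<otimes>\<^bsub>function_field Q\<^esub> (t [^]\<^bsub>function_field Q\<^esub> fval P F G)"
proof -
  obtain T L H where TLH: "homogeneous 1 T" "homogeneous 1 L" "homogeneous 3 H"
    "\<not> vanishes_at L P" "\<not> vanishes_at H P" "\<not> Q dvd T" "val P T = 1"
    and expansion: "\<And>e F. homogeneous e F \<Longrightarrow> \<not> Q dvd F \<Longrightarrow>
      \<exists>U. homogeneous (2 * val P F + e) U \<and> \<not> vanishes_at U P \<and> Q dvd H ^ val P F * F - T ^ val P F * U"
    using val_expansion P unfolding Q_def by metis
  have L: "\<not> Q dvd L"
    using nonvanishing_not_dvd'[OF TLH(2,4)] .
  have "vanishes_at T P"
    using val_eq_0_iff'[OF TLH(1,6)] TLH(7) by simp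
  have TL: "(T, L) \<in> fractions Q"
    using TLH L by (intro fractionsI)
  define t where "t = ratfun Q T L"
  have t: "is_uniformizer P t"
    unfolding is_uniformizer_def
  proof (intro conjI equalityI subsetI)
    show "t \<in> carrier (local_ring Q P)"
      unfolding local_ring_carrier_iff t_def using TL TLH(4) by blast
  next
    fix f assume "f \<in> PIdl\<^bsub>local_ring Q P\<^esub> t"
    then obtain A B where AB: "(A, B) \<in> fractions Q" "\<not> vanishes_at B P" "f = ratfun Q (A * T) (B * L)"
      using TL by (auto simp: mem_PIdl_iff local_ring_carrier_iff function_field_mult t_def)
    obtain e where e: "homogeneous e A" "homogeneous e B"
      using AB(1) by (metis fractionsE)
    show "f \<in> local_maximal_ideal Q P"
      unfolding local_maximal_ideal_iff
      using AB fractions_mult[OF AB(1) TL] vanishes_at_mult'[OF e(1) TLH(1)] vanishes_at_mult'[OF e(2) TLH(2)]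
        TLH(4) \<open>vanishes_at T P\<close> by blast
  next
    fix f assume "f \<in> local_maximal_ideal Q P"
    then obtain A B where AB: "(A, B) \<in> fractions Q" "f = ratfun Q A B" "\<not> vanishes_at B P" "vanishes_at A P"
      by (auto simp: local_maximal_ideal_iff)
    obtain e where e: "homogeneous e A" "homogeneous e B" "\<not> Q dvd B"
      using AB(1) by (metis fractionsE)
    show "f \<in> PIdl\<^bsub>local_ring Q P\<^esub> t"
    proof (cases "Q dvd A")
      case True
      \<comment> \<open>Here f is the zero function, so f = f t.\<close>
      have "ratfun Q A B \<in> carrier (local_ring Q P)"
        unfolding local_ring_carrier_iff using AB by blast
      moreover have "Q dvd A * (B * L) - A * T * B"
        using True by (intro dvd_diff) auto
      then have "f = ratfun Q A B \<otimes>\<^bsub>function_field Q\<^esub> t"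
        unfolding AB(2) t_def using AB(1) TL by (simp add: function_field_mult ratfun_eq_iff fractions_mult)
      ultimately show ?thesis
        unfolding mem_PIdl_iff by blast
    next
      case False
      define a where "a = val P A"
      obtain U where U: "homogeneous (2 * a + e) U" "Q dvd H ^ a * A - T ^ a * U"
        using expansion[OF e(1) False] unfolding a_def by blast
      have "a > 0"
        using val_eq_0_iff'[OF e(1) False] AB(4) by (simp add: a_def)
      then obtain m where m: "a = Suc m"
        using gr0_implies_Suc by blast
      \<comment> \<open>The quotient f / t, where A = T^a U / H^a and one of the a factors T has
        been removed.\<close>
      let ?N = "U * T ^ m * L" and ?D = "H ^ a * B"
      have deg: "3 * a + e = 2 * a + e + 1 * m + 1"
        by (simp add: m)
      have hN: "homogeneous (3 * a + e) ?N"
        unfolding deg by (rule homogeneous_mult[OF homogeneous_mult[OF U(1) homogeneous_power[OF TLH(1)]] TLH(2)])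
      have hH: "homogeneous (3 * a) (H ^ a)"
        by (rule homogeneous_power[OF TLH(3)])
      have D: "\<not> vanishes_at ?D P" "homogeneous (3 * a + e) ?D"
        using vanishes_at_mult'[OF hH e(2)] vanishes_at_power[OF TLH(3,5)] AB(3) homogeneous_mult[OF hH e(2)] by auto
      have ND: "(?N, ?D) \<in> fractions Q"
        using hN D nonvanishing_not_dvd' by (intro fractionsI) auto
      then have "ratfun Q ?N ?D \<in> carrier (local_ring Q P)"
        unfolding local_ring_carrier_iff using D by blast
      moreover have "A * (?D * L) - ?N * T * B = (H ^ a * A - T ^ a * U) * (B * L)"
        by (simp add: m algebra_simps)
      then have "Q dvd A * (?D * L) - ?N * T * B"
        using U(2) by simp
      then have "f = ratfun Q ?N ?D \<otimes>\<^bsub>function_field Q\<^esub> t"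
        unfolding AB(2) t_def using AB(1) TL ND by (simp add: function_field_mult ratfun_eq_iff fractions_mult)
      ultimately show ?thesis
        unfolding mem_PIdl_iff by blast
    qed
  qed
  obtain e where e: "homogeneous e F" "homogeneous e G" "\<not> Q dvd G"
    using FG(1) by (metis fractionsE)
  define a b where "a = val P F" and "b = val P G"
  obtain U where U: "homogeneous (2 * a + e) U" "\<not> vanishes_at U P" "Q dvd H ^ a * F - T ^ a * U"
    using expansion[OF e(1) FG(2)] unfolding a_def by blast
  obtain V where V: "homogeneous (2 * b + e) V" "\<not> vanishes_at V P" "Q dvd H ^ b * G - T ^ b * V"
    using expansion[OF e(2,3)] unfolding b_def by blast
  let ?C = "U * H ^ b * L ^ a" and ?D = "V * H ^ a * L ^ b"
  have deg: "homogeneous (c + 3 * m + n) (W * H ^ m * L ^ n)" if "homogeneous c W" for W c m n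
    using homogeneous_mult[OF homogeneous_mult[OF that homogeneous_power[OF TLH(3), of m]] homogeneous_power[OF TLH(2), of n]]
    by simp
  have van: "\<not> vanishes_at (W * H ^ m * L ^ n) P" if "homogeneous c W" "\<not> vanishes_at W P" for W c m n
    using vanishes_at_mult'[OF homogeneous_mult[OF that(1) homogeneous_power[OF TLH(3), of m]] homogeneous_power[OF TLH(2), of n]]
      vanishes_at_mult'[OF that(1) homogeneous_power[OF TLH(3), of m]] that(2)
      vanishes_at_power[OF TLH(3,5)] vanishes_at_power[OF TLH(2,4)] by blast
  have hC: "homogeneous (3 * a + 3 * b + e) ?C" and hD: "homogeneous (3 * a + 3 * b + e) ?D"
  proof -
    have 1: "3 * a + 3 * b + e = 2 * a + e + 3 * b + a" and 2: "3 * a + 3 * b + e = 2 * b + e + 3 * a + b"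
      by simp_all
    show "homogeneous (3 * a + 3 * b + e) ?C"
      unfolding 1 by (rule deg[OF U(1)])
    show "homogeneous (3 * a + 3 * b + e) ?D"
      unfolding 2 by (rule deg[OF V(1)])
  qed
  have u: "ratfun Q ?C ?D \<in> Units (local_ring Q P)"
    by (rule unitI[OF hC hD van[OF U(1,2)] van[OF V(1,2)]])
  have CD: "(?C, ?D) \<in> fractions Q"
    using hC hD nonvanishing_not_dvd'[OF hD van[OF V(1,2)]] by (intro fractionsI)
  \<comment> \<open>Y1 / Y2 stands for t^(a - b), so that both signs of a - b reduce to the same
    identity.\<close>
  have key: "Q dvd F * (?D * Y2) - ?C * Y1 * G" if "L ^ b * T ^ a * Y2 = L ^ a * T ^ b * Y1" for Y1 Y2
  proof -
    have "F * (?D * Y2) - ?C * Y1 * G =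
      (H ^ a * F - T ^ a * U) * (V * L ^ b * Y2) - (H ^ b * G - T ^ b * V) * (U * L ^ a * Y1)
      + U * V * (L ^ b * T ^ a * Y2 - L ^ a * T ^ b * Y1)"
      by (simp add: algebra_simps)
    also have "\<dots> = (H ^ a * F - T ^ a * U) * (V * L ^ b * Y2) - (H ^ b * G - T ^ b * V) * (U * L ^ a * Y1)"
      using that by simp
    finally show ?thesis
      using U(3) V(3) by simp
  qed
  have n: "fval P F G = int a - int b"
    by (simp add: fval_def a_def b_def)
  have "ratfun Q F G = ratfun Q ?C ?D \<otimes>\<^bsub>function_field Q\<^esub> (t [^]\<^bsub>function_field Q\<^esub> fval P F G)"
  proof (cases "a \<ge> b")
    case True
    then obtain m where m: "a = b + m"
      using le_Suc_ex by blast
    have "t [^]\<^bsub>function_field Q\<^esub> fval P F G = ratfun Q (T ^ m) (L ^ m)"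
      unfolding n m t_def using function_field_int_pow(1)[OF TL TLH(6), of m] by simp
    moreover have "Q dvd F * (?D * L ^ m) - ?C * T ^ m * G"
      by (rule key) (simp add: m power_add mult_ac)
    ultimately show ?thesis
      using FG CD TL by (simp add: function_field_mult fractions_power fractions_mult ratfun_eq_iff)
  next
    case False
    then obtain m where m: "b = a + m"
      using le_Suc_ex[of a b] by auto
    have LT: "(L, T) \<in> fractions Q"
      using TL TLH(6) by (rule fractions_swap)
    have "t [^]\<^bsub>function_field Q\<^esub> fval P F G = ratfun Q (L ^ m) (T ^ m)"
      unfolding n m t_def using function_field_int_pow(2)[OF TL TLH(6), of m] by simp
    moreover have "Q dvd F * (?D * T ^ m) - ?C * L ^ m * G"
      by (rule key) (simp add: m power_add mult_ac)
    ultimately show ?thesis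
      using FG CD LT by (simp add: function_field_mult fractions_power fractions_mult ratfun_eq_iff)
  qed
  with t u show ?thesis
    by blast
qed

lemma ord_at_ratfun:
  assumes "(F, G) \<in> fractions Q" "\<not> Q dvd F"
  shows "ord_at Q P (ratfun Q F G) = int (val P F) - int (val P G)"
proof -
  have "ord_at Q P (ratfun Q F G) = fval P F G"
    unfolding ord_at_def
    using ord_at_exists[OF assms] ord_at_unique[OF assms]
    by (intro the_equality) (auto simp: is_uniformizer_def)
  then show ?thesis
    by (simp add: fval_def)
qed

end

text \<open>The bridge from the function field to forms: later arguments work with pairs of forms of
  equal degree and with \<open>val\<close>.\<close>

lemma principal_divisors_iff:
  "D \<in> principal_divisors Q \<longleftrightarrow> keys D \<subseteq> curve_points Q \<and>
    (\<exists>e F G. homogeneous e F \<and> homogeneous e G \<and> \<not> Q dvd F \<and> \<not> Q dvd G \<and>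
      (\<forall>P\<in>curve_points Q. lookup D P = int (val P F) - int (val P G)))"
    (is "_ \<longleftrightarrow> _ \<and> ?R")
proof -
  have zero: "\<zero>\<^bsub>function_field Q\<^esub> = ratfun Q 0 1"
    by (simp add: function_field_def)
  have zf: "(0, 1) \<in> fractions Q"
    using fermat_not_dvd_1 by (intro fractionsI[of 0]) simp_all
  have nz: "ratfun Q F G = ratfun Q 0 1 \<longleftrightarrow> Q dvd F" if "(F, G) \<in> fractions Q" for F G
    using ratfun_eq_iff[OF that zf] by simp
  have "(\<exists>f \<in> carrier (function_field Q) - {\<zero>\<^bsub>function_field Q\<^esub>}.
         \<forall>P\<in>curve_points Q. lookup D P = ord_at Q P f) \<longleftrightarrow> ?R"
  proof
    assume "\<exists>f \<in> carrier (function_field Q) - {\<zero>\<^bsub>function_field Q\<^esub>}.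
         \<forall>P\<in>curve_points Q. lookup D P = ord_at Q P f"
    then obtain F G where FG: "(F, G) \<in> fractions Q" "ratfun Q F G \<noteq> ratfun Q 0 1"
      "\<forall>P\<in>curve_points Q. lookup D P = ord_at Q P (ratfun Q F G)"
      unfolding function_field_carrier zero by blast
    then have FG: "(F, G) \<in> fractions Q" "\<not> Q dvd F"
      "\<forall>P\<in>curve_points Q. lookup D P = ord_at Q P (ratfun Q F G)"
      using nz by auto
    then show ?R
      using ord_at_ratfun[OF _ FG(1,2)] by (auto simp: fractions_def)
  next
    assume ?R
    then obtain e F G where FG: "homogeneous e F" "homogeneous e G" "\<not> Q dvd F" "\<not> Q dvd G"
      "\<forall>P\<in>curve_points Q. lookup D P = int (val P F) - int (val P G)"
      by blast
    then have f: "(F, G) \<in> fractions Q"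
      by (intro fractionsI)
    have "ratfun Q F G \<in> carrier (function_field Q) - {\<zero>\<^bsub>function_field Q\<^esub>}"
      unfolding zero using nz[OF f] FG(3) ratfun_in_carrier[OF f] by simp
    moreover have "\<forall>P\<in>curve_points Q. lookup D P = ord_at Q P (ratfun Q F G)"
      using ord_at_ratfun[OF _ f FG(3)] FG(5) by simp
    ultimately show "\<exists>f \<in> carrier (function_field Q) - {\<zero>\<^bsub>function_field Q\<^esub>}.
         \<forall>P\<in>curve_points Q. lookup D P = ord_at Q P f"
      by (rule bexI[rotated])
  qed
  then show ?thesis
    by (simp add: principal_divisors_def)
qed

end


section \<open>Real structures\<close>

lemma val_diff_ge:
  fixes A B :: "'a::{field_char_0, alg_closed_field} ternary"
  assumes P: "P \<in> curve" and A: "homogeneous e A" and B: "homogeneous e B"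
    and AB: "\<not> Q dvd A - B"
  shows "val P (A - B) \<ge> min (val P A) (val P B)"
proof -
  define \<psi> where "\<psi> = (SOME \<psi>. branch \<psi> P)"
  have \<psi>: "branch \<psi> P"
    unfolding \<psi>_def by (rule branch_ex[OF P])
  then have "\<psi> (A - B) \<noteq> 0" and eq: "\<psi> (A - B) = \<psi> A - \<psi> B"
    using AB homogeneous_diff[OF A B] unfolding branch_def by (blast, simp add: ring_map_diff)
  then show ?thesis
    unfolding val_def \<psi>_def[symmetric] eq by (intro subdegree_diff_ge) auto
qed

text \<open>If \<open>A / B\<close> has no zeros or poles and takes the value \<open>c\<close> at a point, then \<open>A - c B\<close> has more
  zeros than its degree allows.\<close>

lemma equal_val_imp_proportional:
  fixes A B :: "'a::{field_char_0, alg_closed_field} ternary"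
  assumes A: "homogeneous e A" "\<not> Q dvd A" and B: "homogeneous e B" "\<not> Q dvd B"
    and eq: "\<And>P. P \<in> curve \<Longrightarrow> val P A = val P B"
  shows "\<exists>c. c \<noteq> 0 \<and> Q dvd A - tconst c * B"
proof -
  obtain r :: 'a where r: "r ^ 4 = -1"
    using fourth_root_exists by blast
  have ch: "chart 1 2 3 r 0"
    by unfold_locales (use r in auto)
  define v where "v = chart.pt 1 2 r 0"
  define P where "P = proj_pt v"
  have P: "P \<in> curve"
    unfolding P_def v_def by (rule val_proj_pt_chart(1)[OF ch homogeneous_0])
  obtain T L H where TLH: "homogeneous 1 T" "homogeneous 3 H" "\<not> vanishes_at H P" "val P T = 1"
    and expansion: "\<And>e F. homogeneous e F \<Longrightarrow> \<not> Q dvd F \<Longrightarrow>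
      \<exists>U. homogeneous (2 * val P F + e) U \<and> \<not> vanishes_at U P \<and>
        Q dvd H ^ val P F * F - T ^ val P F * U"
    using val_expansion[OF P] by metis
  define n where "n = val P B"
  have nA: "val P A = n"
    using eq[OF P] by (simp add: n_def)
  obtain U where U: "homogeneous (2 * n + e) U" "\<not> vanishes_at U P" "Q dvd H ^ n * A - T ^ n * U"
    using expansion[OF A] unfolding nA by blast
  obtain V where V: "homogeneous (2 * n + e) V" "\<not> vanishes_at V P" "Q dvd H ^ n * B - T ^ n * V"
    using expansion[OF B] unfolding n_def by blast
  have UV: "teval v U \<noteq> 0" "teval v V \<noteq> 0"
    using U V by (auto simp: P_def vanishes_at_proj_pt)
  \<comment> \<open>The value of A / B at P, read off from the unit parts because A and B have the
    same order n there.\<close>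
  define c where "c = teval v U / teval v V"
  have c: "c \<noteq> 0"
    using UV by (simp add: c_def)
  let ?A = "A - tconst c * B" and ?U = "U - tconst c * V"
  have hA: "homogeneous e ?A" and hU: "homogeneous (2 * n + e) ?U"
    using A(1) B(1) U(1) V(1) by (auto intro: homogeneous_diff homogeneous_tconst_mult)
  have hcB: "homogeneous e (tconst c * B)"
    using B(1) by (rule homogeneous_tconst_mult)
  have hH: "homogeneous (3 * n) (H ^ n)" and hT: "homogeneous (1 * n) (T ^ n)"
    using homogeneous_power TLH by blast+
  have nH: "\<not> Q dvd H ^ n"
    using fermat_not_dvd_power[OF TLH(2)] nonvanishing_not_dvd[OF P TLH(2,3)] by simp
  have "Q dvd ?A"
  proof (rule ccontr)
    assume nd: "\<not> Q dvd ?A"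
    have "Q dvd (H ^ n * A - T ^ n * U) - tconst c * (H ^ n * B - T ^ n * V)"
      using U(3) V(3) by (rule dvd_diff[OF _ dvd_mult])
    also have "(H ^ n * A - T ^ n * U) - tconst c * (H ^ n * B - T ^ n * V) = H ^ n * ?A - T ^ n * ?U"
      by (simp add: algebra_simps)
    finally have cong: "Q dvd H ^ n * ?A - T ^ n * ?U" .
    have nHA: "\<not> Q dvd H ^ n * ?A"
      using fermat_prime[OF hH hA] nH nd by blast
    have nTU: "\<not> Q dvd T ^ n * ?U"
    proof
      assume "Q dvd T ^ n * ?U"
      from dvd_add[OF cong this] show False
        using nHA by simp
    qed
    then have nT: "\<not> Q dvd T ^ n" and nU: "\<not> Q dvd ?U"
      by (auto intro: dvd_mult dvd_mult2)
    have deg: "3 * n + e = 1 * n + (2 * n + e)"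
      by simp
    have "val P (H ^ n * ?A) = val P (T ^ n * ?U)"
      using cong homogeneous_mult[OF hH hA] homogeneous_mult[OF hT hU] unfolding deg
      by (intro val_cong[OF P])
    moreover have "val P (H ^ n * ?A) = val P ?A"
      using val_mult[OF P hH hA nH nd] vanishes_at_mult[OF P] val_eq_0_iff[OF P hH nH]
        val_power[OF P TLH(2)] nonvanishing_not_dvd[OF P TLH(2,3)] val_eq_0_iff[OF P TLH(2)] TLH(3) by simp
    moreover have "val P (T ^ n * ?U) = val P (T ^ n) + val P ?U"
      by (rule val_mult[OF P hT hU nT nU])
    moreover have "val P (T ^ n) = n"
    proof (cases "n = 0")
      case True
      have "val P 1 = 0"
        using val_eq_0_iff[OF P homogeneous_one] fermat_not_dvd_1 P
        by (auto simp: curve_points_eq vanishes_at_proj_pt[OF homogeneous_one] teval_simps)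
      with True show ?thesis
        by simp
    next
      case False
      then have "\<not> Q dvd T"
        using nT dvd_power[of n T] by (auto intro: dvd_trans)
      then show ?thesis
        using val_power[OF P TLH(1)] TLH(4) by simp
    qed
    moreover have "val P ?U > 0"
    proof -
      have "teval v ?U = 0"
        using UV by (simp add: teval_simps c_def)
      then show ?thesis
        using val_eq_0_iff[OF P hU nU] by (simp add: P_def vanishes_at_proj_pt[OF hU])
    qed
    ultimately have big: "val P ?A > val P B"
      by (simp add: n_def)
    have ge: "val R B \<le> val R ?A" if R: "R \<in> curve" for R
    proof -
      have nc: "\<not> Q dvd tconst c"
        using vdeg_bform[of 1 2 3 "[:c:]" 0] c by (simp add: bform_def)
      have "val R (tconst c) = 0"
        using val_eq_0_iff[OF R homogeneous_tconst nc] R c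
        by (auto simp: curve_points_eq vanishes_at_proj_pt[OF homogeneous_tconst])
      then have "val R (tconst c * B) = val R B"
        using val_mult[OF R homogeneous_tconst B(1) nc B(2)] by simp
      then show ?thesis
        using val_diff_ge[OF R A(1) hcB nd] eq[OF R] by simp
    qed
    let ?Z = "zeros ?A \<union> zeros B \<union> {P}"
    have Z: "finite ?Z" "?Z \<subseteq> curve"
      using bezout(1)[OF hA nd] bezout(1)[OF B] P by (auto simp: zeros_def)
    have "(\<Sum>R\<in>?Z. val R B) < (\<Sum>R\<in>?Z. val R ?A)"
      using Z ge big by (intro sum_strict_mono_ex1) auto
    moreover have "vdeg B = (\<Sum>R\<in>?Z. val R B)"
      by (rule vdeg_superset[OF B Z(1) _ Z(2)]) blast
    moreover have "vdeg ?A = (\<Sum>R\<in>?Z. val R ?A)"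
      by (rule vdeg_superset[OF hA nd Z(1) _ Z(2)]) blast
    ultimately have "vdeg B < vdeg ?A"
      by (simp only:)
    then show False
      using bezout(2)[OF B] bezout(2)[OF hA nd] by simp
  qed
  with c show ?thesis
    by blast
qed

lemma even_sum_involution:
  fixes M :: "'b \<Rightarrow> int"
  assumes "finite S" "\<And>x. x \<in> S \<Longrightarrow> f x \<in> S \<and> f (f x) = x \<and> f x \<noteq> x \<and> M (f x) = M x"
  shows "even (\<Sum>x\<in>S. M x)"
  using assms
proof (induction "card S" arbitrary: S rule: less_induct)
  case less
  show ?case
  proof (cases "S = {}")
    case False
    then obtain x where x: "x \<in> S"
      by blast
    note fx = less.prems(2)[OF x]
    let ?S = "S - {x, f x}"
    have "f y \<in> ?S" if "y \<in> ?S" for y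
      using that less.prems(2)[of y] fx by auto
    then have "even (\<Sum>y\<in>?S. M y)"
      using less.prems x by (intro less.hyps psubset_card_mono) auto
    moreover have "(\<Sum>y\<in>S. M y) = (\<Sum>y\<in>?S. M y) + (\<Sum>y\<in>{x, f x}. M y)"
      using less.prems(1) x fx by (intro sum.subset_diff) auto
    moreover have "(\<Sum>y\<in>{x, f x}. M y) = 2 * M x"
      using fx by (subst sum.insert) auto
    ultimately show ?thesis
      by simp
  qed simp
qed

text \<open>The facts about complex conjugation that the parity argument needs.
  \<open>real_sqrt\<close> normalises a real norm to 1 or -1, \<open>imaginary\<close> conjugates
  X^2 + u Y^2, and \<open>definite\<close> says that the quartic has no real point, in coordinates
  with one entry equal to 1.\<close>

locale real_structure =
  fixes \<kappa> :: "'a::{field_char_0, alg_closed_field} \<Rightarrow> 'a"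
  assumes ring_map_kappa: "ring_map \<kappa>" and involution: "\<kappa> (\<kappa> x) = x"
    and imaginary: "u\<^sup>2 = -1 \<Longrightarrow> \<kappa> u = - u"
    and real_sqrt: "\<kappa> c = c \<Longrightarrow> \<exists>d. \<kappa> d = d \<and> (d\<^sup>2 = c \<or> d\<^sup>2 = - c)"
    and definite: "\<kappa> a = a \<Longrightarrow> \<kappa> b = b \<Longrightarrow> 1 + a ^ 4 + b ^ 4 \<noteq> 0"
begin

sublocale symmetry \<kappa> "\<lambda>_. 1"
  by unfold_locales (auto simp: ring_map_kappa intro: o_bij[of \<kappa>] simp: involution fun_eq_iff)

definition cj :: "'a ternary \<Rightarrow> 'a ternary" where
  "cj = twist \<kappa> (\<lambda>_. 1)"

definition cp :: "('a ^ 3) set \<Rightarrow> ('a ^ 3) set" where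
  "cp = twist_point \<kappa> (\<lambda>_. 1)"

lemma ring_map_cj: "ring_map cj"
  unfolding cj_def by (rule ring_map_twist[OF ring_map_kappa])

lemmas cj_simps = ring_map_simps[OF ring_map_cj]

lemma cj_cj: "cj (cj F) = F"
  by (simp add: cj_def twist_twist ring_map_kappa involution ring_map_1[OF ring_map_kappa] twist_id)

lemma cj_tvar [simp]: "cj (tvar i) = tvar i" and cj_tconst [simp]: "cj (tconst c) = tconst (\<kappa> c)"
  by (simp_all add: cj_def twist_tvar twist_tconst ring_map_kappa)

lemma homogeneous_cj: "homogeneous e F \<Longrightarrow> homogeneous e (cj F)"
  unfolding cj_def by (rule homogeneous_twist[OF ring_map_kappa])

lemma dvd_cj_iff: "Q dvd cj F \<longleftrightarrow> Q dvd F"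
  unfolding cj_def by (rule dvd_twist_iff)

lemma cp_cp: "cp (cp P) = P"
  by (simp add: cp_def twist_point_def image_image involution)

lemma cp_curve: "P \<in> curve \<Longrightarrow> cp P \<in> curve"
  unfolding cp_def by (rule twist_point_curve)

lemma val_cj:
  assumes "P \<in> curve" "homogeneous e F"
  shows "val P (cj F) = val (cp P) F"
  using val_twist[OF cp_curve[OF assms(1)] assms(2)] cp_cp[of P] by (simp add: cj_def cp_def)

text \<open>Normalising X_i = 1 singles out one coordinate vector of the point, so a fixed point
  would have real coordinates.\<close>

lemma cp_no_fixed_point:
  assumes "P \<in> curve"
  shows "cp P \<noteq> P"
proof
  assume fixed: "cp P = P"
  obtain i j k and b c :: 'a where ch: "chart i j k b c" "P = proj_pt (chart.pt i j b c)"
    using curve_point_chart[OF assms] by blast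
  interpret chart i j k b c
    by (rule ch)
  let ?v = "\<chi> n. \<kappa> (pt $ n) / 1"
  have "proj_pt ?v = proj_pt pt"
    using fixed twist_point_proj_pt[OF ring_map_kappa bij_s, of "\<lambda>_. 1" pt] by (simp only: cp_def ch(2))
  then have "?v = pt"
    by (rule proj_pt_eq_normalized[where i = i]) (simp_all add: ring_map_1[OF ring_map_kappa])
  then have "?v $ n = pt $ n" for n
    by simp
  from this[of j] this[of k] have "\<kappa> b = b" "\<kappa> c = c"
    by simp_all
  from definite[OF this] show False
    using bc by simp
qed

text \<open>Hilbert 90 made explicit: if h = F / G has norm 1, then h = (1 + h) / (1 + h)'. Hence M
  plus the divisor of 1 + h is invariant, and its points come in conjugate pairs.\<close>

lemma hilbert90_even:
  fixes M :: "('a ^ 3) set \<Rightarrow> int"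
  assumes F: "homogeneous e F" "\<not> Q dvd F" and G: "homogeneous e G" "\<not> Q dvd G"
    and norm: "Q dvd F * cj F - G * cj G"
    and M: "\<And>P. P \<in> curve \<Longrightarrow> M (cp P) - M P = int (val P F) - int (val P G)"
    and S: "finite S" "S \<subseteq> curve" "\<And>P. P \<in> curve - S \<Longrightarrow> M P = 0"
  shows "even (\<Sum>P\<in>S. M P)"
proof -
  let ?W = "G + F"
  have hW: "homogeneous e ?W"
    using G(1) F(1) by (rule homogeneous_add)
  \<comment> \<open>W / G is 1 + h. If that is zero, then h = -1 has trivial divisor and the
    constant 1 does instead.\<close>
  define W where "W = (if Q dvd ?W then G else ?W)"
  have W: "homogeneous e W" "\<not> Q dvd W"
    using hW G by (auto simp: W_def)
  have key: "int (val P F) - int (val P G) =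
      int (val P W) - int (val P G) - (int (val (cp P) W) - int (val (cp P) G))"
    if P: "P \<in> curve" for P
  proof (cases "Q dvd ?W")
    case True
    then have "Q dvd F - (- G)"
      by (simp add: add.commute)
    then have "val P F = val P (- G)"
      by (intro val_cong[OF P F(1) homogeneous_uminus[OF G(1)]])
    also have "\<dots> = val P G"
      using branch_ex[OF P] by (simp add: val_def branch_def ring_map_uminus)
    finally show ?thesis
      using True by (simp add: W_def)
  next
    case False
    have "F * cj ?W - ?W * cj G = F * cj F - G * cj G"
      by (simp add: cj_simps algebra_simps)
    then have dvd: "Q dvd F * cj ?W - ?W * cj G"
      using norm by simp
    have nc: "\<not> Q dvd cj ?W" "\<not> Q dvd cj G"
      using False G(2) by (simp_all add: dvd_cj_iff)
    have "val P (F * cj ?W) = val P (?W * cj G)"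
      by (rule val_cong[OF P homogeneous_mult[OF F(1) homogeneous_cj[OF hW]]
            homogeneous_mult[OF hW homogeneous_cj[OF G(1)]] dvd])
    then have "val P F + val P (cj ?W) = val P ?W + val P (cj G)"
      using val_mult[OF P F(1) homogeneous_cj[OF hW] F(2) nc(1)] val_mult[OF P hW homogeneous_cj[OF G(1)] False nc(2)]
      by simp
    then show ?thesis
      using False by (simp add: W_def val_cj[OF P hW] val_cj[OF P G(1)])
  qed
  define N where "N P = M P + int (val P W) - int (val P G)" for P
  let ?S = "S \<union> zeros W \<union> zeros G"
  \<comment> \<open>Closed under \<open>cp\<close>, and large enough to contain every point where N
    may be nonzero.\<close>
  let ?T = "?S \<union> cp ` ?S"
  have T: "finite ?T" "?T \<subseteq> curve"
    using S bezout(1)[OF W] bezout(1)[OF G] cp_curve by (auto simp: zeros_def)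
  have "cp P \<in> ?T \<and> cp (cp P) = P \<and> cp P \<noteq> P \<and> N (cp P) = N P" if "P \<in> ?T" for P
  proof -
    have P: "P \<in> curve"
      using that T by blast
    have "cp P \<in> ?T"
      using that cp_cp by auto
    moreover have "N (cp P) = N P"
      using M[OF P] key[OF P] by (simp add: N_def)
    ultimately show ?thesis
      using cp_cp cp_no_fixed_point[OF P] by simp
  qed
  from even_sum_involution[OF T(1) this] have "even (\<Sum>P\<in>?T. N P)" .
  also have "(\<Sum>P\<in>?T. N P) = (\<Sum>P\<in>?T. M P) + int (\<Sum>P\<in>?T. val P W) - int (\<Sum>P\<in>?T. val P G)"
    by (simp add: N_def sum.distrib sum_subtractf)
  also have "(\<Sum>P\<in>?T. val P W) = 4 * e"
    unfolding bezout(2)[OF W, symmetric] by (rule vdeg_superset[OF W T(1) _ T(2), symmetric]) blast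
  also have "(\<Sum>P\<in>?T. val P G) = 4 * e"
    unfolding bezout(2)[OF G, symmetric] by (rule vdeg_superset[OF G T(1) _ T(2), symmetric]) blast
  also have "(\<Sum>P\<in>?T. M P) = (\<Sum>P\<in>S. M P)"
    using T S by (intro sum.mono_neutral_right) auto
  finally show ?thesis
    by simp
qed

text \<open>The hypothesis at P and at \<open>cp P\<close> adds up to 0, so the norm of F / G has
  trivial divisor and \<open>equal_val_imp_proportional\<close> applies. Subtracting the conjugate
  of the resulting congruence shows that the constant is real.\<close>

lemma norm_constant:
  assumes F: "homogeneous e F" "\<not> Q dvd F" and G: "homogeneous e G" "\<not> Q dvd G"
    and M: "\<And>P. P \<in> curve \<Longrightarrow> M (cp P) - M P = int (val P F) - int (val P G)"
  shows "\<exists>c. c \<noteq> 0 \<and> \<kappa> c = c \<and> Q dvd F * cj F - tconst c * (G * cj G)"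
proof -
  have h: "homogeneous (e + e) (F * cj F)" "homogeneous (e + e) (G * cj G)"
    using F G by (auto intro: homogeneous_mult homogeneous_cj)
  have nc: "\<not> Q dvd cj F" "\<not> Q dvd cj G"
    using F(2) G(2) by (simp_all add: dvd_cj_iff)
  then have n: "\<not> Q dvd F * cj F" "\<not> Q dvd G * cj G"
    using fermat_prime[OF F(1) homogeneous_cj[OF F(1)]] fermat_prime[OF G(1) homogeneous_cj[OF G(1)]] F(2) G(2)
    by blast+
  have "val P (F * cj F) = val P (G * cj G)" if P: "P \<in> curve" for P
    using M[OF P] M[OF cp_curve[OF P]] cp_cp[of P]
      val_mult[OF P F(1) homogeneous_cj[OF F(1)] F(2) nc(1)] val_mult[OF P G(1) homogeneous_cj[OF G(1)] G(2) nc(2)]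
    by (simp add: val_cj[OF P F(1)] val_cj[OF P G(1)])
  from equal_val_imp_proportional[OF h(1) n(1) h(2) n(2) this]
  obtain c where c: "c \<noteq> 0" "Q dvd F * cj F - tconst c * (G * cj G)"
    by blast
  have "Q dvd cj (F * cj F - tconst c * (G * cj G))"
    using c(2) by (simp only: dvd_cj_iff)
  also have "cj (F * cj F - tconst c * (G * cj G)) = F * cj F - tconst (\<kappa> c) * (G * cj G)"
    by (simp add: cj_simps cj_cj mult_ac)
  finally have "Q dvd (F * cj F - tconst c * (G * cj G)) - (F * cj F - tconst (\<kappa> c) * (G * cj G))"
    by (rule dvd_diff[OF c(2)])
  also have "(F * cj F - tconst c * (G * cj G)) - (F * cj F - tconst (\<kappa> c) * (G * cj G)) = tconst (\<kappa> c - c) * (G * cj G)"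
    by (simp add: ring_map_diff[OF ring_map_tconst] algebra_simps)
  finally have "Q dvd tconst (\<kappa> c - c)"
    using fermat_prime[OF homogeneous_tconst h(2)] n(2) by blast
  then have "\<kappa> c = c"
    using vdeg_bform[of 1 2 3 "[:\<kappa> c - c:]" 0] by (auto simp: bform_def)
  with c show ?thesis
    by blast
qed

text \<open>The function \<open>(X\<^sup>2 + u Y\<^sup>2) / Z\<^sup>2\<close> with \<open>u\<^sup>2 = -1\<close> has norm \<open>-1\<close>, and its divisor is divisible by two.\<close>

lemma minus_one_norm:
  obtains E :: "'a ternary" where "homogeneous 2 E" "\<not> Q dvd E"
    "Q dvd E * cj E + tvar 3 ^ 4"
    "\<And>P. P \<in> curve \<Longrightarrow> val P E + val (cp P) E = 4 * val P (tvar 3)"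
    "\<And>P. P \<in> curve \<Longrightarrow> even (val P E)"
    "\<And>P. P \<in> curve \<Longrightarrow> val (cp P) (tvar 3) = val P (tvar 3)"
proof -
  obtain r :: 'a where r: "r ^ 4 = -1"
    using fourth_root_exists by blast
  define u where "u = r\<^sup>2"
  have u: "u\<^sup>2 = -1"
    using r by (simp add: u_def flip: power_mult)
  define E where "E = tvar 1 ^ 2 + tconst u * tvar 2 ^ 2"
  have hE: "homogeneous 2 E"
    unfolding E_def by (intro homogeneous_add homogeneous_tconst_mult homogeneous_tvar_power)
  have cjE: "cj E = tvar 1 ^ 2 - tconst u * tvar 2 ^ 2"
    by (simp add: E_def cj_simps imaginary[OF u] ring_map_uminus[OF ring_map_tconst])
  have "tconst u * tconst u = - 1"
    using u by (simp add: mult_single power2_eq_square ring_map_uminus[OF ring_map_tconst])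
  moreover have "(x\<^sup>2 + y * z\<^sup>2) * (x\<^sup>2 - y * z\<^sup>2) = x ^ 4 - y * y * z ^ 4" for x y z :: "'a ternary"
    by (simp add: algebra_simps power2_eq_square power4_eq_xxxx)
  ultimately have "E * cj E = tvar 1 ^ 4 + tvar 2 ^ 4"
    unfolding cjE unfolding E_def by simp
  then have EE: "E * cj E + tvar 3 ^ 4 = Q"
    by (simp add: fermat_quartic_def)
  have h3: "homogeneous 1 (tvar 3 :: 'a ternary)" "homogeneous 4 (tvar 3 ^ 4 :: 'a ternary)"
    using homogeneous_tvar homogeneous_tvar_power by blast+
  have n3: "\<not> Q dvd (tvar 3 :: 'a ternary)"
    using vdeg_linear(3)[of 1 2 3 "0 :: 'a"] by simp
  have n34: "\<not> Q dvd - (tvar 3 ^ 4 :: 'a ternary)"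
    using fermat_not_dvd_power[OF h3(1) n3] by simp
  have hEE: "homogeneous 4 (E * cj E)"
    using homogeneous_mult[OF hE homogeneous_cj[OF hE]] by simp
  have dvd: "Q dvd E * cj E - (- (tvar 3 ^ 4))"
    using EE by simp
  have nEE: "\<not> Q dvd E * cj E"
  proof
    assume "Q dvd E * cj E"
    from dvd_diff[OF this dvd] show False
      using n34 by simp
  qed
  then have nE: "\<not> Q dvd E" "\<not> Q dvd cj E"
    by (auto intro: dvd_mult dvd_mult2)
  have sum: "val P E + val (cp P) E = 4 * val P (tvar 3)" if P: "P \<in> curve" for P
  proof -
    have "val P (E * cj E) = val P (- (tvar 3 ^ 4))"
      by (rule val_cong[OF P hEE homogeneous_uminus[OF h3(2)] dvd])
    also have "\<dots> = val P (tvar 3 ^ 4)"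
      using branch_ex[OF P] by (simp add: val_def branch_def ring_map_uminus)
    also have "\<dots> = 4 * val P (tvar 3)"
      by (rule val_power[OF P h3(1) n3])
    finally show ?thesis
      using val_mult[OF P hE homogeneous_cj[OF hE] nE] by (simp add: val_cj[OF P hE])
  qed
  \<comment> \<open>E and its conjugate have no common zero on the curve: it would have X = Y = 0
    and then Z = 0. So one of the two orders is 0, and the other is four times that of Z.\<close>
  have even: "even (val P E)" if P: "P \<in> curve" for P
  proof -
    have "val P E = 0 \<or> val P (cj E) = 0"
    proof (rule ccontr)
      assume "\<not> ?thesis"
      then have van: "vanishes_at E P" "vanishes_at (cj E) P"
        using val_eq_0_iff[OF P hE nE(1)] val_eq_0_iff[OF P homogeneous_cj[OF hE] nE(2)] by auto
      obtain v where v: "P = proj_pt v" "v \<noteq> 0" "teval v Q = 0"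
        using P by (auto simp: curve_points_eq)
      have "(v $ 1)\<^sup>2 + u * (v $ 2)\<^sup>2 = 0" "(v $ 1)\<^sup>2 - u * (v $ 2)\<^sup>2 = 0"
        using van unfolding v(1) vanishes_at_proj_pt[OF hE] vanishes_at_proj_pt[OF homogeneous_cj[OF hE]]
        by (simp_all add: cjE) (simp_all add: E_def teval_simps)
      then have "2 * (v $ 1)\<^sup>2 = 0" "u * (v $ 2)\<^sup>2 = (v $ 1)\<^sup>2"
        by (simp_all add: algebra_simps add_eq_0_iff)
      then have "v $ 1 = 0" "v $ 2 = 0"
        using u by auto
      then have "v $ 3 = 0"
        using v(3) by (simp add: fermat_quartic_def teval_simps)
      have "v $ n = 0" for n
      proof -
        have "n \<in> {1, 2, 3}"
          by (subst UNIV_3[of 1 2 3, symmetric]) simp_all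
        then show ?thesis
          using \<open>v $ 1 = 0\<close> \<open>v $ 2 = 0\<close> \<open>v $ 3 = 0\<close> by auto
      qed
      then show False
        using v(2) by (simp add: vec_eq_iff)
    qed
    then show ?thesis
      using sum[OF P] by (auto simp: val_cj[OF P hE])
  qed
  have v3: "val (cp P) (tvar 3) = val P (tvar 3)" if P: "P \<in> curve" for P
    using val_cj[OF P h3(1)] by simp
  show ?thesis
    using that[OF hE nE(1) _ sum even v3] EE by simp
qed

text \<open>M gives the coefficients of a divisor supported in S, and F / G is a function whose
  divisor is the conjugate divisor minus the original one.\<close>

lemma invariant_class_even_degree:
  fixes M :: "('a ^ 3) set \<Rightarrow> int"
  assumes F: "homogeneous e F" "\<not> Q dvd F" and G: "homogeneous e G" "\<not> Q dvd G"
    and M: "\<And>P. P \<in> curve \<Longrightarrow> M (cp P) - M P = int (val P F) - int (val P G)"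
    and S: "finite S" "S \<subseteq> curve" "\<And>P. P \<in> curve - S \<Longrightarrow> M P = 0"
  shows "even (\<Sum>P\<in>S. M P)"
proof -
  obtain c where c: "c \<noteq> 0" "\<kappa> c = c" "Q dvd F * cj F - tconst c * (G * cj G)"
    using norm_constant[OF F G M] by blast
  obtain d where d: "\<kappa> d = d" "d\<^sup>2 = c \<or> d\<^sup>2 = - c"
    using real_sqrt[OF c(2)] by blast
  have "d \<noteq> 0"
    using d(2) c(1) by auto
  have nd: "\<not> Q dvd tconst d"
    using vdeg_bform[of 1 2 3 "[:d:]" 0] \<open>d \<noteq> 0\<close> by (simp add: bform_def)
  have vd: "val P (tconst d) = 0" if P: "P \<in> curve" for P
    using val_eq_0_iff[OF P homogeneous_tconst nd] P \<open>d \<noteq> 0\<close>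
    by (auto simp: curve_points_eq vanishes_at_proj_pt[OF homogeneous_tconst])
  \<comment> \<open>F / G' has norm c / d^2, that is 1 or -1, and the same divisor as F / G.\<close>
  define G' where "G' = tconst d * G"
  have G': "homogeneous e G'" "\<not> Q dvd G'"
    using homogeneous_tconst_mult[OF G(1)] fermat_prime[OF homogeneous_tconst G(1)] nd G(2)
    by (auto simp: G'_def)
  have vG': "val P G' = val P G" if P: "P \<in> curve" for P
    using val_mult[OF P homogeneous_tconst G(1) nd G(2)] vd[OF P] by (simp add: G'_def)
  have GG': "G' * cj G' = tconst (d\<^sup>2) * (G * cj G)"
    by (simp add: G'_def cj_simps d(1) power2_eq_square ring_map_mult[OF ring_map_tconst] mult_ac)
  from d(2) show ?thesis
  proof
    assume "d\<^sup>2 = c"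
    then show ?thesis
      using c(3) M vG' by (intro hilbert90_even[OF F G' _ _ S]) (auto simp: GG')
  next
    assume dc: "d\<^sup>2 = - c"
    obtain E :: "'a ternary" where E: "homogeneous 2 E" "\<not> Q dvd E"
      and dvdE: "Q dvd E * cj E + tvar 3 ^ 4"
      and sum: "\<And>P. P \<in> curve \<Longrightarrow> val P E + val (cp P) E = 4 * val P (tvar 3)"
      and even: "\<And>P. P \<in> curve \<Longrightarrow> even (val P E)"
      and v3: "\<And>P. P \<in> curve \<Longrightarrow> val (cp P) (tvar 3) = val P (tvar 3)"
      using minus_one_norm by blast
    have h3: "homogeneous 1 (tvar 3 :: 'a ternary)" "homogeneous 2 (tvar 3 ^ 2 :: 'a ternary)"
      using homogeneous_tvar homogeneous_tvar_power by blast+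
    have n3: "\<not> Q dvd (tvar 3 :: 'a ternary)"
      using vdeg_linear(3)[of 1 2 3 "0 :: 'a"] by simp
    have n32: "\<not> Q dvd (tvar 3 ^ 2 :: 'a ternary)"
      by (rule fermat_not_dvd_power[OF h3(1) n3])
    \<comment> \<open>Half the divisor of E / Z^2; the division by 2 is exact on the curve.\<close>
    define h where "h P = int (val P E) div 2 - int (val P (tvar 3))" for P
    have h: "2 * h P = int (val P E) - 2 * int (val P (tvar 3))" if P: "P \<in> curve" for P
      using even[OF P] by (simp add: h_def)
    let ?S = "S \<union> zeros E \<union> zeros (tvar 3)"
    have S': "finite ?S" "?S \<subseteq> curve"
      using S bezout(1)[OF E] bezout(1)[OF h3(1) n3] by (auto simp: zeros_def)
    have "even (\<Sum>P\<in>?S. M P + h P)"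
    \<comment> \<open>The function (F / G') / (E / Z^2): both factors have norm -1, so it has norm
      1.\<close>
    proof (rule hilbert90_even[of "e + 2" "F * tvar 3 ^ 2" "G' * E"])
      show "homogeneous (e + 2) (F * tvar 3 ^ 2)" "homogeneous (e + 2) (G' * E)"
        by (rule homogeneous_mult[OF F(1) h3(2)], rule homogeneous_mult[OF G'(1) E(1)])
      show "\<not> Q dvd F * tvar 3 ^ 2" "\<not> Q dvd G' * E"
        using fermat_prime[OF F(1) h3(2)] fermat_prime[OF G'(1) E(1)] F(2) n32 G'(2) E(2) by blast+
      have "F * tvar 3 ^ 2 * cj (F * tvar 3 ^ 2) - G' * E * cj (G' * E) =
          (F * cj F - tconst c * (G * cj G)) * tvar 3 ^ 4 + tconst c * (G * cj G) * (E * cj E + tvar 3 ^ 4)"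
      proof -
        have "G' * E * cj (G' * E) = (G' * cj G') * (E * cj E)"
          by (simp add: cj_simps mult_ac)
        also have "\<dots> = - (tconst c * (G * cj G) * (E * cj E))"
          unfolding GG' dc by (simp add: ring_map_uminus[OF ring_map_tconst])
        finally show ?thesis
          by (simp add: cj_simps power2_eq_square power4_eq_xxxx algebra_simps)
      qed
      then show "Q dvd F * tvar 3 ^ 2 * cj (F * tvar 3 ^ 2) - G' * E * cj (G' * E)"
        using dvd_add[OF dvd_mult2[OF c(3)] dvd_mult[OF dvdE]] by simp
      show "M (cp P) + h (cp P) - (M P + h P) = int (val P (F * tvar 3 ^ 2)) - int (val P (G' * E))"
        if P: "P \<in> curve" for P
      proof -
        have "val P (F * tvar 3 ^ 2) = val P F + 2 * val P (tvar 3)"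
          using val_mult[OF P F(1) h3(2) F(2) n32] val_power[OF P h3(1) n3] by simp
        moreover have "val P (G' * E) = val P G + val P E"
          using val_mult[OF P G'(1) E(1) G'(2) E(2)] vG'[OF P] by simp
        moreover have "2 * (h (cp P) - h P) = int (val (cp P) E) - int (val P E)"
          using h[OF P] h[OF cp_curve[OF P]] v3[OF P] by simp
        ultimately show ?thesis
          using M[OF P] sum[OF P] by simp
      qed
      show "M P + h P = 0" if P: "P \<in> curve - ?S" for P
      proof -
        have "P \<in> curve" "\<not> vanishes_at E P" "\<not> vanishes_at (tvar 3) P"
          using P by (auto simp: zeros_def)
        then have "val P E = 0" "val P (tvar 3) = 0"
          using val_eq_0_iff[OF _ E] val_eq_0_iff[OF _ h3(1) n3] by blast+
        then show ?thesis
          using P S(3)[of P] by (simp add: h_def)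
      qed
    qed (use S' in auto)
    also have "(\<Sum>P\<in>?S. M P + h P) = (\<Sum>P\<in>?S. M P) + (\<Sum>P\<in>?S. h P)"
      by (rule sum.distrib)
    \<comment> \<open>By \<open>bezout\<close> twice this sum is 8 - 2 * 4, so adding h does not
      change the degree.\<close>
    also have "(\<Sum>P\<in>?S. h P) = 0"
    proof -
      have "2 * (\<Sum>P\<in>?S. h P) = (\<Sum>P\<in>?S. int (val P E) - 2 * int (val P (tvar 3)))"
        unfolding sum_distrib_left using S'(2) by (intro sum.cong refl h) blast
      also have "\<dots> = int (\<Sum>P\<in>?S. val P E) - 2 * int (\<Sum>P\<in>?S. val P (tvar 3))"
        by (simp add: sum_subtractf sum_distrib_left)
      also have "(\<Sum>P\<in>?S. val P E) = 8"
        using bezout(2)[OF E] vdeg_superset[OF E S'(1) _ S'(2)] by auto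
      also have "(\<Sum>P\<in>?S. val P (tvar 3)) = 4"
        using bezout(2)[OF h3(1) n3] vdeg_superset[OF h3(1) n3 S'(1) _ S'(2)] by auto
      finally show ?thesis
        by simp
    qed
    also have "(\<Sum>P\<in>?S. M P) = (\<Sum>P\<in>S. M P)"
      using S S' by (intro sum.mono_neutral_right) auto
    finally show ?thesis
      by simp
  qed
qed

end


section \<open>Complex conjugation on the algebraic closure of the rationals\<close>

text \<open>A partial embedding of \<open>qbar\<close> into the complex numbers, given by its graph.\<close>

locale partial_embedding =
  fixes R :: "(qbar \<times> complex) set"
  assumes rat: "(to_ac q, of_rat q) \<in> R"
    and add: "(x, a) \<in> R \<Longrightarrow> (y, b) \<in> R \<Longrightarrow> (x + y, a + b) \<in> R"
    and mult: "(x, a) \<in> R \<Longrightarrow> (y, b) \<in> R \<Longrightarrow> (x * y, a * b) \<in> R"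
    and zeroD: "(0, a) \<in> R \<Longrightarrow> a = 0"
begin

text \<open>p has its coefficients in the domain of the partial embedding, and p' is its
  image.\<close>

definition poly_rel :: "qbar poly \<Rightarrow> complex poly \<Rightarrow> bool" where
  "poly_rel p p' \<longleftrightarrow> (\<forall>n. (coeff p n, coeff p' n) \<in> R)"

lemma zero: "(0, 0) \<in> R" and one: "(1, 1) \<in> R"
  using rat[of 0] rat[of 1] by simp_all

lemma uminus: "(x, a) \<in> R \<Longrightarrow> (- x, - a) \<in> R"
  using mult[OF rat[of "-1"], of x a] by simp

lemma diff: "(x, a) \<in> R \<Longrightarrow> (y, b) \<in> R \<Longrightarrow> (x - y, a - b) \<in> R"
  using add[OF _ uminus, of x a y b] by simp

lemma single_valued: "(x, a) \<in> R \<Longrightarrow> (x, b) \<in> R \<Longrightarrow> a = b"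
  using diff[of x a x b] zeroD[of "a - b"] by simp

lemma sum: "(\<And>i. i \<in> A \<Longrightarrow> (f i, g i) \<in> R) \<Longrightarrow> (sum f A, sum g A) \<in> R"
  by (induction A rule: infinite_finite_induct) (auto intro: zero add)

lemma rat_poly: "(x, a) \<in> R \<Longrightarrow> (poly (map_poly to_ac p) x, poly (map_poly of_rat p) a) \<in> R"
  by (induction p) (auto simp: map_poly_pCons intro: zero add mult rat)

text \<open>The axioms only make the domain a ring. It is closed under inverses because its elements
  are algebraic: from c + x h(x) = 0 with c nonzero rational, the inverse of x is - h(x) /
  c.\<close>

lemma inverse:
  assumes "(x, a) \<in> R" "x \<noteq> 0"
  shows "\<exists>b. (inverse x, b) \<in> R"
proof -
  obtain p where p: "p \<noteq> 0" "poly (map_poly to_ac p) x = 0"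
    using alg_closure_algebraic by blast
  \<comment> \<open>Factors X are stripped off until the constant term is nonzero.\<close>
  then have "\<exists>q. coeff q 0 \<noteq> 0 \<and> poly (map_poly to_ac q) x = 0"
  proof (induction p)
    case (pCons c q)
    show ?case
    proof (cases "c = 0")
      case True
      then have "q \<noteq> 0" "poly (map_poly to_ac q) x = 0"
        using pCons.prems assms(2) by (auto simp: map_poly_pCons)
      then show ?thesis
        by (rule pCons.IH)
    next
      case False
      then show ?thesis
        using pCons.prems by (intro exI[of _ "pCons c q"]) simp
    qed
  qed simp
  then obtain q where q: "coeff q 0 \<noteq> 0" "poly (map_poly to_ac q) x = 0"
    by blast
  obtain c h where ch: "q = pCons c h"
    by (cases q) auto
  have c: "c \<noteq> 0"
    using q(1) by (simp add: ch)
  have "to_ac c + x * poly (map_poly to_ac h) x = 0"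
    using q(2) by (cases "q = 0") (simp_all add: ch map_poly_pCons)
  then have "inverse x = to_ac (- inverse c) * poly (map_poly to_ac h) x"
    using c assms(2) by (simp add: field_simps eq_neg_iff_add_eq_0)
  then show ?thesis
    using mult[OF rat[of "- inverse c"] rat_poly[OF assms(1), of h]] by metis
qed

lemma poly_rel_add: "poly_rel p p' \<Longrightarrow> poly_rel q q' \<Longrightarrow> poly_rel (p + q) (p' + q')"
  by (simp add: poly_rel_def add)

lemma poly_rel_diff: "poly_rel p p' \<Longrightarrow> poly_rel q q' \<Longrightarrow> poly_rel (p - q) (p' - q')"
  by (simp add: poly_rel_def diff)

lemma poly_rel_mult: "poly_rel p p' \<Longrightarrow> poly_rel q q' \<Longrightarrow> poly_rel (p * q) (p' * q')"
  unfolding poly_rel_def coeff_mult by (intro allI sum mult) auto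

lemma poly_rel_monom: "(x, a) \<in> R \<Longrightarrow> poly_rel (monom x n) (monom a n)"
  by (simp add: poly_rel_def zero)

lemma poly_rel_0: "poly_rel 0 p' \<Longrightarrow> p' = 0"
  by (rule poly_eqI) (auto simp: poly_rel_def dest: zeroD)

lemma poly_rel_rat: "poly_rel (map_poly to_ac p) (map_poly of_rat p)"
  by (simp add: poly_rel_def coeff_map_poly rat)

text \<open>A polynomial of least degree over the domain that annihilates x can be made monic by
  \<open>inverse\<close>. It is not constant, and its image keeps the leading coefficient 1, so the
  image has a complex root z.\<close>

lemma minimal_polynomial:
  obtains p p' z where "poly_rel p p'" "Polynomial.lead_coeff p = 1" "poly p x = 0" "poly p' z = 0"
    "\<And>q q'. poly_rel q q' \<Longrightarrow> q \<noteq> 0 \<Longrightarrow> poly q x = 0 \<Longrightarrow> degree p \<le> degree q"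
proof -
  define A where "A = {q. q \<noteq> 0 \<and> poly q x = 0 \<and> (\<exists>q'. poly_rel q q')}"
  obtain f :: "rat poly" where "f \<noteq> 0" "poly (map_poly to_ac f) x = 0"
    using alg_closure_algebraic by blast
  then have "map_poly to_ac f \<in> A"
    unfolding A_def using poly_rel_rat by (auto simp: map_poly_eq_0_iff)
  then obtain q where q: "q \<in> A" "\<And>r. r \<in> A \<Longrightarrow> degree q \<le> degree r"
    using ex_has_least_nat[of "\<lambda>q. q \<in> A" _ degree] by blast
  then obtain q' where q': "poly_rel q q'"
    by (auto simp: A_def)
  let ?l = "Polynomial.lead_coeff q"
  have l: "?l \<noteq> 0"
    using q(1) by (simp add: A_def)
  obtain b where b: "(inverse ?l, b) \<in> R"
    using inverse[of ?l] q' l unfolding poly_rel_def by blast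
  define p p' where "p = monom (inverse ?l) 0 * q" and "p' = monom b 0 * q'"
  have rel: "poly_rel p p'"
    unfolding p_def p'_def by (intro poly_rel_mult poly_rel_monom b q')
  have p: "p = Polynomial.smult (inverse ?l) q"
    by (simp add: p_def monom_0)
  have deg: "degree p = degree q" and lc: "Polynomial.lead_coeff p = 1"
    using l by (simp_all add: p)
  have px: "poly p x = 0"
    using q(1) by (simp add: p A_def)
  have "degree p \<noteq> 0"
  proof
    assume "degree p = 0"
    then obtain c where "p = [:c:]"
      by (rule degree_eq_zeroE)
    then show False
      using lc px by simp
  qed
  moreover have "(1, coeff p' (degree p)) \<in> R"
    using rel lc unfolding poly_rel_def by metis
  then have "coeff p' (degree p) = 1"
    using single_valued[OF _ one] by blast
  then have "degree p \<le> degree p'"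
    by (intro le_degree) simp
  ultimately have "degree p' > 0"
    by simp
  then obtain z where "poly p' z = 0"
    using alg_closed_imp_poly_has_root by blast
  then show ?thesis
    using that[OF rel lc px] q(2) deg by (auto simp: A_def)
qed

text \<open>Adjoins x by sending q(x) to q'(z). This respects zero because q(x) = 0 forces p to
  divide q, so that q'(z) = 0.\<close>

lemma extend: "\<exists>R' z. partial_embedding R' \<and> R \<subseteq> R' \<and> (x, z) \<in> R'"
proof -
  obtain p p' z where p: "poly_rel p p'" "Polynomial.lead_coeff p = 1" "poly p x = 0" "poly p' z = 0"
    and min: "\<And>q q'. poly_rel q q' \<Longrightarrow> q \<noteq> 0 \<Longrightarrow> poly q x = 0 \<Longrightarrow> degree p \<le> degree q"
    by (rule minimal_polynomial[of x]) blast
  \<comment> \<open>Division by the monic p, written as an induction on a strict bound N for the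
    degree: minimality of p allows the top term to be cancelled, in q and q' alike.\<close>
  have vanish: "poly q' z = 0" if "poly_rel q q'" "poly q x = 0" "\<forall>n\<ge>N. coeff q n = 0" for N q q'
    using that
  proof (induction N arbitrary: q q')
    case 0
    then have "q = 0"
      by (simp add: poly_eq_iff)
    with 0 have "q' = 0"
      by (intro poly_rel_0) simp
    then show ?case
      by simp
  next
    case (Suc N)
    show ?case
    proof (cases "coeff q N = 0")
      case True
      then have "\<forall>n\<ge>N. coeff q n = 0"
        using Suc.prems(3) by (metis Suc_leI le_neq_implies_less)
      then show ?thesis
        using Suc.IH Suc.prems by blast
    next
      case False
      have "degree q = N"
        using False Suc.prems(3) by (intro antisym degree_le le_degree) auto
      then have "degree p \<le> N"
        using min[OF Suc.prems(1) _ Suc.prems(2)] False by auto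
      define m where "m = N - degree p"
      let ?c = "coeff q N" and ?c' = "coeff q' N"
      let ?r = "q - monom ?c m * p" and ?r' = "q' - monom ?c' m * p'"
      have "poly_rel ?r ?r'"
        using Suc.prems(1) by (intro poly_rel_diff poly_rel_mult poly_rel_monom p) (simp_all add: poly_rel_def)
      moreover have "poly ?r x = 0"
        using Suc.prems(2) p(3) by simp
      moreover have "coeff ?r n = 0" if n: "n \<ge> N" for n
      proof (cases "n = N")
        case True
        then show ?thesis
          using p(2) \<open>degree p \<le> N\<close> by (simp add: coeff_monom_mult m_def)
      next
        case False
        then have "n - m > degree p" "Suc N \<le> n"
          using n \<open>degree p \<le> N\<close> by (auto simp: m_def)
        then show ?thesis
          using Suc.prems(3) by (simp add: coeff_monom_mult coeff_eq_0)
      qed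
      ultimately have "poly ?r' z = 0"
        using Suc.IH by blast
      then show ?thesis
        using p(4) by simp
    qed
  qed
  define R' where "R' = {(poly q x, poly q' z) | q q'. poly_rel q q'}"
  have inR': "(poly q x, poly q' z) \<in> R'" if "poly_rel q q'" for q q'
    using that by (auto simp: R'_def)
  have sub: "R \<subseteq> R'"
  proof safe
    fix y a assume "(y, a) \<in> R"
    from inR'[OF poly_rel_monom[OF this, of 0]] show "(y, a) \<in> R'"
      by (simp add: monom_0)
  qed
  have "(x, z) \<in> R'"
    using inR'[OF poly_rel_monom[OF one, of 1]] by (simp add: poly_monom)
  moreover have "partial_embedding R'"
    unfolding partial_embedding_def
  proof (intro conjI allI impI)
    show "(to_ac q, of_rat q) \<in> R'" for q
      using rat sub by blast
    fix y a assume "(y, a) \<in> R'"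
    then obtain q q' where q: "y = poly q x" "a = poly q' z" "poly_rel q q'"
      by (auto simp: R'_def)
    {
      fix w b assume "(w, b) \<in> R'"
      then obtain r r' where r: "w = poly r x" "b = poly r' z" "poly_rel r r'"
        by (auto simp: R'_def)
      show "(y + w, a + b) \<in> R'" "(y * w, a * b) \<in> R'"
        using inR'[OF poly_rel_add[OF q(3) r(3)]] inR'[OF poly_rel_mult[OF q(3) r(3)]] by (simp_all add: q r)
    }
  next
    fix a assume "(0, a) \<in> R'"
    then obtain q q' where q: "poly q x = 0" "a = poly q' z" "poly_rel q q'"
      by (auto simp: R'_def)
    show "a = 0"
      unfolding q(2) by (rule vanish[OF q(3,1), of "Suc (degree q)"]) (simp add: coeff_eq_0)
  qed
  ultimately show ?thesis
    using sub by blast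
qed

end

lemma partial_embedding_rat: "partial_embedding {(to_ac q, of_rat q) | q. True}"
  unfolding partial_embedding_def
  by (auto simp: of_rat_add of_rat_mult simp flip: to_ac_add to_ac_mult)

lemma partial_embedding_Union:
  assumes "C \<noteq> {}" "\<And>R. R \<in> C \<Longrightarrow> partial_embedding R" "\<And>R S. R \<in> C \<Longrightarrow> S \<in> C \<Longrightarrow> R \<subseteq> S \<or> S \<subseteq> R"
  shows "partial_embedding (\<Union>C)"
  unfolding partial_embedding_def
proof (intro conjI allI impI)
  show "(to_ac q, of_rat q) \<in> \<Union>C" for q
    using assms(1,2) by (auto simp: partial_embedding_def)
  show "a = 0" if "(0, a) \<in> \<Union>C" for a
    using that assms(2) by (auto simp: partial_embedding_def)
  fix x a y b assume "(x, a) \<in> \<Union>C" "(y, b) \<in> \<Union>C"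
  then obtain R S where "R \<in> C" "S \<in> C" "(x, a) \<in> R" "(y, b) \<in> S"
    by blast
  then obtain T where T: "T \<in> C" "(x, a) \<in> T" "(y, b) \<in> T"
    using assms(3)[of R S] by blast
  then have "(x + y, a + b) \<in> T \<and> (x * y, a * b) \<in> T"
    using assms(2) unfolding partial_embedding_def by blast
  then show "(x + y, a + b) \<in> \<Union>C" "(x * y, a * b) \<in> \<Union>C"
    using T(1) by blast+
qed

text \<open>A maximal partial embedding is total, since \<open>extend\<close> would enlarge any
  other.\<close>

lemma qbar_embedding:
  obtains \<iota> :: "qbar \<Rightarrow> complex" where "ring_map \<iota>" "inj \<iota>" "\<And>q. \<iota> (to_ac q) = of_rat q"
proof -
  let ?\<A> = "{R. partial_embedding R}"
  have "\<exists>M\<in>?\<A>. \<forall>S\<in>?\<A>. M \<subseteq> S \<longrightarrow> S = M"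
  proof (rule subset_Zorn_nonempty)
    show "?\<A> \<noteq> {}"
      using partial_embedding_rat by blast
    fix C assume "C \<noteq> {}" "subset.chain ?\<A> C"
    then show "\<Union>C \<in> ?\<A>"
      using partial_embedding_Union[of C] by (auto simp: subset_chain_def)
  qed
  then obtain M where M: "partial_embedding M" "\<And>S. partial_embedding S \<Longrightarrow> M \<subseteq> S \<Longrightarrow> S = M"
    by blast
  interpret partial_embedding M
    by (rule M(1))
  have total: "\<exists>z. (x, z) \<in> M" for x
    using extend[of x] M(2) by blast
  define \<iota> where "\<iota> x = (SOME z. (x, z) \<in> M)" for x
  have graph: "(x, \<iota> x) \<in> M" for x
    unfolding \<iota>_def using total by (rule someI_ex)
  have eqI: "\<iota> x = z" if "(x, z) \<in> M" for x z
    using single_valued[OF graph that] .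
  have rm: "ring_map \<iota>"
    by (rule ring_mapI) (auto intro!: eqI intro: one add mult graph)
  have "inj \<iota>"
  proof (rule injI, rule ccontr)
    fix x y assume eq: "\<iota> x = \<iota> y" and ne: "x \<noteq> y"
    have "\<iota> (x - y) * \<iota> (inverse (x - y)) = 1"
      using ne by (simp add: ring_map_1[OF rm] flip: ring_map_mult[OF rm])
    moreover have "\<iota> (x - y) = 0"
      using eq by (simp add: ring_map_diff[OF rm])
    ultimately show False
      by simp
  qed
  then show ?thesis
    using that rm eqI[OF rat] by blast
qed

section \<open>Transport of complex conjugation to the algebraic numbers\<close>

lemma poly_map_poly_linear_factor:
  fixes h :: "'a::field \<Rightarrow> 'b::field"
  assumes h: "ring_map h"
  shows "poly (map_poly h ([:- r, 1:] * p)) w = (w - h r) * poly (map_poly h p) w"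
proof -
  have h0 [simp]: "h 0 = 0"
    by (rule ring_map_0[OF h])
  have add: "map_poly h (p + q) = map_poly h p + map_poly h q" for p q
    by (rule poly_eqI) (simp add: coeff_map_poly ring_map_add[OF h])
  have smult: "map_poly h (Polynomial.smult c p) = Polynomial.smult (h c) (map_poly h p)" for c p
    by (rule poly_eqI) (simp add: coeff_map_poly ring_map_mult[OF h])
  have "[:- r, 1:] * p = pCons 0 p + Polynomial.smult (- r) p"
    by simp
  then show ?thesis
    by (simp only: add smult) (simp add: map_poly_pCons ring_map_uminus[OF h] algebra_simps)
qed

text \<open>p splits into linear factors over its algebraically closed field, so every root of its
  image is the image of a root of p.\<close>

lemma roots_in_range:
  fixes p :: "'a::alg_closed_field poly" and h :: "'a \<Rightarrow> 'b::field"
  assumes h: "ring_map h" and "p \<noteq> 0" "poly (map_poly h p) w = 0"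
  shows "w \<in> Set.range h"
  using assms(2,3)
proof (induction "degree p" arbitrary: p)
  case 0
  then obtain c where c: "p = [:c:]" "c \<noteq> 0"
    by (metis degree_0_id pCons_0_0)
  then have "h c = 0"
    using 0 by (simp add: map_poly_pCons ring_map_0[OF h])
  moreover have "h c * h (inverse c) = 1"
    using c by (simp add: ring_map_1[OF h] flip: ring_map_mult[OF h])
  ultimately show ?case
    by simp
next
  case (Suc n)
  then obtain r where "poly p r = 0"
    using alg_closed_imp_poly_has_root[of p] by auto
  then obtain q where q: "p = [:- r, 1:] * q"
    by (auto simp: poly_eq_0_iff_dvd dvd_def)
  then have "q \<noteq> 0"
    using Suc.prems(1) by auto
  then have "n = degree q"
    using Suc.hyps(2) unfolding q by (subst (asm) degree_mult_eq) auto
  moreover have "w = h r \<or> poly (map_poly h q) w = 0"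
    using Suc.prems(2) unfolding q poly_map_poly_linear_factor[OF h] by simp
  ultimately show ?case
    using Suc.hyps(1) \<open>q \<noteq> 0\<close> by blast
qed

text \<open>The complex conjugate of an embedded element is a root of the same rational polynomial,
  whose roots all lie in the range of the embedding. Hence \<open>cnj\<close> restricts to the range
  and can be pulled back.\<close>

lemma complex_conjugation_exists:
  obtains \<kappa> :: "qbar \<Rightarrow> qbar" where "real_structure \<kappa>" "\<kappa> \<in> carrier galois_group"
proof -
  obtain \<iota> :: "qbar \<Rightarrow> complex" where \<iota>: "ring_map \<iota>" "inj \<iota>" "\<And>q. \<iota> (to_ac q) = of_rat q"
    using qbar_embedding by blast
  have \<iota>_eq [simp]: "\<iota> x = \<iota> y \<longleftrightarrow> x = y" for x y
    using \<iota>(2) by (auto simp: inj_def)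
  note \<iota>_simps = ring_map_simps[OF \<iota>(1)]
  have "\<exists>y. \<iota> y = cnj (\<iota> x)" for x
  proof -
    obtain p :: "rat poly" where p: "p \<noteq> 0" "poly (map_poly to_ac p) x = 0"
      using alg_closure_algebraic by blast
    have ev: "poly (map_poly \<iota> (map_poly to_ac q)) (\<iota> y) = \<iota> (poly (map_poly to_ac q) y)" for q y
      by (induction q) (simp_all add: map_poly_pCons \<iota>_simps)
    have cn: "poly (map_poly \<iota> (map_poly to_ac q)) (cnj w) = cnj (poly (map_poly \<iota> (map_poly to_ac q)) w)" for q w
    proof (induction q)
      case (pCons a q)
      have "cnj (of_rat a) = of_rat a"
        by (cases a) (simp add: of_rat_rat)
      then show ?case
        using pCons by (simp add: map_poly_pCons \<iota>_simps \<iota>(3))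
    qed simp
    have "poly (map_poly \<iota> (map_poly to_ac p)) (cnj (\<iota> x)) = 0"
      by (simp add: cn ev p(2) \<iota>_simps)
    moreover have "map_poly to_ac p \<noteq> 0"
      using p(1) by (simp add: map_poly_eq_0_iff)
    ultimately have "cnj (\<iota> x) \<in> Set.range \<iota>"
      using roots_in_range[OF \<iota>(1)] by blast
    then show ?thesis
      by auto
  qed
  then obtain \<kappa> where \<kappa>: "\<And>x. \<iota> (\<kappa> x) = cnj (\<iota> x)"
    by metis
  have rm: "ring_map \<kappa>"
    by (rule ring_mapI; subst \<iota>_eq[symmetric]) (simp_all add: \<kappa> \<iota>_simps)
  have inv: "\<kappa> (\<kappa> x) = x" for x
    by (subst \<iota>_eq[symmetric]) (simp add: \<kappa>)
  have real: "\<kappa> x = x \<longleftrightarrow> \<iota> x \<in> \<real>" for x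
    by (subst \<iota>_eq[symmetric]) (simp only: \<kappa> Reals_cnj_iff)
  have "real_structure \<kappa>"
  proof
    fix u :: qbar assume "u\<^sup>2 = -1"
    then have "(\<iota> u)\<^sup>2 = -1"
      by (metis \<iota>_simps)
    then have "\<iota> u = \<i> \<or> \<iota> u = - \<i>"
      by (metis power2_eq_iff power2_i)
    then have "\<iota> (\<kappa> u) = \<iota> (- u)"
      by (auto simp: \<kappa> \<iota>_simps)
    then show "\<kappa> u = - u"
      by simp
  next
    fix c assume "\<kappa> c = c"
    then obtain r where r: "\<iota> c = of_real r"
      unfolding real by (auto elim: Reals_cases)
    \<comment> \<open>Both complex square roots of a nonnegative real number are real, so any square
      root d of e in \<open>qbar\<close> is fixed.\<close>
    have sqrt: "\<exists>d. \<kappa> d = d \<and> d\<^sup>2 = e" if e: "\<iota> e = of_real t" "t \<ge> 0" for e t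
    proof -
      obtain d where d: "d\<^sup>2 = e"
        using nth_root_exists[of 2 e] by auto
      have "(\<iota> d)\<^sup>2 = (of_real (sqrt t))\<^sup>2"
        using e by (simp add: d ring_map_power[OF \<iota>(1), symmetric] flip: of_real_power)
      then have "\<iota> d \<in> \<real>"
        by (auto simp: power2_eq_iff)
      then show ?thesis
        using d real by blast
    qed
    have "\<iota> (- c) = of_real (- r)"
      by (simp add: \<iota>_simps r)
    then show "\<exists>d. \<kappa> d = d \<and> (d\<^sup>2 = c \<or> d\<^sup>2 = - c)"
      using sqrt[OF r] sqrt[of "- c" "- r"] by (cases "r \<ge> 0") auto
  next
    fix a b assume "\<kappa> a = a" "\<kappa> b = b"
    then obtain s t where st: "\<iota> a = of_real s" "\<iota> b = of_real t"
      unfolding real by (metis Reals_cases)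
    show "1 + a ^ 4 + b ^ 4 \<noteq> 0"
    proof
      assume "1 + a ^ 4 + b ^ 4 = 0"
      then have "\<iota> (1 + a ^ 4 + b ^ 4) = 0"
        by (simp only: \<iota>_simps)
      then have "complex_of_real (1 + s ^ 4 + t ^ 4) = 0"
        by (simp add: \<iota>_simps st)
      then have "1 + s ^ 4 + t ^ 4 = 0"
        by (simp only: of_real_eq_0_iff)
      moreover have "s ^ 4 \<ge> 0" "t ^ 4 \<ge> 0"
        by simp_all
      ultimately show False
        by linarith
    qed
  qed (use rm inv in auto)
  moreover have "\<kappa> (to_ac q) = to_ac q" for q
  proof -
    have "cnj (of_rat q) = of_rat q"
      by (cases q) (simp add: of_rat_rat)
    then show ?thesis
      by (subst \<iota>_eq[symmetric]) (simp add: \<kappa> \<iota>(3))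
  qed
  then have "\<kappa> \<in> carrier galois_group"
    using ring_map_add[OF rm] ring_map_mult[OF rm] inv
    by (auto simp: galois_group_def intro!: o_bij[of \<kappa>] simp: fun_eq_iff)
  ultimately show ?thesis
    using that by blast
qed


section \<open>Divisor classes\<close>

lemma base_change_fermat: "base_change Q = Q"
proof (rule poly_mapping_eqI)
  have F: "(Q :: 'b::comm_ring_1 ternary) = Poly_Mapping.single (Poly_Mapping.single 1 4) 1
    + Poly_Mapping.single (Poly_Mapping.single 2 4) 1 + Poly_Mapping.single (Poly_Mapping.single 3 4) 1"
    unfolding fermat_quartic_def tvar_power ..
  fix m
  have "lookup (base_change Q) m = to_ac (lookup Q m)"
    unfolding base_change_def by (simp add: map.rep_eq when_def)
  also have "\<dots> = lookup Q m"
    unfolding F by (simp add: lookup_add lookup_single when_def)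
  finally show "lookup (base_change Q) m = lookup Q m" .
qed

abbreviation on_curve :: "(('a::field ^ 3) set \<Rightarrow>\<^sub>0 int) \<Rightarrow> bool" where
  "on_curve D \<equiv> keys D \<subseteq> curve"

abbreviation class_sum :: "((qbar ^ 3) set \<Rightarrow>\<^sub>0 int) set \<Rightarrow> ((qbar ^ 3) set \<Rightarrow>\<^sub>0 int) set
    \<Rightarrow> ((qbar ^ 3) set \<Rightarrow>\<^sub>0 int) set" (infixl \<open>\<star>\<close> 70) where
  "x \<star> y \<equiv> x \<otimes>\<^bsub>divisor_class_group Q\<^esub> y"

lemma divisor_degree_superset:
  "finite S \<Longrightarrow> keys D \<subseteq> S \<Longrightarrow> divisor_degree D = (\<Sum>P\<in>S. lookup D P)"
  unfolding divisor_degree_def by (intro sum.mono_neutral_left) (auto simp: in_keys_iff)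

lemma divisor_degree_add: "divisor_degree (D + E) = divisor_degree D + divisor_degree E"
  using divisor_degree_superset[of "keys D \<union> keys E"] keys_add[of D E]
  by (simp add: lookup_add sum.distrib)

lemma divisor_degree_0 [simp]: "divisor_degree 0 = 0"
  by (simp add: divisor_degree_def)

lemma divisor_degree_uminus: "divisor_degree (- D) = - divisor_degree D"
  using divisor_degree_add[of D "- D"] by simp

lemma divisor_degree_diff: "divisor_degree (D - E) = divisor_degree D - divisor_degree E"
  using divisor_degree_add[of D "- E"] by (simp add: divisor_degree_uminus)

lemma divisor_degree_cmul_of: "divisor_degree (frag_cmul n (frag_of P)) = n"
  using divisor_degree_superset[of "{P}" "frag_cmul n (frag_of P)"] keys_cmul[of n "frag_of P"]
  by (simp add: keys_frag_of)

lemma divisor_degree_frag_extend: "divisor_degree (frag_extend (\<lambda>P. frag_of (g P)) D) = divisor_degree D"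
proof -
  have "keys D \<subseteq> UNIV"
    by simp
  then show ?thesis
  proof (induction D rule: frag_induction)
    case (one x)
    then show ?case
      using divisor_degree_cmul_of[of 1 x] divisor_degree_cmul_of[of 1 "g x"] by simp
  qed (simp_all add: frag_extend_diff divisor_degree_diff)
qed

lemma lookup_frag_extend_inj:
  assumes "inj_on g S" "keys D \<subseteq> S" "P \<in> S"
  shows "lookup (frag_extend (\<lambda>P. frag_of (g P)) D) (g P) = lookup D P"
  using assms(2)
proof (induction D rule: frag_induction)
  case (one x)
  then show ?case
    using assms(1,3) by (auto simp: inj_on_eq_iff)
qed (simp_all add: frag_extend_diff lookup_minus)

section \<open>Galois action on divisors\<close>

context
  fixes \<sigma> :: "qbar \<Rightarrow> qbar"
  assumes \<sigma>: "\<sigma> \<in> carrier galois_group"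
begin

lemma galois_symmetry: "symmetry \<sigma> (\<lambda>_. 1)"
proof -
  have "\<sigma> (to_ac q) = to_ac q" for q
    using \<sigma> by (simp add: galois_group_def)
  from this[of 1] have "\<sigma> 1 = 1"
    by simp
  then have "ring_map \<sigma>"
    using \<sigma> by (intro ring_mapI) (simp_all add: galois_group_def)
  then show ?thesis
    using \<sigma> by unfold_locales (simp_all add: galois_group_def)
qed

lemma galois_point_eq: "galois_point \<sigma> = twist_point \<sigma> (\<lambda>_. 1)"
  by (simp add: galois_point_def twist_point_def fun_eq_iff)

lemma inj_galois_point: "inj_on (galois_point \<sigma>) (curve)"
  unfolding galois_point_eq by (rule symmetry.inj_twist_point[OF galois_symmetry])

lemma galois_point_image: "galois_point \<sigma> ` curve = curve"
proof -
  interpret symmetry \<sigma> "\<lambda>_. 1"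
    by (rule galois_symmetry)
  \<comment> \<open>The zero form vanishes on the whole curve, so \<open>zeros_twist\<close> for it
    says that the curve is mapped onto itself.\<close>
  have "zeros (0 :: qbar ternary) = curve"
    by (auto simp: zeros_def vanishes_at_def teval_simps)
  then show ?thesis
    using zeros_twist[of 0] by (simp add: galois_point_eq ring_map_0[OF ring_map_twist[OF ring_map_s]])
qed

lemma galois_divisor_keys:
  assumes "on_curve D"
  shows "on_curve (galois_divisor \<sigma> D)"
proof -
  have "keys (galois_divisor \<sigma> D) \<subseteq> galois_point \<sigma> ` keys D"
    unfolding galois_divisor_def
    using keys_frag_extend[of "\<lambda>P. frag_of (galois_point \<sigma> P)" D] by (auto simp: keys_frag_of)
  also have "\<dots> \<subseteq> galois_point \<sigma> ` curve"
    using assms by (rule image_mono)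
  finally show ?thesis
    unfolding galois_point_image .
qed

lemma lookup_galois_divisor:
  "on_curve D \<Longrightarrow> P \<in> curve \<Longrightarrow>
    lookup (galois_divisor \<sigma> D) (galois_point \<sigma> P) = lookup D P"
  unfolding galois_divisor_def by (rule lookup_frag_extend_inj[OF inj_galois_point])

lemma galois_divisor_principal:
  assumes "D \<in> principal_divisors Q"
  shows "galois_divisor \<sigma> D \<in> principal_divisors Q"
proof -
  interpret symmetry \<sigma> "\<lambda>_. 1"
    by (rule galois_symmetry)
  obtain e F G where D: "on_curve D"
    and FG: "homogeneous e F" "homogeneous e G" "\<not> Q dvd F" "\<not> Q dvd G"
    and l: "\<forall>P\<in>curve. lookup D P = int (val P F) - int (val P G)"
    using assms unfolding principal_divisors_iff by blast
  let ?t = "twist \<sigma> (\<lambda>_. 1)"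
  have "lookup (galois_divisor \<sigma> D) P = int (val P (?t F)) - int (val P (?t G))"
    if P: "P \<in> curve" for P
  proof -
    obtain R where R: "R \<in> curve" "P = galois_point \<sigma> R"
      using P galois_point_image by blast
    then show ?thesis
      using lookup_galois_divisor[OF D R(1)] l val_twist[OF R(1) FG(1)] val_twist[OF R(1) FG(2)]
      by (simp add: galois_point_eq)
  qed
  moreover have "homogeneous e (?t F)" "homogeneous e (?t G)"
    using FG homogeneous_twist[OF ring_map_s] by blast+
  moreover have "\<not> Q dvd ?t F" "\<not> Q dvd ?t G"
    using FG by (simp_all add: dvd_twist_iff)
  ultimately show ?thesis
    using galois_divisor_keys[OF D] unfolding principal_divisors_iff by blast
qed

lemma galois_inverse: "inv_into UNIV \<sigma> \<in> carrier galois_group"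
proof -
  interpret symmetry \<sigma> "\<lambda>_. 1"
    by (rule galois_symmetry)
  interpret I: symmetry "inv_into UNIV \<sigma>" "\<lambda>_. inv_into UNIV \<sigma> (1 / 1)"
    by (rule symmetry_inverse)
  have "inv_into UNIV \<sigma> (to_ac q) = to_ac q" for q
    using \<sigma> bij_s by (intro inv_f_eq) (simp_all add: galois_group_def bij_is_inj)
  then show ?thesis
    using I.bij_s ring_map_add[OF I.ring_map_s] ring_map_mult[OF I.ring_map_s] by (simp add: galois_group_def)
qed

end

lemma galois_divisor_add: "galois_divisor \<sigma> (D + E) = galois_divisor \<sigma> D + galois_divisor \<sigma> E"
  by (simp add: galois_divisor_def frag_extend_add)

lemma galois_divisor_0: "galois_divisor \<sigma> 0 = 0"
  by (simp add: galois_divisor_def)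

lemma galois_divisor_comp: "galois_divisor (\<sigma> \<circ> \<tau>) D = galois_divisor \<sigma> (galois_divisor \<tau> D)"
proof -
  have "galois_point (\<sigma> \<circ> \<tau>) P = galois_point \<sigma> (galois_point \<tau> P)" for P
    by (simp add: galois_point_def image_image)
  then show ?thesis
    using frag_extend_compose[of "\<lambda>P. frag_of (galois_point \<sigma> P)" "galois_point \<tau>" D]
    by (simp add: galois_divisor_def o_def)
qed

lemma galois_divisor_id: "galois_divisor id D = D"
proof -
  have "galois_point id = (\<lambda>P. P)"
    by (simp add: galois_point_def fun_eq_iff)
  then have "galois_divisor id D = frag_extend frag_of D"
    by (simp add: galois_divisor_def)
  then show ?thesis
    by (simp only: frag_expansion[symmetric])
qed

lemma galois_divisor_inverse:
  assumes "\<sigma> \<in> carrier galois_group"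
  shows "galois_divisor \<sigma> (galois_divisor (inv_into UNIV \<sigma>) D) = D"
proof -
  have "\<sigma> \<circ> inv_into UNIV \<sigma> = id"
    using assms by (simp add: galois_group_def bij_is_surj surj_iff[symmetric])
  then show ?thesis
    unfolding galois_divisor_comp[symmetric] by (simp add: galois_divisor_id)
qed


section \<open>Divisor classes and the torsor structure\<close>

context
  fixes G :: "((qbar ^ 3) set \<Rightarrow>\<^sub>0 int) monoid" and N :: "((qbar ^ 3) set \<Rightarrow>\<^sub>0 int) set"
    and cl :: "((qbar ^ 3) set \<Rightarrow>\<^sub>0 int) \<Rightarrow> ((qbar ^ 3) set \<Rightarrow>\<^sub>0 int) set"
  defines "G \<equiv> divisor_group Q" and "N \<equiv> principal_divisors Q"
    and "cl \<equiv> \<lambda>D. N #>\<^bsub>G\<^esub> D"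
begin

lemma subgroup_principal: "subgroup N G"
proof (rule subgroup.intro)
  show "N \<subseteq> carrier G"
    by (auto simp: N_def G_def principal_divisors_def)
next
  fix D E assume "D \<in> N" "E \<in> N"
  then obtain e F H e' F' H' where
    D: "on_curve D"
    and FH: "homogeneous e F" "homogeneous e H" "\<not> Q dvd F" "\<not> Q dvd H"
    and l: "\<forall>P\<in>curve. lookup D P = int (val P F) - int (val P H)"
    and E: "on_curve E"
    and FH': "homogeneous e' F'" "homogeneous e' H'" "\<not> Q dvd F'" "\<not> Q dvd H'"
    and l': "\<forall>P\<in>curve. lookup E P = int (val P F') - int (val P H')"
    unfolding N_def principal_divisors_iff by blast
  have "on_curve (D + E)"
    using D E keys_add[of D E] by blast
  moreover have "homogeneous (e + e') (F * F')" "homogeneous (e + e') (H * H')"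
    using FH FH' homogeneous_mult by blast+
  moreover have "\<not> Q dvd F * F'" "\<not> Q dvd H * H'"
    using fermat_prime[OF FH(1) FH'(1)] fermat_prime[OF FH(2) FH'(2)] FH FH' by blast+
  moreover have "\<forall>P\<in>curve.
      lookup (D + E) P = int (val P (F * F')) - int (val P (H * H'))"
    using l l' by (simp add: lookup_add val_mult[OF _ FH(1) FH'(1) FH(3) FH'(3)] val_mult[OF _ FH(2) FH'(2) FH(4) FH'(4)])
  ultimately show "D \<otimes>\<^bsub>G\<^esub> E \<in> N"
    unfolding N_def principal_divisors_iff G_def mult_free_Abelian_group by blast
next
  have "\<not> Q dvd (1 :: qbar ternary)"
    by (rule fermat_not_dvd_1)
  then show "\<one>\<^bsub>G\<^esub> \<in> N"
    unfolding N_def principal_divisors_iff G_def one_free_Abelian_group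
    by (intro conjI exI[of _ 0] exI[of _ 1]) simp_all
next
  fix D assume "D \<in> N"
  then obtain e F H where
    D: "on_curve D"
    and FH: "homogeneous e F" "homogeneous e H" "\<not> Q dvd F" "\<not> Q dvd H"
    and l: "\<forall>P\<in>curve. lookup D P = int (val P F) - int (val P H)"
    unfolding N_def principal_divisors_iff by blast
  have "\<forall>P\<in>curve. lookup (- D) P = int (val P H) - int (val P F)"
    using l by simp
  then have "- D \<in> N"
    unfolding N_def principal_divisors_iff keys_minus using D FH by blast
  then show "inv\<^bsub>G\<^esub> D \<in> N"
    using D by (simp add: G_def)
qed

lemma normal_principal: "N \<lhd> G"
  unfolding G_def
  by (rule comm_group.subgroup_imp_normal[OF abelian_free_Abelian_group subgroup_principal[unfolded G_def]])

lemma cl_eq_image: "cl D = (\<lambda>E. E + D) ` N"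
  unfolding cl_def r_coset_def by (auto simp: G_def)

lemma cl_mult:
  assumes "on_curve D" "on_curve E"
  shows "cl D \<star> cl E = cl (D + E)"
proof -
  interpret normal N G
    by (rule normal_principal)
  show ?thesis
    using rcos_sum[of D E] assms
    unfolding divisor_class_group_def FactGroup_def cl_def by (simp add: G_def N_def)
qed

lemma cl_0: "\<one>\<^bsub>divisor_class_group Q\<^esub> = cl 0"
  by (simp add: divisor_class_group_def FactGroup_def cl_eq_image N_def)

lemma cl_eq_iff: "cl D = cl E \<longleftrightarrow> D - E \<in> N"
proof -
  have add: "x + y \<in> N" if "x \<in> N" "y \<in> N" for x y
    using subgroup.m_closed[OF subgroup_principal that] by (simp add: G_def)
  have neg: "- x \<in> N" if "x \<in> N" for x
    using subgroup.m_inv_closed[OF subgroup_principal that] subgroup.subset[OF subgroup_principal] that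
    by (auto simp: G_def)
  have zero: "0 \<in> N"
    using subgroup.one_closed[OF subgroup_principal] by (simp add: G_def)
  show ?thesis
  proof
    assume eq: "cl D = cl E"
    have "D \<in> cl D"
      unfolding cl_eq_image using zero by (intro image_eqI[of _ _ 0]) simp_all
    then have "D \<in> cl E"
      unfolding eq .
    from this[unfolded cl_eq_image] obtain x where "D = x + E" "x \<in> N"
      by (rule imageE)
    then show "D - E \<in> N"
      by simp
  next
    have sub: "cl D \<subseteq> cl E" if "D - E \<in> N" for D E
    proof
      fix y assume "y \<in> cl D"
      from this[unfolded cl_eq_image] obtain x where x: "y = x + D" "x \<in> N"
        by (rule imageE)
      have "y = (x + (D - E)) + E"
        by (simp add: x)
      moreover have "x + (D - E) \<in> N"
        by (rule add[OF x(2) that])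
      ultimately show "y \<in> cl E"
        unfolding cl_eq_image by (rule image_eqI)
    qed
    assume DE: "D - E \<in> N"
    moreover have "E - D \<in> N"
      using neg[OF DE] by simp
    ultimately show "cl D = cl E"
      using sub by blast
  qed
qed

text \<open>An automorphism maps the principal divisors into themselves, and the inverse
  automorphism shows that it maps them onto themselves; so cosets go to cosets.\<close>

lemma galois_class_cl:
  assumes "\<sigma> \<in> carrier galois_group"
  shows "galois_class \<sigma> (cl D) = cl (galois_divisor \<sigma> D)"
proof -
  have "galois_divisor \<sigma> ` N = N"
  proof
    show "galois_divisor \<sigma> ` N \<subseteq> N"
      using galois_divisor_principal[OF assms] by (auto simp: N_def)
    show "N \<subseteq> galois_divisor \<sigma> ` N"
    proof
      fix E assume "E \<in> N"
      then have "galois_divisor (inv_into UNIV \<sigma>) E \<in> N"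
        using galois_divisor_principal[OF galois_inverse[OF assms]] by (simp add: N_def)
      then show "E \<in> galois_divisor \<sigma> ` N"
        using galois_divisor_inverse[OF assms, of E] by (intro image_eqI[of E]) simp_all
    qed
  qed
  then have "cl (galois_divisor \<sigma> D) = (\<lambda>E. E + galois_divisor \<sigma> D) ` galois_divisor \<sigma> ` N"
    by (simp add: cl_eq_image)
  then show ?thesis
    by (simp add: galois_class_def cl_eq_image image_image galois_divisor_add)
qed

lemma pic_points_eq:
  "pic_points Q m = {cl D | D. on_curve D \<and> divisor_degree D = m}"
  by (simp add: pic_points_def base_change_fermat divisor_classes_of_degree_def cl_def N_def G_def)

lemma pic_points_mult:
  assumes "x \<in> pic_points Q m" "y \<in> pic_points Q n"
  shows "x \<star> y \<in> pic_points Q (m + n)"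
proof -
  obtain D E where D: "x = cl D" "on_curve D" "divisor_degree D = m"
    and E: "y = cl E" "on_curve E" "divisor_degree E = n"
    using assms unfolding pic_points_eq by blast
  have "on_curve (D + E)"
    using D E keys_add[of D E] by blast
  moreover have "divisor_degree (D + E) = m + n"
    using D E by (simp add: divisor_degree_add)
  ultimately show ?thesis
    unfolding pic_points_eq D(1) E(1) cl_mult[OF D(2) E(2)] by blast
qed

lemma pic_points_galois:
  assumes "\<sigma> \<in> carrier galois_group" "x \<in> pic_points Q m"
  shows "galois_class \<sigma> x \<in> pic_points Q m"
proof -
  obtain D where D: "x = cl D" "on_curve D" "divisor_degree D = m"
    using assms(2) unfolding pic_points_eq by blast
  have "divisor_degree (galois_divisor \<sigma> D) = m"
    using D(3) by (simp add: galois_divisor_def divisor_degree_frag_extend)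
  then show ?thesis
    unfolding pic_points_eq D(1) galois_class_cl[OF assms(1)] using galois_divisor_keys[OF assms(1) D(2)] by blast
qed

lemma pic_points_mult_assoc:
  assumes "x \<in> pic_points Q l" "y \<in> pic_points Q m" "z \<in> pic_points Q n"
  shows "x \<star> y \<star> z =
    x \<star> (y \<star> z)"
proof -
  obtain D E F where D: "x = cl D" "on_curve D"
    and E: "y = cl E" "on_curve E"
    and F: "z = cl F" "on_curve F"
    using assms unfolding pic_points_eq by blast
  have "on_curve (D + E)" "on_curve (E + F)"
    using D E F keys_add[of D E] keys_add[of E F] by blast+
  then show ?thesis
    using D E F by (simp add: cl_mult add.assoc)
qed

lemma pic_points_mult_comm:
  assumes "x \<in> pic_points Q m" "y \<in> pic_points Q n"
  shows "x \<star> y = y \<star> x"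
proof -
  obtain D E where "x = cl D" "on_curve D"
    "y = cl E" "on_curve E"
    using assms unfolding pic_points_eq by blast
  then show ?thesis
    by (simp add: cl_mult add.commute)
qed

lemma pic_points_one: "\<one>\<^bsub>divisor_class_group Q\<^esub> \<in> pic_points Q 0"
  unfolding cl_0 pic_points_eq by (intro CollectI exI[of _ 0]) simp

lemma pic_points_one_mult:
  assumes "x \<in> pic_points Q m"
  shows "\<one>\<^bsub>divisor_class_group Q\<^esub> \<star> x = x"
  using assms unfolding pic_points_eq cl_0 by (auto simp: cl_mult)

lemma pic_points_galois_mult:
  assumes "\<sigma> \<in> carrier galois_group" "x \<in> pic_points Q m" "y \<in> pic_points Q n"
  shows "galois_class \<sigma> (x \<star> y) =
    galois_class \<sigma> x \<star> galois_class \<sigma> y"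
proof -
  obtain D E where "x = cl D" "on_curve D"
    "y = cl E" "on_curve E"
    using assms unfolding pic_points_eq by blast
  then show ?thesis
    using galois_divisor_keys[OF assms(1)] by (simp add: cl_mult galois_class_cl[OF assms(1)] galois_divisor_add)
qed

lemma galois_class_comp: "galois_class (\<sigma> \<otimes>\<^bsub>galois_group\<^esub> \<tau>) x = galois_class \<sigma> (galois_class \<tau> x)"
  by (simp add: galois_group_def galois_class_def image_image galois_divisor_comp)

lemma galois_class_one: "galois_class \<one>\<^bsub>galois_group\<^esub> x = x"
  by (simp add: galois_group_def galois_class_def galois_divisor_id)

text \<open>For m = n this is simple transitivity of the Jacobian; with both degrees 0 and y the
  neutral class it also provides the inverses in the Jacobian.\<close>

lemma pic_points_transitive:
  assumes "x \<in> pic_points Q m" "y \<in> pic_points Q n"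
  shows "\<exists>!a. a \<in> pic_points Q (n - m) \<and> a \<star> x = y"
proof -
  obtain D E where D: "x = cl D" "on_curve D" "divisor_degree D = m"
    and E: "y = cl E" "on_curve E" "divisor_degree E = n"
    using assms unfolding pic_points_eq by blast
  have k: "on_curve (E - D)"
    using D E keys_diff[of E D] by blast
  have deg: "divisor_degree (E - D) = n - m"
    using D E by (simp add: divisor_degree_diff)
  show ?thesis
  proof (rule ex1I[of _ "cl (E - D)"])
    show "cl (E - D) \<in> pic_points Q (n - m) \<and> cl (E - D) \<star> x = y"
    proof
      show "cl (E - D) \<in> pic_points Q (n - m)"
        unfolding pic_points_eq using k deg by blast
      show "cl (E - D) \<star> x = y"
        using k D E by (simp add: cl_mult)
    qed
    fix a assume a: "a \<in> pic_points Q (n - m) \<and> a \<star> x = y"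
    then obtain A where A: "a = cl A" "on_curve A"
      unfolding pic_points_eq by blast
    then have "cl (A + D) = cl E"
      using a D E by (simp add: cl_mult)
    then have "A + D - E \<in> N"
      by (simp only: cl_eq_iff)
    then show "a = cl (E - D)"
      unfolding A(1) cl_eq_iff by (simp add: algebra_simps)
  qed
qed

lemma jacobian_simps:
  "carrier (jacobian Q) = pic_points Q 0"
  "a \<otimes>\<^bsub>jacobian Q\<^esub> b = a \<star> b"
  "\<one>\<^bsub>jacobian Q\<^esub> = \<one>\<^bsub>divisor_class_group Q\<^esub>"
  by (simp_all add: jacobian_def base_change_fermat)

lemma comm_group_jacobian: "comm_group (jacobian Q)"
proof (rule comm_groupI; unfold jacobian_simps)
  fix x assume x: "x \<in> pic_points Q 0"
  show "\<exists>y\<in>pic_points Q 0. y \<star> x = \<one>\<^bsub>divisor_class_group Q\<^esub>"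
    using pic_points_transitive[OF x pic_points_one] by auto
  show "\<one>\<^bsub>divisor_class_group Q\<^esub> \<star> x = x"
    by (rule pic_points_one_mult[OF x])
  fix y assume y: "y \<in> pic_points Q 0"
  show "x \<star> y \<in> pic_points Q 0"
    using pic_points_mult[OF x y] by simp
  show "x \<star> y = y \<star> x"
    by (rule pic_points_mult_comm[OF x y])
  fix z assume z: "z \<in> pic_points Q 0"
  show "x \<star> y \<star> z =
    x \<star> (y \<star> z)"
    by (rule pic_points_mult_assoc[OF x y z])
qed (rule pic_points_one)

lemma pic_points_nonempty: "pic_points Q m \<noteq> {}"
proof -
  obtain r :: qbar where r: "r ^ 4 = -1"
    using fourth_root_exists by blast
  have ch: "chart 1 2 3 r 0"
    by unfold_locales (use r in auto)
  let ?P = "proj_pt (chart.pt 1 2 r 0)"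
  have "?P \<in> curve"
    by (rule val_proj_pt_chart(1)[OF ch homogeneous_0])
  then have "on_curve (frag_cmul m (frag_of ?P))"
    using keys_cmul[of m "frag_of ?P"] by (auto simp: keys_frag_of)
  then have "cl (frag_cmul m (frag_of ?P)) \<in> pic_points Q m"
    unfolding pic_points_eq
    by (intro CollectI exI[of _ "frag_cmul m (frag_of ?P)"]) (simp add: divisor_degree_cmul_of)
  then show ?thesis
    by blast
qed

lemma pic_is_torsor_fermat: "pic_is_torsor Q m"
proof -
  have "galois_module galois_group (jacobian Q) galois_class"
    unfolding galois_module_def hom_def jacobian_simps
    using comm_group_jacobian pic_points_galois pic_points_galois_mult
    by (auto simp: galois_class_one galois_class_comp)
  moreover have "\<exists>!a. a \<in> pic_points Q 0 \<and> a \<star> x = y"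
    if "x \<in> pic_points Q m" "y \<in> pic_points Q m" for x y
    using pic_points_transitive[OF that] by simp
  moreover have "a \<star> x \<in> pic_points Q m"
    if "a \<in> pic_points Q 0" "x \<in> pic_points Q m" for a x
    using pic_points_mult[OF that] by simp
  ultimately show ?thesis
    unfolding pic_is_torsor_def galois_torsor_def jacobian_simps base_change_fermat
    using pic_points_nonempty pic_points_galois pic_points_one_mult pic_points_mult_assoc pic_points_galois_mult
    by (intro conjI ballI) (simp_all add: galois_class_one galois_class_comp)
qed

lemma odd_no_rational_points:
  assumes "odd m"
  shows "pic_rational_points Q m = {}"
proof (rule equals0I)
  fix c assume c: "c \<in> pic_rational_points Q m"
  obtain \<kappa> where \<kappa>: "real_structure \<kappa>" "\<kappa> \<in> carrier galois_group"
    by (rule complex_conjugation_exists)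
  interpret real_structure \<kappa>
    by (rule \<kappa>(1))
  obtain D where D: "c = cl D" "on_curve D" "divisor_degree D = m"
    using c unfolding pic_rational_points_def pic_points_eq by blast
  have "galois_class \<kappa> c = c"
    using c \<kappa>(2) by (simp add: pic_rational_points_def)
  then have "galois_divisor \<kappa> D - D \<in> N"
    unfolding D(1) galois_class_cl[OF \<kappa>(2)] cl_eq_iff .
  then obtain e F H where FH: "homogeneous e F" "homogeneous e H" "\<not> Q dvd F" "\<not> Q dvd H"
    and l: "\<forall>P\<in>curve. lookup (galois_divisor \<kappa> D - D) P = int (val P F) - int (val P H)"
    unfolding N_def principal_divisors_iff by blast
  have "lookup D (cp P) - lookup D P = int (val P F) - int (val P H)"
    if P: "P \<in> curve" for P
  proof -
    \<comment> \<open>The conjugate divisor has at the image of a point the coefficient of that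
      point; since \<open>cp\<close> is an involution, its coefficient at P is that of D at
      \<open>cp P\<close>.\<close>
    have "lookup (galois_divisor \<kappa> D) (cp (cp P)) = lookup D (cp P)"
      using lookup_galois_divisor[OF \<kappa>(2) D(2) cp_curve[OF P]] by (simp add: galois_point_eq[OF \<kappa>(2)] cp_def)
    then show ?thesis
      using bspec[OF l P] by (simp add: cp_cp lookup_minus)
  qed
  then have "even (\<Sum>P\<in>keys D. lookup D P)"
    using D(2) by (intro invariant_class_even_degree[OF FH(1,3) FH(2,4)]) (auto simp: in_keys_iff)
  then show False
    using D(3) assms by (simp add: divisor_degree_def)
qed

text \<open>The neutral class is fixed by every automorphism, hence so is its image under an
  equivariant bijection.\<close>

lemma trivial_torsor_imp_rational_point:
  assumes "pic_is_trivial_torsor Q m"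
  shows "pic_rational_points Q m \<noteq> {}"
proof -
  obtain \<phi> where \<phi>: "bij_betw \<phi> (pic_points Q 0) (pic_points Q m)"
    "\<And>\<sigma> a. \<sigma> \<in> carrier galois_group \<Longrightarrow> a \<in> pic_points Q 0 \<Longrightarrow> \<phi> (galois_class \<sigma> a) = galois_class \<sigma> (\<phi> a)"
    using assms unfolding pic_is_trivial_torsor_def trivial_galois_torsor_def jacobian_simps by blast
  have one: "cl 0 \<in> pic_points Q 0"
    using pic_points_one by (simp add: cl_0)
  then have "\<phi> (cl 0) \<in> pic_points Q m"
    using \<phi>(1) by (auto simp: bij_betw_def)
  moreover have "galois_class \<sigma> (\<phi> (cl 0)) = \<phi> (cl 0)" if "\<sigma> \<in> carrier galois_group" for \<sigma>
    using \<phi>(2)[OF that one] by (simp add: galois_class_cl[OF that] galois_divisor_0)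
  ultimately show ?thesis
    by (auto simp: pic_rational_points_def)
qed

end

theorem theorem1p2:
  fixes d :: int
  shows "pic_rational_points fermat_quartic (2 * d + 1) = {} \<and>
         pic_is_torsor fermat_quartic (2 * d + 1) \<and>
         \<not> pic_is_trivial_torsor fermat_quartic (2 * d + 1)"
  using odd_no_rational_points[of "2 * d + 1"] pic_is_torsor_fermat trivial_torsor_imp_rational_point by auto

end
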